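(* Let $k$ be an algebraically closed field of characteristic $p>3!$, and let $\mathrm{Hilb}^3(\mathbb{A}^2_k)$ be equipped with the Frobenius splitting induced from the standard splitting of $\mathbb{A}^2_k$. The compatibly split subvarieties of $\mathrm{Hilb}^3(\mathbb{A}^2_k)$ which are contained inside the punctual Hilbert scheme $\mathrm{Hilb}^3_0(\mathbb{A}^2_k)$ are precisely the following: 1. $Y=\{\langle y^3,xy,x^2,ay^2+bx\rangle : [a,b]\in \mathbb{P}^1_k\}$; 2. $Y=\{\langle y^2,xy,x^3,ax^2+by\rangle : [a,b]\in \mathbb{P}^1_k\}$; 3. $Y$ is one of the three points $\{\langle x,y^3\rangle\}$, $\{\langle x^2,xy,y^2\rangle\}$, $\{\langle x^3,y\rangle\}$.
   Context: Points of $\mathrm{Hilb}^n(\mathbb{A}^2_k)$ are written as colength-$n$ ideals of $k[x,y]$; $\mathrm{Hilb}^n_0(\mathbb{A}^2_k)$ is the closed locus of ideals whose subscheme is supported at the origin. Subvarieties are closed, reduced and irreducible. A Frobenius splitting of a $k$-scheme $X$ is an $\mathcal{O}_X$-linear map $\phi:F_*\mathcal{O}_X\to\mathcal{O}_X$ with $\phi\circ F^\sharp=\mathrm{id}$; a closed subscheme $Y$ is compatibly split if $\phi(F_*\mathcal{I}_Y)\subseteq\mathcal{I}_Y$. The standard splitting of $\mathbb{A}^N_k=\mathrm{Spec}\,k[z_1,\dots,z_N]$ is $\mathrm{Tr}((z_1\cdots z_N)^{p-1}\cdot)$, where $\mathrm{Tr}$ is additive, satisfies $\mathrm{Tr}(c^pg)=c\,\mathrm{Tr}(g)$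 for $c\in k$, and sends a monomial $m$ to $(z_1\cdots z_N m)^{1/p}/(z_1\cdots z_N)$ if $z_1\cdots z_Nm$ is a $p$-th power and to $0$ otherwise. The standard splitting of $(\mathbb{A}^2_k)^n$ preserves $S_n$-invariants, hence induces a splitting of $(\mathbb{A}^2_k)^n/S_n$; the induced splitting of $\mathrm{Hilb}^n(\mathbb{A}^2_k)$ is the unique splitting agreeing with it on the open locus of $n$ distinct points. *)

theory Defs
  imports "HOL-Analysis.Analysis" "HOL-Library.Poly_Mapping" "HOL-Library.Numeral_Type"
    "HOL-Library.Multiset" "HOL-Computational_Algebra.Computational_Algebra"
begin

type_synonym 'v expo = "'v \<Rightarrow>\<^sub>0 nat"
type_synonym ('v, 'k) mpol = "'v expo \<Rightarrow>\<^sub>0 'k"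

definition monom :: "'v expo \<Rightarrow> ('v, 'k::comm_ring_1) mpol" where
  "monom m = Poly_Mapping.single m 1"

definition Const :: "'k::comm_ring_1 \<Rightarrow> ('v, 'k) mpol" where
  "Const c = Poly_Mapping.single 0 c"

definition Var :: "'v \<Rightarrow> ('v, 'k::comm_ring_1) mpol" where
  "Var v = monom (Poly_Mapping.single v 1)"

definition eval :: "('v, 'k::comm_ring_1) mpol \<Rightarrow> ('v \<Rightarrow> 'k) \<Rightarrow> 'k" where
  "eval P q = (\<Sum>m\<in>Poly_Mapping.keys P. Poly_Mapping.lookup P m *
                (\<Prod>v\<in>Poly_Mapping.keys m. q v ^ Poly_Mapping.lookup m v))"

text \<open>
  Over an algebraically closed field a reduced scheme of finite type is determined by its closed
  points together with its sheaf of \<open>k\<close>-valued regular functions. Such a space is given here by an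
  affine atlas: a set of pairs \<open>(W, A)\<close>, where \<open>W\<close> is (the point set of) an affine open subset and
  \<open>A\<close> is its coordinate ring, a ring of functions on \<open>W\<close>. Only the values on \<open>W\<close> of the elements
  of \<open>A\<close> matter.
\<close>

type_synonym ('p, 'k) atlas = "('p set \<times> ('p \<Rightarrow> 'k) set) set"

definition zariski :: "('p, 'k::field) atlas \<Rightarrow> 'p topology" where
  "zariski \<A> = topology_generated_by
     {{x \<in> W. h x \<noteq> 0} | W A h. (W, A) \<in> \<A> \<and> h \<in> A}"

text \<open>
  The sections over \<open>U\<close> of the structure sheaf: functions that are locally fractions. A section
  over \<open>U\<close> is represented by its extension by zero outside \<open>U\<close>.
\<close>

definition regular :: "('p, 'k::field) atlas \<Rightarrow> 'p set \<Rightarrow> ('p \<Rightarrow> 'k) set" where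
  "regular \<A> U = {f. (\<forall>x. x \<notin> U \<longrightarrow> f x = 0) \<and>
     (\<forall>x\<in>U. \<exists>W A g h. (W, A) \<in> \<A> \<and> g \<in> A \<and> h \<in> A \<and> x \<in> W \<and> h x \<noteq> 0 \<and>
        (\<forall>y\<in>U \<inter> W. h y \<noteq> 0 \<longrightarrow> f y = g y / h y))}"

definition cut :: "'p set \<Rightarrow> ('p \<Rightarrow> 'k::zero) \<Rightarrow> 'p \<Rightarrow> 'k" where
  "cut U f = (\<lambda>x. if x \<in> U then f x else 0)"

definition subvariety :: "('p, 'k::field) atlas \<Rightarrow> 'p set \<Rightarrow> bool" where
  "subvariety \<A> Y \<longleftrightarrow> closedin (zariski \<A>) Y \<and> Y \<noteq> {} \<and>
     (\<forall>C D. closedin (zariski \<A>) C \<and> closedin (zariski \<A>) D \<and> Y \<subseteq> C \<union> D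
            \<longrightarrow> Y \<subseteq> C \<or> Y \<subseteq> D)"

text \<open>
  The absolute Frobenius is the identity on points, so the sections of the push-forward of the
  structure sheaf over \<open>U\<close> are again \<open>regular \<A> U\<close>, with \<open>f\<close> acting as multiplication by the
  \<open>p\<close>-th power of \<open>f\<close>.
\<close>

type_synonym ('p, 'k) sheaf_map = "'p set \<Rightarrow> ('p \<Rightarrow> 'k) \<Rightarrow> ('p \<Rightarrow> 'k)"

definition frobenius_splitting ::
    "('p, 'k::field) atlas \<Rightarrow> ('p, 'k) sheaf_map \<Rightarrow> bool" where
  "frobenius_splitting \<A> \<phi> \<longleftrightarrow>
     (\<forall>U. openin (zariski \<A>) U \<longrightarrow>
        (\<forall>f\<in>regular \<A> U. \<phi> U f \<in> regular \<A> U) \<and>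
        (\<forall>f\<in>regular \<A> U. \<forall>g\<in>regular \<A> U. \<phi> U (\<lambda>x. f x + g x) = (\<lambda>x. \<phi> U f x + \<phi> U g x)) \<and>
        (\<forall>f\<in>regular \<A> U. \<forall>g\<in>regular \<A> U.
           \<phi> U (\<lambda>x. f x ^ CHAR('k) * g x) = (\<lambda>x. f x * \<phi> U g x)) \<and>
        (\<forall>V. openin (zariski \<A>) V \<and> V \<subseteq> U \<longrightarrow>
           (\<forall>f\<in>regular \<A> U. \<phi> V (cut V f) = cut V (\<phi> U f))) \<and>
        (\<forall>f\<in>regular \<A> U. \<phi> U (\<lambda>x. f x ^ CHAR('k)) = f))"

text \<open>
  \<open>Y\<close> carries its reduced structure: its ideal sheaf consists of the sections vanishing on \<open>Y\<close>.
\<close>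

definition ideal_sheaf :: "('p, 'k::field) atlas \<Rightarrow> 'p set \<Rightarrow> 'p set \<Rightarrow> ('p \<Rightarrow> 'k) set" where
  "ideal_sheaf \<A> Y U = {f \<in> regular \<A> U. \<forall>x\<in>Y \<inter> U. f x = 0}"

definition compatibly_split ::
    "('p, 'k::field) atlas \<Rightarrow> ('p, 'k) sheaf_map \<Rightarrow> 'p set \<Rightarrow> bool" where
  "compatibly_split \<A> \<phi> Y \<longleftrightarrow>
     (\<forall>U. openin (zariski \<A>) U \<longrightarrow> \<phi> U ` ideal_sheaf \<A> Y U \<subseteq> ideal_sheaf \<A> Y U)"

definition affine_space :: "('v::finite \<Rightarrow> 'k::field, 'k) atlas" where
  "affine_space = {(UNIV, range eval)}"

definition proot :: "'k::field \<Rightarrow> 'k" where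
  "proot c = (THE r. r ^ CHAR('k) = c)"

text \<open>
  The product of all variables times the monomial with exponent \<open>m\<close> is a \<open>p\<close>-th power iff \<open>p\<close>
  divides every \<open>m v + 1\<close>; extracting the root and dividing by the product of the variables leaves
  the exponent \<open>(m v + 1) / p - 1\<close>, which is nonnegative.
\<close>

definition Tr_monom :: "'v::finite expo \<Rightarrow> ('v, 'k::field) mpol" where
  "Tr_monom m =
     (if \<forall>v. CHAR('k) dvd Poly_Mapping.lookup m v + 1
      then monom (Abs_poly_mapping (\<lambda>v. (Poly_Mapping.lookup m v + 1) div CHAR('k) - 1))
      else 0)"

definition Tr :: "('v::finite, 'k::field) mpol \<Rightarrow> ('v, 'k) mpol" where
  "Tr P = (\<Sum>m\<in>Poly_Mapping.keys P. Const (proot (Poly_Mapping.lookup P m)) * Tr_monom m)"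

text \<open>A sheaf map on an affine scheme is determined by its action on global sections.\<close>

definition standard_splitting :: "('v::finite \<Rightarrow> 'k::field, 'k) sheaf_map \<Rightarrow> bool" where
  "standard_splitting \<psi> \<longleftrightarrow> frobenius_splitting affine_space \<psi> \<and>
     (\<forall>P. \<psi> UNIV (eval P) = eval (Tr ((\<Prod>v\<in>UNIV. Var v) ^ (CHAR('k) - 1) * P)))"

datatype coord = X | Y

instance coord :: finite
proof
  have "(UNIV :: coord set) \<subseteq> {X, Y}"
    using coord.exhaust by blast
  then show "finite (UNIV :: coord set)"
    by (rule finite_subset) simp
qed

text \<open>
  An \<open>n\<close>-tuple of points of the plane is a point of the affine space with coordinates indexed by
  \<open>'n \<times> coord\<close>, where \<open>n = CARD('n)\<close>. Its orbit under the symmetric group is the multiset of its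
  entries, and the coordinate ring of the quotient is the ring of invariant polynomials.
\<close>

definition orbit :: "('n::finite \<times> coord \<Rightarrow> 'k) \<Rightarrow> (coord \<Rightarrow> 'k) multiset" where
  "orbit q = image_mset (\<lambda>i. (\<lambda>c. q (i, c))) (mset_set UNIV)"

definition sym_product :: "'n::finite itself \<Rightarrow> ((coord \<Rightarrow> 'k::field) multiset, 'k) atlas" where
  "sym_product _ = {(range (orbit :: ('n \<times> coord \<Rightarrow> 'k) \<Rightarrow> _),
      {f. f \<circ> (orbit :: ('n \<times> coord \<Rightarrow> 'k) \<Rightarrow> _) \<in> range eval})}"

definition quotient_splitting ::
    "('n::finite \<times> coord \<Rightarrow> 'k::field, 'k) sheaf_map \<Rightarrow>
     ((coord \<Rightarrow> 'k) multiset, 'k) sheaf_map \<Rightarrow> bool" where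
  "quotient_splitting \<psi> \<sigma> \<longleftrightarrow> frobenius_splitting (sym_product TYPE('n)) \<sigma> \<and>
     (\<forall>U. openin (zariski (sym_product TYPE('n) :: (_, 'k) atlas)) U \<longrightarrow>
        (\<forall>f\<in>regular (sym_product TYPE('n)) U. \<sigma> U f \<circ> orbit = \<psi> (orbit -` U) (f \<circ> orbit)))"

text \<open>Ideals are the submodules of the ring as a module over itself.\<close>

definition is_ideal :: "(coord, 'k::field) mpol set \<Rightarrow> bool" where
  "is_ideal = module.subspace (*)"

definition ideal_gen :: "(coord, 'k::field) mpol set \<Rightarrow> (coord, 'k) mpol set" where
  "ideal_gen = module.span (*)"

text \<open>\<open>basis_mod I B\<close>: the classes of the elements of \<open>B\<close> form a \<open>k\<close>-basis of the quotient by \<open>I\<close>.\<close>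

definition expansion_mod :: "(coord, 'k::field) mpol set \<Rightarrow> (coord, 'k) mpol set \<Rightarrow>
    (coord, 'k) mpol \<Rightarrow> ((coord, 'k) mpol \<Rightarrow> 'k) \<Rightarrow> bool" where
  "expansion_mod I B f c \<longleftrightarrow>
     (\<forall>b. b \<notin> B \<longrightarrow> c b = 0) \<and> f - (\<Sum>b\<in>B. Const (c b) * b) \<in> I"

definition basis_mod :: "(coord, 'k::field) mpol set \<Rightarrow> (coord, 'k) mpol set \<Rightarrow> bool" where
  "basis_mod I B \<longleftrightarrow> finite B \<and> (\<forall>f. \<exists>!c. expansion_mod I B f c)"

definition Hilb :: "nat \<Rightarrow> (coord, 'k::field) mpol set set" where
  "Hilb n = {I. is_ideal I \<and> (\<exists>B. basis_mod I B \<and> card B = n)}"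

definition zeros :: "(coord, 'k::field) mpol set \<Rightarrow> (coord \<Rightarrow> 'k) set" where
  "zeros I = {a. \<forall>f\<in>I. eval f a = 0}"

definition punctual_Hilb :: "nat \<Rightarrow> (coord, 'k::field) mpol set set" where
  "punctual_Hilb n = {I \<in> Hilb n. zeros I \<subseteq> {\<lambda>_. 0}}"

text \<open>
  The affine charts: for a set \<open>B\<close> of \<open>n\<close> monomials, the ideals modulo which \<open>B\<close> is a basis. The
  coordinate ring is generated by the coefficients, as functions of the ideal, of the expansions
  of all monomials in terms of \<open>B\<close>.
\<close>

definition chart :: "coord expo set \<Rightarrow> (coord, 'k::field) mpol set set" where
  "chart B = {I. is_ideal I \<and> basis_mod I (monom ` B)}"

definition chart_coeff ::
    "coord expo set \<Rightarrow> (coord, 'k::field) mpol set \<Rightarrow> coord expo \<times> coord expo \<Rightarrow> 'k" where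
  "chart_coeff B I = (\<lambda>(m, b). (THE c. expansion_mod I (monom ` B) (monom m) c) (monom b))"

definition chart_ring :: "coord expo set \<Rightarrow> ((coord, 'k::field) mpol set \<Rightarrow> 'k) set" where
  "chart_ring B = {\<lambda>I. eval P (chart_coeff B I) | P. True}"

definition hilb_scheme :: "nat \<Rightarrow> ((coord, 'k::field) mpol set, 'k) atlas" where
  "hilb_scheme n = {(chart B, chart_ring B) | B. finite B \<and> card B = n}"

text \<open>
  On the open locus of \<open>n\<close> distinct points, an ideal is identified with the point of the symmetric
  product given by its zero set.
\<close>

definition distinct_locus :: "nat \<Rightarrow> (coord, 'k::field) mpol set set" where
  "distinct_locus n = {I \<in> Hilb n. finite (zeros I) \<and> card (zeros I) = n}"

definition cycle :: "(coord, 'k::field) mpol set \<Rightarrow> (coord \<Rightarrow> 'k) multiset" where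
  "cycle I = mset_set (zeros I)"

definition agrees_on_distinct_locus :: "'n::finite itself \<Rightarrow>
    ((coord \<Rightarrow> 'k::field) multiset, 'k) sheaf_map \<Rightarrow>
    ((coord, 'k) mpol set, 'k) sheaf_map \<Rightarrow> bool" where
  "agrees_on_distinct_locus _ \<sigma> \<phi> \<longleftrightarrow>
     (\<forall>U. openin (zariski (sym_product TYPE('n) :: (_, 'k) atlas)) U \<and>
          (\<forall>M\<in>U. \<forall>a. count M a \<le> 1) \<longrightarrow>
        (\<forall>f\<in>regular (sym_product TYPE('n)) U.
           let V = {I \<in> distinct_locus CARD('n). cycle I \<in> U}
           in \<phi> V (cut V (f \<circ> cycle)) = cut V (\<sigma> U f \<circ> cycle)))"

definition induced_splitting :: "'n::finite itself \<Rightarrow>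
    ((coord \<Rightarrow> 'k::field) multiset, 'k) sheaf_map \<Rightarrow>
    ((coord, 'k) mpol set, 'k) sheaf_map \<Rightarrow> bool" where
  "induced_splitting N \<sigma> \<phi> \<longleftrightarrow>
     frobenius_splitting (hilb_scheme CARD('n)) \<phi> \<and> agrees_on_distinct_locus N \<sigma> \<phi>"

end

theory Submission
  imports Defs
begin

text \<open>
  The splitting sends \<open>c z\<^sup>m\<close> to \<open>c\<^sup>1\<^sup>/\<^sup>p z\<^sup>m\<^sup>/\<^sup>p\<close> on triples of points, so it divides torus weights
  by \<open>p\<close>. Near each point of the two curves, and near each of the three fixed points, a
  one-parameter torus with nonnegative weights contracts an affine chart onto the curve or point;
  its ideal is then spanned by functions of positive weight, and the splitting preserves it.

  Conversely, on the chart \<open>u = a + b v + c v\<^sup>2\<close>, \<open>v\<^sup>3 = d v\<^sup>2 + e v + f\<close> the splitting maps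
  \<open>d b\<^sup>p\<^sup>-\<^sup>1 c\<close> to \<open>- b\<close>. Since \<open>d\<close> vanishes on punctual ideals, so does \<open>b\<close> on any compatibly split
  punctual subvariety, which leaves only the two curves. A point \<open>c = c\<^sub>0\<close> of a curve is excluded
  unless \<open>c\<^sub>0 = 0\<close>, because the splitting maps \<open>c\<^sup>p\<^sup>-\<^sup>1 (c - c\<^sub>0)\<close> to \<open>c\<close>.
\<close>

text \<open>The splitting \<open>\<phi>\<close> is known only on triples of distinct points, while
  all ideals in question lie on the boundary of that locus. Its value at a boundary ideal
  \<open>J\<close> is always found by joining \<open>J\<close> to such triples in a family whose
  chart coordinates are polynomials in \<open>t\<close>: a regular function is a fraction of
  polynomials along the family, so its value at \<open>t = 0\<close> is forced by the others.
  Irreducibility of the Hilbert scheme is bypassed in this way.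

  The function d b^(p-1) c is chosen for its denominator. On triples, b and c are determinants B and
  C divided by the Vandermonde determinant D in v, so b^(p-1) c = B^(p-1) C / D^p, and Frobenius
  linearity takes D^p out as D. Expanding C along the u-coordinates, the i-th summand of d B^(p-1) C
  survives only in the top power of u_i. There B contributes (v_j^2 - v_k^2)^(p-1) and C contributes
  v_k - v_j; the factor d = v_1 + v_2 + v_3 supplies the missing v_j + v_k that completes a p-th
  power, and its remaining term is of degree one in v_i and is killed.\<close>

abbreviation lookup where "lookup \<equiv> Poly_Mapping.lookup"
abbreviation keys where "keys \<equiv> Poly_Mapping.keys"

subsection \<open>Polynomial functions\<close>

definition mval :: "('v \<Rightarrow> 'k::comm_ring_1) \<Rightarrow> 'v expo \<Rightarrow> 'k" where
  "mval q m = (\<Prod>v\<in>keys m. q v ^ lookup m v)"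

lemma mval_superset: "finite S \<Longrightarrow> keys m \<subseteq> S \<Longrightarrow> mval q m = (\<Prod>v\<in>S. q v ^ lookup m v)"
  unfolding mval_def by (rule prod.mono_neutral_left) (auto simp: in_keys_iff)

lemma mval_0 [simp]: "mval q 0 = 1"
  by (simp add: mval_def)

lemma mval_add: "mval q (m + n) = mval q m * mval q n"
proof -
  let ?S = "keys m \<union> keys n"
  have "mval q (m + n) = (\<Prod>v\<in>?S. q v ^ lookup (m + n) v)"
    by (rule mval_superset) (use Poly_Mapping.keys_add[of m n] in auto)
  also have "\<dots> = (\<Prod>v\<in>?S. q v ^ lookup m v) * (\<Prod>v\<in>?S. q v ^ lookup n v)"
    by (simp add: lookup_add power_add prod.distrib)
  also have "\<dots> = mval q m * mval q n"
    by (subst (1 2) mval_superset[where S = ?S]) auto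
  finally show ?thesis .
qed

lemma mval_single [simp]: "mval q (Poly_Mapping.single v n) = q v ^ n"
  by (cases "n = 0") (auto simp: mval_def)

lemma eval_superset:
  assumes "finite S" "keys P \<subseteq> S"
  shows "eval P q = (\<Sum>m\<in>S. lookup P m * mval q m)"
proof -
  have "eval P q = (\<Sum>m\<in>keys P. lookup P m * mval q m)" by (simp add: eval_def mval_def)
  also have "\<dots> = (\<Sum>m\<in>S. lookup P m * mval q m)"
    by (rule sum.mono_neutral_left) (use assms in \<open>auto simp: in_keys_iff\<close>)
  finally show ?thesis .
qed

lemma eval_0 [simp]: "eval 0 q = 0"
  by (simp add: eval_def)

lemma eval_add [simp]: "eval (P + Q) q = eval P q + eval Q q"
proof -
  let ?S = "keys P \<union> keys Q"
  have "eval (P + Q) q = (\<Sum>m\<in>?S. lookup (P + Q) m * mval q m)"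
    by (rule eval_superset) (use Poly_Mapping.keys_add[of P Q] in auto)
  also have "\<dots> = (\<Sum>m\<in>?S. lookup P m * mval q m) + (\<Sum>m\<in>?S. lookup Q m * mval q m)"
    by (simp add: lookup_add algebra_simps sum.distrib)
  also have "\<dots> = eval P q + eval Q q"
    by (subst (1 2) eval_superset[where S = ?S]) auto
  finally show ?thesis .
qed

lemma eval_single [simp]: "eval (Poly_Mapping.single m c) q = c * mval q m"
  by (cases "c = 0") (simp_all add: eval_def mval_def)

lemma mpol_induct [case_names zero add]:
  fixes P :: "('v, 'k::comm_ring_1) mpol"
  assumes "R 0" and step: "\<And>m c P. R P \<Longrightarrow> R (Poly_Mapping.single m c + P)"
  shows "R P"
proof (induction P rule: update_induct)
  case const
  show ?case by fact
next
  case (update f a b)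
  then have "Poly_Mapping.update a b f = Poly_Mapping.single a b + f"
    by (intro poly_mapping_eqI)
      (auto simp: Poly_Mapping.lookup_update lookup_add lookup_single when_def in_keys_iff)
  with step[OF update(3)] show ?case by simp
qed

lemma eval_mult [simp]: "eval (P * Q) q = eval P q * eval Q q"
proof (induction P rule: mpol_induct)
  case (add m c P)
  have "eval (Poly_Mapping.single m c * Q) q = c * mval q m * eval Q q"
  proof (induction Q rule: mpol_induct)
    case (add n d Q)
    then show ?case by (simp add: distrib_left mult_single mval_add algebra_simps)
  qed simp
  with add show ?case by (simp add: distrib_right)
qed simp

lemma eval_monom [simp]: "eval (monom m) q = mval q m"
  by (simp add: monom_def)

lemma eval_Const [simp]: "eval (Const c) q = c"
  by (simp add: Const_def)

lemma eval_Var [simp]: "eval (Var v) q = q v"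
  by (simp add: Var_def)

lemma eval_1 [simp]: "eval 1 q = 1"
  using eval_single[of 0 1 q] by simp

lemma eval_uminus [simp]: "eval (- P) q = - eval P q"
  using eval_add[of P "- P" q] by (simp add: add_eq_0_iff)

lemma eval_diff [simp]: "eval (P - Q) q = eval P q - eval Q q"
  using eval_add[of P "- Q" q] by simp

lemma eval_power [simp]: "eval (P ^ n) q = eval P q ^ n"
  by (induction n) auto

lemma eval_sum [simp]: "eval (sum P S) q = (\<Sum>i\<in>S. eval (P i) q)"
  by (induction S rule: infinite_finite_induct) auto

lemma eval_prod [simp]: "eval (prod P S) q = (\<Prod>i\<in>S. eval (P i) q)"
  by (induction S rule: infinite_finite_induct) auto

lemma monom_0 [simp]: "monom 0 = 1"
  by (simp add: monom_def)

lemma monom_add: "monom (m + n) = monom m * monom n"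
  by (simp add: monom_def mult_single)

lemma lookup_monom: "lookup (monom m :: ('v, 'k::comm_ring_1) mpol) n = (if m = n then 1 else 0)"
  by (simp add: monom_def lookup_single when_def)

lemma monom_eq_iff [simp]: "(monom m :: ('v, 'k::field) mpol) = monom n \<longleftrightarrow> m = n"
  by (metis lookup_monom zero_neq_one)

lemma Const_0 [simp]: "Const 0 = 0"
  and Const_1 [simp]: "Const 1 = 1"
  and Const_add: "Const (a + b) = Const a + Const b"
  and Const_mult: "Const (a * b) = Const a * Const b"
  and Const_diff: "Const (a - b) = Const a - Const b"
  and Const_uminus: "Const (- a) = - Const a"
  by (simp_all add: Const_def mult_single single_add single_diff single_uminus)

lemma single_eq_Const_monom: "Poly_Mapping.single m c = Const c * monom m"
  by (simp add: Const_def monom_def mult_single)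

lemma lookup_Const_mult [simp]:
  fixes P :: "('v, 'k::comm_ring_1) mpol"
  shows "lookup (Const c * P) m = c * lookup P m"
proof (induction P rule: mpol_induct)
  case (add n d P)
  have "Const c * Poly_Mapping.single n d = Poly_Mapping.single n (c * d)"
    by (simp add: Const_def mult_single)
  with add show ?case
    by (simp add: distrib_left lookup_add lookup_single when_def)
qed simp

text \<open>The atlases give coordinate rings as images of \<open>eval\<close>; this inductive
  description provides closure rules and an induction principle for them, see
  \<open>range_eval_comp\<close>.\<close>

inductive_set alg :: "('a \<Rightarrow> 'k::comm_ring_1) set \<Rightarrow> ('a \<Rightarrow> 'k) set" for G where
  const: "(\<lambda>_. c) \<in> alg G"
| gen: "g \<in> G \<Longrightarrow> g \<in> alg G"
| add: "f \<in> alg G \<Longrightarrow> g \<in> alg G \<Longrightarrow> (\<lambda>x. f x + g x) \<in> alg G"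
| mult: "f \<in> alg G \<Longrightarrow> g \<in> alg G \<Longrightarrow> (\<lambda>x. f x * g x) \<in> alg G"

lemma alg_uminus: "f \<in> alg G \<Longrightarrow> (\<lambda>x. - f x) \<in> alg G"
  using alg.mult[OF alg.const[of "-1"]] by fastforce

lemma alg_diff: "f \<in> alg G \<Longrightarrow> g \<in> alg G \<Longrightarrow> (\<lambda>x. f x - g x) \<in> alg G"
  using alg.add[OF _ alg_uminus] by fastforce

lemma alg_power: "f \<in> alg G \<Longrightarrow> (\<lambda>x. f x ^ n) \<in> alg G"
  by (induction n) (auto intro: alg.const alg.mult)

lemma alg_sum: "(\<And>i. i \<in> S \<Longrightarrow> f i \<in> alg G) \<Longrightarrow> (\<lambda>x. \<Sum>i\<in>S. f i x) \<in> alg G"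
  by (induction S rule: infinite_finite_induct) (auto intro: alg.const alg.add)

lemma alg_prod: "(\<And>i. i \<in> S \<Longrightarrow> f i \<in> alg G) \<Longrightarrow> (\<lambda>x. \<Prod>i\<in>S. f i x) \<in> alg G"
  by (induction S rule: infinite_finite_induct) (auto intro: alg.const alg.mult)

lemmas alg_intros = alg.const alg.add alg.mult alg_uminus alg_diff alg_power alg_sum alg_prod

lemma alg_det:
  fixes A :: "'a \<Rightarrow> 'k::comm_ring_1^'n^'n"
  assumes "\<And>i j. (\<lambda>x. A x $ i $ j) \<in> alg G"
  shows "(\<lambda>x. det (A x)) \<in> alg G"
  unfolding det_def by (intro alg_intros assms)

lemma range_eval_comp: "range (\<lambda>P x. eval P (c x)) = alg (range (\<lambda>v x. c x v))"
proof (intro set_eqI iffI)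
  fix f assume "f \<in> range (\<lambda>P x. eval P (c x))"
  then obtain P where f: "f = (\<lambda>x. eval P (c x))" by auto
  show "f \<in> alg (range (\<lambda>v x. c x v))"
    unfolding f eval_def by (intro alg_intros alg.gen) auto
next
  fix f assume "f \<in> alg (range (\<lambda>v x. c x v))"
  then have "\<exists>P. f = (\<lambda>x. eval P (c x))"
  proof induction
    case (const a)
    have "(\<lambda>_. a) = (\<lambda>x. eval (Const a) (c x))" by simp
    then show ?case by blast
  next
    case (gen g)
    then obtain v where "g = (\<lambda>x. eval (Var v) (c x))" by auto
    then show ?case by blast
  next
    case (add f g)
    then obtain P Q where "f = (\<lambda>x. eval P (c x))" "g = (\<lambda>x. eval Q (c x))" by blast
    then have "(\<lambda>x. f x + g x) = (\<lambda>x. eval (P + Q) (c x))" by simp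
    then show ?case by blast
  next
    case (mult f g)
    then obtain P Q where "f = (\<lambda>x. eval P (c x))" "g = (\<lambda>x. eval Q (c x))" by blast
    then have "(\<lambda>x. f x * g x) = (\<lambda>x. eval (P * Q) (c x))" by simp
    then show ?case by blast
  qed
  then show "f \<in> range (\<lambda>P x. eval P (c x))" by blast
qed

lemma chart_ring_alg: "chart_ring B = alg (range (\<lambda>v I. chart_coeff B I v))"
  by (subst range_eval_comp[symmetric]) (auto simp: chart_ring_def)

lemma range_eval_alg: "range eval = alg (range (\<lambda>v q. q v))"
  by (subst range_eval_comp[symmetric]) simp

text \<open>Functions of the parameter of a one-parameter family. A coordinate ring restricted to a
  family with polynomial coordinates consists of such functions, see
  \<open>polyfun_alg\<close>.\<close>

definition polyfun :: "('k::comm_ring_1 \<Rightarrow> 'k) \<Rightarrow> bool" where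
  "polyfun f \<longleftrightarrow> (\<exists>p. f = poly p)"

lemma polyfun_const: "polyfun (\<lambda>_. c)"
  unfolding polyfun_def by (rule exI[of _ "[:c:]"]) auto

lemma polyfun_id: "polyfun (\<lambda>t. t)"
  unfolding polyfun_def by (rule exI[of _ "[:0, 1:]"]) auto

lemma polyfun_add: "polyfun f \<Longrightarrow> polyfun g \<Longrightarrow> polyfun (\<lambda>t. f t + g t)"
  unfolding polyfun_def by (elim exE, rule_tac x = "p + pa" in exI) (auto simp: poly_pcompose)

lemma polyfun_mult: "polyfun f \<Longrightarrow> polyfun g \<Longrightarrow> polyfun (\<lambda>t. f t * g t)"
  unfolding polyfun_def by (elim exE, rule_tac x = "p * pa" in exI) (auto simp: poly_pcompose)

lemma polyfun_diff: "polyfun f \<Longrightarrow> polyfun g \<Longrightarrow> polyfun (\<lambda>t. f t - g t)"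
  unfolding polyfun_def by (elim exE, rule_tac x = "p - pa" in exI) (auto simp: poly_pcompose)

lemma polyfun_power: "polyfun f \<Longrightarrow> polyfun (\<lambda>t. f t ^ n)"
  by (induction n) (auto intro: polyfun_const polyfun_mult)

lemma polyfun_sum: "(\<And>i. i \<in> S \<Longrightarrow> polyfun (f i)) \<Longrightarrow> polyfun (\<lambda>t. \<Sum>i\<in>S. f i t)"
  by (induction S rule: infinite_finite_induct) (auto intro: polyfun_const polyfun_add)

lemmas polyfun_intros =
  polyfun_const polyfun_id polyfun_add polyfun_mult polyfun_diff polyfun_power polyfun_sum

lemma polyfun_alg:
  assumes "g \<in> alg G" "\<And>h. h \<in> G \<Longrightarrow> polyfun (\<lambda>t. h (c t))"
  shows "polyfun (\<lambda>t. g (c t))"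
  using assms(1) by induction (auto intro: polyfun_intros assms(2))

lemma infinite_alg_closed: "infinite (UNIV :: 'k::alg_closed_field set)"
proof
  assume fin: "finite (UNIV :: 'k set)"
  \<comment> \<open>Over a finite field this polynomial would take the value 1 everywhere and so
    have no root.\<close>
  define P :: "'k poly" where "P = (\<Prod>a\<in>UNIV. [:- a, 1:]) + 1"
  have deg: "degree (\<Prod>a\<in>(UNIV::'k set). [:- a, 1:]) = card (UNIV :: 'k set)"
    by (subst degree_prod_eq_sum_degree) auto
  have "card (UNIV :: 'k set) > 0" using fin by (simp add: finite_UNIV_card_ge_0)
  then have "degree P > 0" unfolding P_def by (subst degree_add_eq_left) (auto simp: deg)
  then obtain x where "poly P x = 0" using alg_closed_imp_poly_has_root by blast
  moreover have "poly P x = 1"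
    unfolding P_def poly_add poly_prod using fin by (simp add: prod_zero_iff)
  ultimately show False by simp
qed

lemma polyfun_zeros: "polyfun f \<Longrightarrow> f (t0 :: 'k::idom) \<noteq> 0 \<Longrightarrow> finite {t. f t = 0}"
  unfolding polyfun_def by (auto intro!: poly_roots_finite)

text \<open>If \<open>f\<close> were not identically zero, the infinite field would be the union of
  the zeros of \<open>f\<close>, the zeros of \<open>g\<close> and \<open>E\<close>, three finite
  sets.\<close>

lemma polyfun_eq_0:
  fixes f g :: "'k::alg_closed_field \<Rightarrow> 'k"
  assumes "polyfun f" "polyfun g" "g s \<noteq> 0" "finite E"
    and "\<And>t. t \<notin> E \<Longrightarrow> g t \<noteq> 0 \<Longrightarrow> f t = 0"
  shows "f t = 0"
proof (rule ccontr)
  assume "f t \<noteq> 0"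
  then have "finite ({t. f t = 0} \<union> {t. g t = 0} \<union> E)"
    using polyfun_zeros[OF assms(1)] polyfun_zeros[OF assms(2,3)] assms(4) by blast
  moreover have "{t. f t = 0} \<union> {t. g t = 0} \<union> E = UNIV" using assms(5) by auto
  ultimately show False using infinite_alg_closed[where 'k='k] by simp
qed

subsection \<open>Ideals\<close>

lemma module_mult: "module ((*) :: 'a::comm_ring_1 \<Rightarrow> 'a \<Rightarrow> 'a)"
  by standard (auto simp: algebra_simps)

lemma is_ideal_iff:
  "is_ideal I \<longleftrightarrow> 0 \<in> I \<and> (\<forall>f\<in>I. \<forall>g\<in>I. f + g \<in> I) \<and> (\<forall>h. \<forall>f\<in>I. h * f \<in> I)"
  unfolding is_ideal_def module.subspace_def[OF module_mult] by blast

lemma ideal_0: "is_ideal I \<Longrightarrow> 0 \<in> I"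
  and ideal_add: "is_ideal I \<Longrightarrow> f \<in> I \<Longrightarrow> g \<in> I \<Longrightarrow> f + g \<in> I"
  and ideal_mult: "is_ideal I \<Longrightarrow> f \<in> I \<Longrightarrow> h * f \<in> I"
  by (auto simp: is_ideal_iff)

lemma ideal_mult_right: "is_ideal I \<Longrightarrow> f \<in> I \<Longrightarrow> f * h \<in> I"
  using ideal_mult[of I f h] by (simp add: mult.commute)

lemma ideal_uminus: "is_ideal I \<Longrightarrow> f \<in> I \<Longrightarrow> - f \<in> I"
  using ideal_mult[of I f "-1"] by simp

lemma ideal_diff: "is_ideal I \<Longrightarrow> f \<in> I \<Longrightarrow> g \<in> I \<Longrightarrow> f - g \<in> I"
  using ideal_add[of I f "- g"] ideal_uminus by fastforce

lemma ideal_sum: "is_ideal I \<Longrightarrow> (\<And>i. i \<in> S \<Longrightarrow> f i \<in> I) \<Longrightarrow> sum f S \<in> I"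
  by (induction S rule: infinite_finite_induct) (auto intro: ideal_0 ideal_add)

lemma is_ideal_gen: "is_ideal (ideal_gen S)"
  unfolding is_ideal_def ideal_gen_def by (rule module.subspace_span[OF module_mult])

lemma ideal_gen_base: "f \<in> S \<Longrightarrow> f \<in> ideal_gen S"
  unfolding ideal_gen_def by (rule module.span_base[OF module_mult])

lemma ideal_gen_minimal: "S \<subseteq> I \<Longrightarrow> is_ideal I \<Longrightarrow> ideal_gen S \<subseteq> I"
  unfolding ideal_gen_def is_ideal_def by (rule module.span_minimal[OF module_mult])

lemma monom_coord: "monom m = Var X ^ lookup m X * Var Y ^ lookup m Y"
proof -
  have *: "Var v ^ n = monom (Poly_Mapping.single v n)" for v :: coord and n
    by (induction n) (simp_all add: Var_def monom_add[symmetric] single_add[symmetric])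
  have "m = Poly_Mapping.single X (lookup m X) + Poly_Mapping.single Y (lookup m Y)"
    by (rule poly_mapping_eqI, rename_tac c, case_tac c)
      (auto simp: lookup_add lookup_single when_def)
  then show ?thesis by (metis * monom_add)
qed

lemma mpol_coord_closure:
  fixes S :: "(coord, 'k::comm_ring_1) mpol set"
  assumes "1 \<in> S" "\<And>f g. f \<in> S \<Longrightarrow> g \<in> S \<Longrightarrow> f + g \<in> S" "\<And>f c. f \<in> S \<Longrightarrow> Const c * f \<in> S"
    and "\<And>f c. f \<in> S \<Longrightarrow> Var c * f \<in> S"
  shows "f \<in> S"
proof -
  have pow: "f \<in> S \<Longrightarrow> Var c ^ n * f \<in> S" for f c n
    by (induction n) (auto simp: mult.assoc intro: assms)
  have mon: "monom m \<in> S" for m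
    using pow[OF pow[OF assms(1), of Y "lookup m Y"], of X "lookup m X"] by (simp add: monom_coord)
  show ?thesis
  proof (induction f rule: mpol_induct)
    case zero
    show ?case using assms(3)[OF assms(1), of 0] by simp
  qed (auto simp: single_eq_Const_monom intro: assms mon)
qed

no_notation fps_nth (infixl "$" 75)

subsection \<open>Bases of three-dimensional quotients\<close>

text \<open>Bases are families over the type \<open>3\<close> rather than sets, so that coefficients
  become vectors and changes of basis become matrices with determinants.\<close>

definition lin :: "(3 \<Rightarrow> (coord, 'k) mpol) \<Rightarrow> 'k::field^3 \<Rightarrow> (coord, 'k) mpol" where
  "lin e c = (\<Sum>j\<in>UNIV. Const (c $ j) * e j)"

lemma lin_0 [simp]: "lin e 0 = 0"
  and lin_add: "lin e (c + d) = lin e c + lin e d"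
  and lin_diff: "lin e (c - d) = lin e c - lin e d"
  and lin_scale: "lin e (a *s c) = Const a * lin e c"
  and lin_axis: "lin e (axis j 1) = e j"
proof -
  have "Const (axis j 1 $ i) * e i = (if i = j then e j else 0)" for i :: 3
    by (simp add: axis_def)
  then show "lin e (axis j 1) = e j" by (simp add: lin_def)
qed (simp_all add: lin_def Const_add Const_diff Const_mult algebra_simps sum.distrib
      sum_subtractf sum_distrib_left)

lemma expansion_mod_range:
  fixes e :: "3 \<Rightarrow> (coord, 'k::field) mpol"
  assumes "inj e"
  shows "expansion_mod I (range e) f c \<longleftrightarrow>
    (\<forall>b. b \<notin> range e \<longrightarrow> c b = 0) \<and> f - lin e (\<chi> j. c (e j)) \<in> I"
  unfolding expansion_mod_def lin_def by (subst sum.reindex) (use assms in auto)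

lemma ex1_expansion:
  fixes e :: "3 \<Rightarrow> (coord, 'k::field) mpol"
  assumes "inj e"
  shows "(\<exists>!c. expansion_mod I (range e) f c) \<longleftrightarrow> (\<exists>!c. f - lin e c \<in> I)"
proof -
  \<comment> \<open>As \<open>e\<close> is injective, \<open>T\<close> and \<open>S\<close> are
    inverse bijections between coefficient functions supported on \<open>range e\<close> and
    vectors.\<close>
  define T where "T c = (\<chi> j. c (e j))" for c :: "(coord, 'k) mpol \<Rightarrow> 'k"
  define S where "S w b = (if b \<in> range e then w $ (inv e b) else 0)" for w :: "'k^3" and b
  have TS: "T (S w) = w" for w
    using assms by (simp add: T_def S_def vec_eq_iff)
  have ST: "S (T c) = c" if "\<forall>b. b \<notin> range e \<longrightarrow> c b = 0" for c
    using assms that by (auto simp: T_def S_def fun_eq_iff f_inv_into_f)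
  have iff: "expansion_mod I (range e) f c \<longleftrightarrow>
    (\<forall>b. b \<notin> range e \<longrightarrow> c b = 0) \<and> f - lin e (T c) \<in> I" for c
    unfolding expansion_mod_range[OF assms] T_def by simp
  have S0: "\<forall>b. b \<notin> range e \<longrightarrow> S w b = 0" for w by (simp add: S_def)
  show ?thesis
  proof
    assume "\<exists>!c. expansion_mod I (range e) f c"
    then obtain c where c: "expansion_mod I (range e) f c"
      and u: "\<And>d. expansion_mod I (range e) f d \<Longrightarrow> d = c" by metis
    show "\<exists>!c. f - lin e c \<in> I"
    proof (rule ex1I[of _ "T c"])
      show "f - lin e (T c) \<in> I" using c iff by blast
      fix w assume "f - lin e w \<in> I"
      then have "expansion_mod I (range e) f (S w)" by (simp add: iff S0 TS)
      then show "w = T c" using u TS by metis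
    qed
  next
    assume "\<exists>!c. f - lin e c \<in> I"
    then obtain w where w: "f - lin e w \<in> I" and u: "\<And>d. f - lin e d \<in> I \<Longrightarrow> d = w" by metis
    show "\<exists>!c. expansion_mod I (range e) f c"
    proof (rule ex1I[of _ "S w"])
      show "expansion_mod I (range e) f (S w)" by (simp add: iff S0 TS w)
      fix c assume "expansion_mod I (range e) f c"
      then show "c = S w" using iff u ST by metis
    qed
  qed
qed

lemma basis_mod_range:
  fixes e :: "3 \<Rightarrow> (coord, 'k::field) mpol"
  assumes "inj e"
  shows "basis_mod I (range e) \<longleftrightarrow> (\<forall>f. \<exists>!c. f - lin e c \<in> I)"
  unfolding basis_mod_def using ex1_expansion[OF assms, of I] by simp

lemma obtain_enum:
  assumes "finite B" "card B = 3"
  obtains b :: "3 \<Rightarrow> 'a" where "inj b" "range b = B"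
proof -
  have "\<exists>h. bij_betw h (UNIV :: 3 set) B"
    by (rule finite_same_card_bij) (use assms in auto)
  then show ?thesis using that by (auto simp: bij_betw_def)
qed

abbreviation mon :: "(3 \<Rightarrow> coord expo) \<Rightarrow> 3 \<Rightarrow> (coord, 'k::field) mpol" where
  "mon b \<equiv> (\<lambda>j. monom (b j))"

lemma inj_mon: "inj b \<Longrightarrow> inj (mon b :: 3 \<Rightarrow> (coord, 'k::field) mpol)"
  by (simp add: inj_def)

lemma monom_image_range: "monom ` range b = range (mon b :: 3 \<Rightarrow> (coord, 'k::field) mpol)"
  by auto

abbreviation hchart :: "(3 \<Rightarrow> coord expo) \<Rightarrow> (coord, 'k::field) mpol set set" where
  "hchart b \<equiv> chart (range b)"

abbreviation hring :: "(3 \<Rightarrow> coord expo) \<Rightarrow> ((coord, 'k::field) mpol set \<Rightarrow> 'k) set" where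
  "hring b \<equiv> chart_ring (range b)"

abbreviation hcoeff :: "(3 \<Rightarrow> coord expo) \<Rightarrow> (coord, 'k::field) mpol set \<Rightarrow> coord expo \<times> coord expo \<Rightarrow> 'k" where
  "hcoeff b \<equiv> chart_coeff (range b)"

abbreviation htop :: "(coord, 'k::field) mpol set topology" where
  "htop \<equiv> zariski (hilb_scheme 3)"

lemma chart_range_iff:
  fixes b :: "3 \<Rightarrow> coord expo"
  assumes "inj b"
  shows "I \<in> hchart b \<longleftrightarrow> is_ideal I \<and> (\<forall>f. \<exists>!c. f - lin (mon b) c \<in> I)"
  unfolding chart_def monom_image_range mem_Collect_eq
  by (subst basis_mod_range) (simp_all add: inj_mon assms)

lemma chart_ideal: "I \<in> chart B \<Longrightarrow> is_ideal I"
  by (simp add: chart_def)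

lemma chart_coeff_expansion:
  assumes "I \<in> chart B"
  shows "expansion_mod I (monom ` B) (monom m)
           (THE c. expansion_mod I (monom ` B) (monom m) c)"
  using theI'[of "expansion_mod I (monom ` B) (monom m)"] assms
  by (simp add: chart_def basis_mod_def)

lemma chart_coeff_outside:
  fixes I :: "(coord, 'k::field) mpol set"
  assumes "I \<in> chart B" "n \<notin> B"
  shows "chart_coeff B I (m, n) = 0"
proof -
  have "(monom n :: (coord, 'k) mpol) \<notin> monom ` B" using assms(2) by auto
  moreover have "\<forall>b. b \<notin> monom ` B \<longrightarrow>
      (THE c. expansion_mod I (monom ` B) (monom m) c) b = 0"
    using chart_coeff_expansion[OF assms(1), of m] by (subst (asm) expansion_mod_def) blast
  ultimately show ?thesis unfolding chart_coeff_def prod.case by blast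
qed

lemma chart_coeff_mem:
  fixes b :: "3 \<Rightarrow> coord expo"
  assumes "inj b" "I \<in> hchart b"
  shows "monom m - lin (mon b) (\<chi> j. hcoeff b I (m, b j)) \<in> I"
  using chart_coeff_expansion[OF assms(2), of m]
  unfolding chart_coeff_def monom_image_range expansion_mod_range[OF inj_mon[OF assms(1)]]
  by simp

lemma chart_coeff_unique:
  fixes b :: "3 \<Rightarrow> coord expo"
  assumes "inj b" "I \<in> hchart b" "monom m - lin (mon b) c \<in> I"
  shows "hcoeff b I (m, b j) = c $ j"
proof -
  have "c = (\<chi> j. hcoeff b I (m, b j))"
    using chart_range_iff[OF assms(1), of I] assms(2,3) chart_coeff_mem[OF assms(1,2), of m] by metis
  then show ?thesis by simp
qed

lemma chart_coeff_self:
  fixes b :: "3 \<Rightarrow> coord expo"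
  assumes "inj b" "I \<in> hchart b"
  shows "hcoeff b I (b i, b j) = (if i = j then 1 else 0)"
  using chart_coeff_unique[OF assms, of "b i" "axis i 1"]
  by (simp add: lin_axis ideal_0[OF chart_ideal[OF assms(2)]]) (simp add: axis_def)

lemma chart_lin_eq_0:
  fixes b :: "3 \<Rightarrow> coord expo"
  assumes "inj b" "I \<in> hchart b" "lin (mon b) c \<in> I"
  shows "c = 0"
proof -
  have "0 - lin (mon b) c \<in> I" "0 - lin (mon b) 0 \<in> I"
    using assms(3) ideal_uminus[OF chart_ideal[OF assms(2)]] ideal_0[OF chart_ideal[OF assms(2)]]
    by auto
  then show ?thesis using chart_range_iff[OF assms(1), of I] assms(2) by metis
qed

lemma chart_subset_eq:
  fixes b :: "3 \<Rightarrow> coord expo"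
  assumes "inj b" "I \<in> hchart b" "J \<in> hchart b" "I \<subseteq> J"
  shows "I = J"
proof
  show "J \<subseteq> I"
  proof
    fix f assume "f \<in> J"
    obtain c where c: "f - lin (mon b) c \<in> I" using assms(1,2) chart_range_iff by blast
    then have "f - (f - lin (mon b) c) \<in> J"
      using ideal_diff[OF chart_ideal[OF assms(3)] \<open>f \<in> J\<close>] assms(4) by blast
    then have "c = 0" using chart_lin_eq_0[OF assms(1,3)] by simp
    with c show "f \<in> I" by simp
  qed
qed fact

text \<open>A linear surjection onto \<open>k\<^sup>3\<close> with kernel \<open>I\<close> turns bases modulo \<open>I\<close> into determinants.\<close>

definition frame :: "((coord, 'k::field) mpol \<Rightarrow> 'k^3) \<Rightarrow> (coord, 'k) mpol set \<Rightarrow> bool" where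
  "frame \<kappa> I \<longleftrightarrow> (\<forall>f g. \<kappa> (f + g) = \<kappa> f + \<kappa> g) \<and> (\<forall>c f. \<kappa> (Const c * f) = c *s \<kappa> f) \<and>
     is_ideal I \<and> I = {f. \<kappa> f = 0}"

lemma frame_ideal: "frame \<kappa> I \<Longrightarrow> is_ideal I"
  and frame_mem: "frame \<kappa> I \<Longrightarrow> f \<in> I \<longleftrightarrow> \<kappa> f = 0"
  and frame_add: "frame \<kappa> I \<Longrightarrow> \<kappa> (f + g) = \<kappa> f + \<kappa> g"
  and frame_scale: "frame \<kappa> I \<Longrightarrow> \<kappa> (Const c * f) = c *s \<kappa> f"
  unfolding frame_def by blast+

definition fmat :: "((coord, 'k::field) mpol \<Rightarrow> 'k^3) \<Rightarrow> (3 \<Rightarrow> (coord, 'k) mpol) \<Rightarrow> 'k^3^3" where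
  "fmat \<kappa> e = (\<chi> i j. \<kappa> (e j) $ i)"

lemma frame_diff:
  assumes "frame \<kappa> I"
  shows "\<kappa> (f - g) = \<kappa> f - \<kappa> g"
proof -
  have "\<kappa> (f - g) + \<kappa> g = \<kappa> f" using assms frame_add[OF assms] by (metis diff_add_cancel)
  then show ?thesis by (simp add: algebra_simps)
qed

lemma frame_lin:
  assumes "frame \<kappa> I"
  shows "\<kappa> (lin e c) = fmat \<kappa> e *v c"
proof -
  have add: "\<kappa> (f + g) = \<kappa> f + \<kappa> g" and sc: "\<kappa> (Const a * f) = a *s \<kappa> f" for f g a
    using frame_add[OF assms] frame_scale[OF assms] by auto
  have z: "\<kappa> 0 = 0" using add[of 0 0] by simp
  have "\<kappa> (sum f S) = (\<Sum>j\<in>S. \<kappa> (f j))" if "finite S" for f and S :: "3 set"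
    using that by induction (auto simp: z add)
  then have "\<kappa> (lin e c) = (\<Sum>j\<in>UNIV. c $ j *s \<kappa> (e j))"
    by (simp add: lin_def sc)
  also have "\<dots> = fmat \<kappa> e *v c"
    by (simp add: vec_eq_iff matrix_vector_mult_def fmat_def mult.commute)
  finally show ?thesis .
qed

lemma det_0_ker:
  fixes M :: "'k::field^'n^'n"
  shows "det M = 0 \<longleftrightarrow> (\<exists>c. c \<noteq> 0 \<and> M *v c = 0)"
  using matrix_left_invertible_ker[of M] invertible_det_nz[of M] invertible_left_inverse[of M] by metis

text \<open>Expansions of \<open>f\<close> are the solutions \<open>c\<close> of
  \<open>fmat \<kappa> e *v c = \<kappa> f\<close>. Uniqueness for \<open>f = 0\<close> says that
  the square matrix has trivial kernel; conversely Cramer's rule solves the system.\<close>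

lemma frame_basis:
  fixes e :: "3 \<Rightarrow> (coord, 'k::field) mpol"
  assumes "frame \<kappa> I"
  shows "(\<forall>f. \<exists>!c. f - lin e c \<in> I) \<longleftrightarrow> det (fmat \<kappa> e) \<noteq> 0"
proof -
  have mem: "f - lin e c \<in> I \<longleftrightarrow> fmat \<kappa> e *v c = \<kappa> f" for f c
    using frame_mem[OF assms, of "f - lin e c"] frame_diff[OF assms, of f "lin e c"]
      frame_lin[OF assms, of e c] by auto
  show ?thesis
  proof
    assume "\<forall>f. \<exists>!c. f - lin e c \<in> I"
    then have "\<exists>!c. fmat \<kappa> e *v c = \<kappa> 0" unfolding mem by blast
    then have ex: "\<exists>!c. fmat \<kappa> e *v c = 0" using frame_diff[OF assms, of 0 0] by simp
    have "c = 0" if "fmat \<kappa> e *v c = 0" for c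
      using ex that matrix_vector_mult_0_right[of "fmat \<kappa> e"] by blast
    then show "det (fmat \<kappa> e) \<noteq> 0" unfolding det_0_ker by blast
  next
    assume d: "det (fmat \<kappa> e) \<noteq> 0"
    show "\<forall>f. \<exists>!c. f - lin e c \<in> I" unfolding mem cramer[OF d] by simp
  qed
qed

lemma frame_chart:
  fixes b :: "3 \<Rightarrow> coord expo"
  assumes "frame \<kappa> I" "inj b"
  shows "I \<in> hchart b \<longleftrightarrow> det (fmat \<kappa> (mon b)) \<noteq> 0"
  using frame_basis[OF assms(1), of "mon b"] chart_range_iff[OF assms(2), of I]
    frame_ideal[OF assms(1)] by blast

lemma frame_coeff:
  fixes b :: "3 \<Rightarrow> coord expo"
  assumes "frame \<kappa> I" "inj b" "I \<in> hchart b"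
  shows "fmat \<kappa> (mon b) *v (\<chi> j. hcoeff b I (m, b j)) = \<kappa> (monom m)"
    and "hcoeff b I (m, b k) =
      det (fmat \<kappa> (\<lambda>j. if j = k then monom m else monom (b j))) / det (fmat \<kappa> (mon b))"
proof -
  show *: "fmat \<kappa> (mon b) *v (\<chi> j. hcoeff b I (m, b j)) = \<kappa> (monom m)"
    using chart_coeff_mem[OF assms(2,3), of m] frame_mem[OF assms(1)] frame_diff[OF assms(1)]
      frame_lin[OF assms(1), of "mon b"] by simp
  have "det (fmat \<kappa> (mon b)) \<noteq> 0" using frame_chart[OF assms(1,2)] assms(3) by simp
  from cramer[OF this] * have "(\<chi> j. hcoeff b I (m, b j)) =
     (\<chi> k. det (\<chi> i j. if j = k then \<kappa> (monom m) $ i else fmat \<kappa> (mon b) $ i $ j) / det (fmat \<kappa> (mon b)))"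
    by blast
  then have "hcoeff b I (m, b k) =
     det (\<chi> i j. if j = k then \<kappa> (monom m) $ i else fmat \<kappa> (mon b) $ i $ j) / det (fmat \<kappa> (mon b))"
    by (simp add: vec_eq_iff)
  also have "(\<chi> i j. if j = k then \<kappa> (monom m) $ i else fmat \<kappa> (mon b) $ i $ j)
     = fmat \<kappa> (\<lambda>j. if j = k then monom m else monom (b j))"
    by (simp add: vec_eq_iff fmat_def)
  finally show "hcoeff b I (m, b k) =
      det (fmat \<kappa> (\<lambda>j. if j = k then monom m else monom (b j))) / det (fmat \<kappa> (mon b))" .
qed

text \<open>The frame takes coordinates modulo \<open>I\<close> in the basis \<open>e\<close>;
  uniqueness of expansions makes it linear.\<close>

lemma ex_frame:
  fixes e :: "3 \<Rightarrow> (coord, 'k::field) mpol"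
  assumes "is_ideal I" and ex1: "\<forall>f. \<exists>!c. f - lin e c \<in> I"
  obtains \<kappa> where "frame \<kappa> I" "\<And>f. f - lin e (\<kappa> f) \<in> I" "surj \<kappa>"
proof -
  define \<kappa> where "\<kappa> f = (THE c. f - lin e c \<in> I)" for f
  have mem: "f - lin e (\<kappa> f) \<in> I" for f
    unfolding \<kappa>_def by (rule theI') (use ex1 in blast)
  have eq: "\<kappa> f = c" if "f - lin e c \<in> I" for f c
    using ex1E[OF ex1[rule_format, of f], of "\<kappa> f = c"] that mem[of f] by metis
  have "\<kappa> (f + g) = \<kappa> f + \<kappa> g" for f g
    by (rule eq) (use ideal_add[OF assms(1) mem[of f] mem[of g]] in \<open>simp add: lin_add algebra_simps\<close>)
  moreover have "\<kappa> (Const a * f) = a *s \<kappa> f" for a f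
    by (rule eq) (use ideal_mult[OF assms(1) mem[of f], of "Const a"] in \<open>simp add: lin_scale algebra_simps\<close>)
  moreover have "f \<in> I \<longleftrightarrow> \<kappa> f = 0" for f
    using eq[of f 0] mem[of f] by auto
  ultimately have "frame \<kappa> I" using assms(1) by (auto simp: frame_def)
  moreover have "\<kappa> (lin e c) = c" for c
    by (rule eq) (simp add: ideal_0[OF assms(1)])
  then have "surj \<kappa>" by (metis surjI)
  ultimately show ?thesis using that mem by blast
qed

lemma chart_frame:
  fixes b :: "3 \<Rightarrow> coord expo"
  assumes "inj b" "I \<in> hchart b"
  obtains \<kappa> where "frame \<kappa> I" "\<And>m j. \<kappa> (monom m) $ j = hcoeff b I (m, b j)"
proof -
  have "\<forall>f. \<exists>!c. f - lin (mon b) c \<in> I"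
    using assms(2) unfolding chart_range_iff[OF assms(1)] by simp
  from ex_frame[OF chart_ideal[OF assms(2)] this]
  obtain \<kappa> where \<kappa>: "frame \<kappa> I" "\<And>f. f - lin (mon b) (\<kappa> f) \<in> I" by metis
  have "\<kappa> (monom m) $ j = hcoeff b I (m, b j)" for m j
    using chart_coeff_unique[OF assms \<kappa>(2)] by simp
  with \<kappa>(1) show ?thesis using that by blast
qed

lemma Hilb_frame:
  assumes "I \<in> Hilb 3"
  obtains \<kappa> where "frame \<kappa> I" "surj \<kappa>"
proof -
  obtain B where B: "basis_mod I B" "card B = 3" "is_ideal I" using assms by (auto simp: Hilb_def)
  then have "finite B" by (simp add: basis_mod_def)
  from obtain_enum[OF this B(2)] obtain e :: "3 \<Rightarrow> _" where e: "inj e" "range e = B" .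
  have "\<forall>f. \<exists>!c. f - lin e c \<in> I"
    using B(1) unfolding e(2)[symmetric] basis_mod_range[OF e(1)] .
  from ex_frame[OF B(3) this] obtain \<kappa> where "frame \<kappa> I" "surj \<kappa>" .
  then show ?thesis by (rule that)
qed

lemma chart_Hilb:
  fixes b :: "3 \<Rightarrow> coord expo" and I :: "(coord, 'k::field) mpol set"
  assumes "inj b" "I \<in> hchart b"
  shows "I \<in> Hilb 3"
proof -
  have "card (monom ` range b :: (coord, 'k) mpol set) = card (range b)"
    by (rule card_image) (simp add: inj_on_def)
  also have "\<dots> = 3" using card_image[OF assms(1)] by simp
  finally show ?thesis using assms(2) unfolding Hilb_def chart_def by blast
qed

subsection \<open>The standard charts\<close>

text \<open>In the numeral type \<open>3\<close> the element \<open>3\<close> is \<open>0\<close>;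
  it is the index that reaches the last branch.\<close>

definition trip :: "'a \<Rightarrow> 'a \<Rightarrow> 'a \<Rightarrow> 3 \<Rightarrow> 'a" where
  "trip a b c i = (if i = 1 then a else if i = 2 then b else c)"

lemma trip_simps [simp]: "trip a b c 1 = a" "trip a b c 2 = b" "trip a b c 3 = c"
  by (simp_all add: trip_def)

lemma range_trip: "range (trip a b c) = {a, b, c}"
  by (simp add: UNIV_3)

lemma inj_trip: "a \<noteq> b \<Longrightarrow> a \<noteq> c \<Longrightarrow> b \<noteq> c \<Longrightarrow> inj (trip a b c)"
  unfolding inj_def forall_3 by simp

abbreviation sg :: "coord \<Rightarrow> nat \<Rightarrow> coord expo" where "sg \<equiv> Poly_Mapping.single"

text \<open>The monomials 1, v, v^2 here, and 1, u, v below. By \<open>Hilb_cover\<close> the charts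
  of \<open>mvv v\<close>, \<open>mvv u\<close> and \<open>muv u v\<close> cover
  \<open>Hilb 3\<close>. Working with arbitrary distinct \<open>u\<close> and \<open>v\<close> lets
  every result serve both curves.\<close>

abbreviation mvv :: "coord \<Rightarrow> 3 \<Rightarrow> coord expo" where
  "mvv v \<equiv> trip 0 (sg v (Suc 0)) (sg v 2)"

abbreviation muv :: "coord \<Rightarrow> coord \<Rightarrow> 3 \<Rightarrow> coord expo" where
  "muv u v \<equiv> trip 0 (sg u (Suc 0)) (sg v (Suc 0))"

lemma sg_eq_iff: "sg u n = sg v m \<longleftrightarrow> (n = 0 \<and> m = 0) \<or> (u = v \<and> n = m)"
proof
  assume h: "sg u n = sg v m"
  show "(n = 0 \<and> m = 0) \<or> (u = v \<and> n = m)"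
    using arg_cong[OF h, of "\<lambda>f. lookup f u"] arg_cong[OF h, of "\<lambda>f. lookup f v"]
    by (auto simp: lookup_single when_def split: if_splits)
qed auto

lemma sg_neq: "n \<noteq> 0 \<Longrightarrow> sg v n \<noteq> 0" "n \<noteq> 0 \<Longrightarrow> 0 \<noteq> sg v n"
  using sg_eq_iff[of v n v 0] by auto

lemma inj_mvv [simp]: "inj (mvv v)" and inj_muv [simp]: "u \<noteq> v \<Longrightarrow> inj (muv u v)"
  by (auto intro!: inj_trip simp: sg_eq_iff sg_neq)

lemma lin_trip: "lin (mon (trip a b c)) w =
    Const (w $ 1) * monom a + Const (w $ 2) * monom b + Const (w $ 3) * monom c"
  by (simp add: lin_def sum_3)

lemma monom_sg: "monom (sg v n) = Var v ^ n"
proof (induction n)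
  case (Suc n)
  have "sg v (Suc n) = sg v 1 + sg v n" by (simp add: single_add[symmetric])
  with Suc show ?case by (simp add: Var_def monom_add)
qed simp

text \<open>If 1 and \<open>g\<close> spanned the quotient, the identity 3 x 3 matrix would be a sum
  of two matrices of rank at most one, which has determinant 0.\<close>

lemma not_frame_if_spanned_by_two:
  fixes \<kappa> :: "(coord, 'k::field) mpol \<Rightarrow> 'k^3"
  assumes "frame \<kappa> I" "surj \<kappa>" "\<And>f. \<exists>a b. f - (Const a + Const b * g) \<in> I"
  shows False
proof -
  have "\<exists>a b. w = a *s \<kappa> 1 + b *s \<kappa> g" for w
  proof -
    obtain f where f: "\<kappa> f = w" using assms(2) by (metis surjD)
    obtain a b where "f - (Const a * 1 + Const b * g) \<in> I" using assms(3)[of f] by auto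
    then have "\<kappa> f = \<kappa> (Const a * 1 + Const b * g)"
      using frame_diff[OF assms(1)] frame_mem[OF assms(1)] by simp
    then show ?thesis using f frame_add[OF assms(1)] frame_scale[OF assms(1)] by metis
  qed
  then have "\<forall>j :: 3. \<exists>a b. axis j 1 = a *s \<kappa> 1 + b *s \<kappa> g" by blast
  then obtain a b where ab: "\<And>j :: 3. axis j 1 = a j *s \<kappa> 1 + b j *s \<kappa> g" by metis
  define A where "A = \<kappa> 1"
  define B where "B = \<kappa> g"
  have h: "a j * A $ i + b j * B $ i = axis j (1::'k) $ i" for i j :: 3
    unfolding ab A_def B_def by simp
  have "(\<chi> i j. a j * A $ i + b j * B $ i) = (mat 1 :: 'k^3^3)"
    unfolding h by (simp add: vec_eq_iff mat_def axis_def)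
  moreover have "det (\<chi> i j. a j * A $ i + b j * B $ i) = (0::'k)"
    unfolding det_3 by (simp add: algebra_simps)
  ultimately have "det (mat 1 :: 'k^3^3) = 0" by simp
  then show False by simp
qed


section \<open>Spanning modulo an ideal\<close>

lemma coord_cases: "u \<noteq> v \<Longrightarrow> (c :: coord) = u \<or> c = v"
  by (cases c; cases u; cases v) auto

text \<open>Only spanning is recorded, without independence, because \<open>K\<close> is also taken
  to be a possibly smaller ideal than the one for which \<open>e\<close> is a basis, as in
  \<open>root_in_zeros\<close>.\<close>

definition mod_span :: "(coord, 'k::field) mpol set \<Rightarrow> (3 \<Rightarrow> (coord, 'k) mpol) \<Rightarrow> (coord, 'k) mpol set" where
  "mod_span K e = {f. \<exists>w. f - lin e w \<in> K}"

lemma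
  assumes K: "is_ideal K"
  shows mod_span_add: "f \<in> mod_span K e \<Longrightarrow> g \<in> mod_span K e \<Longrightarrow> f + g \<in> mod_span K e"
    and mod_span_Const: "f \<in> mod_span K e \<Longrightarrow> Const c * f \<in> mod_span K e"
    and mod_span_ideal: "f \<in> K \<Longrightarrow> f \<in> mod_span K e"
    and mod_span_lin: "lin e w \<in> mod_span K e"
proof -
  show "f + g \<in> mod_span K e" if "f \<in> mod_span K e" "g \<in> mod_span K e"
  proof -
    from that obtain w w' where "f - lin e w \<in> K" "g - lin e w' \<in> K" unfolding mod_span_def by auto
    from ideal_add[OF K this] have "f + g - lin e (w + w') \<in> K" by (simp add: lin_add algebra_simps)
    then show ?thesis unfolding mod_span_def by blast
  qed
  show "Const c * f \<in> mod_span K e" if "f \<in> mod_span K e"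
  proof -
    from that obtain w where "f - lin e w \<in> K" unfolding mod_span_def by auto
    from ideal_mult[OF K this, of "Const c"] have "Const c * f - lin e (c *s w) \<in> K"
      by (simp add: lin_scale algebra_simps)
    then show ?thesis unfolding mod_span_def by blast
  qed
  show "f \<in> mod_span K e" if "f \<in> K"
    unfolding mod_span_def using that by (intro CollectI exI[of _ 0]) simp
  show "lin e w \<in> mod_span K e"
    unfolding mod_span_def by (intro CollectI exI[of _ w]) (simp add: ideal_0[OF K])
qed

lemma mod_span_basis: "is_ideal K \<Longrightarrow> e j \<in> mod_span K e"
  using mod_span_lin[of K e "axis j 1"] by (simp add: lin_axis)

lemma mod_span_mult:
  assumes K: "is_ideal K" and h: "\<And>j. h * e j \<in> mod_span K e" and f: "f \<in> mod_span K e"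
  shows "h * f \<in> mod_span K e"
proof -
  obtain w where w: "f - lin e w \<in> K" using f unfolding mod_span_def by auto
  have "h * f = h * (f - lin e w) + (Const (w $ 1) * (h * e 1) +
      (Const (w $ 2) * (h * e 2) + Const (w $ 3) * (h * e 3)))"
    by (simp add: lin_def sum_3 algebra_simps)
  also have "\<dots> \<in> mod_span K e"
    by (intro mod_span_add[OF K] mod_span_Const[OF K] h mod_span_ideal[OF K ideal_mult[OF K w]])
  finally show ?thesis .
qed

lemma mod_span_UNIV:
  fixes u v :: coord
  assumes K: "is_ideal K" and uv: "u \<noteq> v" and one: "1 \<in> mod_span K e"
    and u: "\<And>f. f \<in> mod_span K e \<Longrightarrow> Var u * f \<in> mod_span K e"
    and v: "\<And>f. f \<in> mod_span K e \<Longrightarrow> Var v * f \<in> mod_span K e"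
  shows "f \<in> mod_span K e"
proof (rule mpol_coord_closure[OF one mod_span_add[OF K] mod_span_Const[OF K]])
  show "Var c * f \<in> mod_span K e" if "f \<in> mod_span K e" for f c
    using coord_cases[OF uv, of c] by (elim disjE) (simp_all only: u[OF that] v[OF that])
qed

lemma spanned_closure:
  fixes u v :: coord and I :: "(coord, 'k::field) mpol set"
  assumes I: "is_ideal I" and uv: "u \<noteq> v"
    and 1: "Var u - (Const \<alpha> + Const \<beta> * Var v) \<in> I"
    and 2: "Var v ^ 2 - (Const \<gamma> + Const \<delta> * Var v) \<in> I"
  shows "\<exists>a b. f - (Const a + Const b * Var v) \<in> I"
proof -
  \<comment> \<open>The entry 0 pads the two spanning elements to a family of three.\<close>
  let ?e = "trip 1 (Var v) 0 :: 3 \<Rightarrow> (coord, 'k) mpol"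
  have le: "lin ?e w = Const (w $ 1) + Const (w $ 2) * Var v" for w by (simp add: lin_def sum_3)
  note add = mod_span_add[OF I] and cst = mod_span_Const[OF I] and IS = mod_span_ideal[OF I]
  have e: "1 \<in> mod_span I ?e" "Var v \<in> mod_span I ?e" "0 \<in> mod_span I ?e"
    using mod_span_basis[OF I, of ?e 1] mod_span_basis[OF I, of ?e 2] mod_span_basis[OF I, of ?e 3] by simp_all
  have "Var v * Var v = (Var v ^ 2 - (Const \<gamma> + Const \<delta> * Var v)) + (Const \<gamma> * 1 + Const \<delta> * Var v)"
    by (simp add: power2_eq_square)
  then have "Var v * Var v \<in> mod_span I ?e" using add[OF IS[OF 2] add[OF cst[OF e(1)] cst[OF e(2)]]] by metis
  then have "Var v * ?e j \<in> mod_span I ?e" for j using exhaust_3[of j] e by auto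
  then have v: "Var v * f \<in> mod_span I ?e" if "f \<in> mod_span I ?e" for f
    using mod_span_mult[OF I _ that] by blast
  have u: "Var u * f \<in> mod_span I ?e" if f: "f \<in> mod_span I ?e" for f
  proof -
    have "Var u * f = f * (Var u - (Const \<alpha> + Const \<beta> * Var v)) + (Const \<alpha> * f + Const \<beta> * (Var v * f))"
      by (simp add: algebra_simps)
    also have "\<dots> \<in> mod_span I ?e" by (intro add IS ideal_mult I 1 cst f v)
    finally show ?thesis .
  qed
  have "f \<in> mod_span I ?e" by (rule mod_span_UNIV[OF I uv e(1) u v])
  then show ?thesis unfolding mod_span_def le by blast
qed

lemma ideal_scale_iff:
  assumes "is_ideal I" "c \<noteq> (0::'k::field)"
  shows "Const c * f \<in> I \<longleftrightarrow> f \<in> I"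
proof
  assume "Const c * f \<in> I"
  from ideal_mult[OF assms(1) this, of "Const (inverse c)"]
  have "Const (inverse c * c) * f \<in> I" by (simp only: mult.assoc Const_mult)
  then show "f \<in> I" using assms(2) by simp
qed (rule ideal_mult[OF assms(1)])

text \<open>A linear relation among 1, v, v^2 modulo \<open>I\<close> would reduce v^2 to lower
  powers of v. As u reduces to 1 and v as well, the quotient would be spanned by two
  elements.\<close>

lemma chart_mvv_if_linear:
  fixes u v :: coord
  assumes "I \<in> Hilb 3" "u \<noteq> v" "Var u - (Const \<alpha> + Const \<beta> * Var v) \<in> I"
  shows "I \<in> hchart (mvv v)"
proof (rule ccontr)
  assume not: "I \<notin> hchart (mvv v)"
  obtain \<kappa> where \<kappa>: "frame \<kappa> I" "surj \<kappa>" using Hilb_frame[OF assms(1)] .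
  then have I: "is_ideal I" using frame_ideal by blast
  obtain w where w: "w \<noteq> 0" "fmat \<kappa> (mon (mvv v)) *v w = 0"
    using not frame_chart[OF \<kappa>(1), of "mvv v"] det_0_ker by auto
  then have "lin (mon (mvv v)) w \<in> I" using frame_lin[OF \<kappa>(1)] frame_mem[OF \<kappa>(1)] by simp
  then have mem: "Const (w $ 1) + Const (w $ 2) * Var v + Const (w $ 3) * Var v ^ 2 \<in> I"
    by (simp add: lin_trip monom_sg)
  have "\<exists>\<gamma> \<delta>. Var v ^ 2 - (Const \<gamma> + Const \<delta> * Var v) \<in> I"
  proof (cases "w $ 3 = 0")
    case False
    have "Const (w $ 3) * (Var v ^ 2 - (Const (- w $ 1 / w $ 3) + Const (- w $ 2 / w $ 3) * Var v)) =
      Const (w $ 1) + Const (w $ 2) * Var v + Const (w $ 3) * Var v ^ 2"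
      using False by (simp add: right_diff_distrib distrib_left mult.assoc[symmetric] Const_mult[symmetric] Const_uminus)
    then show ?thesis using mem ideal_scale_iff[OF I False] by metis
  next
    case w3: True
    show ?thesis
    proof (cases "w $ 2 = 0")
      case False
      define r where "r = w $ 1 / w $ 2"
      have r: "w $ 1 = w $ 2 * r" using False by (simp add: r_def)
      \<comment> \<open>A relation that involves only 1 and v is multiplied by v to obtain one for
        v^2.\<close>
      have "Var v * (Const (w $ 1) + Const (w $ 2) * Var v) \<in> I"
        using mem w3 by (intro ideal_mult I) simp
      also have "Var v * (Const (w $ 1) + Const (w $ 2) * Var v) =
         Const (w $ 2) * (Var v ^ 2 - (Const 0 + Const (- r) * Var v))"
        by (simp add: r Const_mult Const_uminus algebra_simps power2_eq_square)
      finally show ?thesis using ideal_scale_iff[OF I False] by metis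
    next
      case True
      with w3 w(1) have "w $ 1 \<noteq> 0" by (auto simp: vec_eq_iff forall_3)
      moreover have "Const (w $ 1) * 1 \<in> I" using mem w3 True by simp
      ultimately have "1 \<in> I" using ideal_scale_iff[OF I] by metis
      then have "f \<in> I" for f using ideal_mult[OF I, of 1 f] by simp
      then show ?thesis by blast
    qed
  qed
  then show False
    using not_frame_if_spanned_by_two[OF \<kappa>, of "Var v"] spanned_closure[OF I assms(2,3)] by blast
qed

text \<open>A linear relation among 1, u, v modulo \<open>I\<close> expresses one variable through
  the other, and then the previous lemma applies; a relation involving the constant alone would make
  \<open>I\<close> the unit ideal.\<close>

lemma Hilb_cover:
  fixes u v :: coord
  assumes "I \<in> Hilb 3" "u \<noteq> v"
  shows "I \<in> hchart (mvv v) \<or> I \<in> hchart (mvv u) \<or> I \<in> hchart (muv u v)"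
proof (rule ccontr)
  assume not: "\<not> ?thesis"
  obtain \<kappa> where \<kappa>: "frame \<kappa> I" "surj \<kappa>" using Hilb_frame[OF assms(1)] .
  then have I: "is_ideal I" using frame_ideal by blast
  obtain w where w: "w \<noteq> 0" "fmat \<kappa> (mon (muv u v)) *v w = 0"
    using not frame_chart[OF \<kappa>(1), of "muv u v"] assms(2) det_0_ker by auto
  then have "lin (mon (muv u v)) w \<in> I" using frame_lin[OF \<kappa>(1)] frame_mem[OF \<kappa>(1)] by simp
  then have mem: "Const (w $ 1) + Const (w $ 2) * Var u + Const (w $ 3) * Var v \<in> I"
    by (simp add: lin_trip monom_sg)
  have nu: "Var u - (Const \<alpha> + Const \<beta> * Var v) \<notin> I" for \<alpha> \<beta>
    using chart_mvv_if_linear[OF assms] not by blast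
  have nv: "Var v - (Const \<alpha> + Const \<beta> * Var u) \<notin> I" for \<alpha> \<beta>
    using chart_mvv_if_linear[OF assms(1) assms(2)[symmetric]] not by blast
  show False
  proof (cases "w $ 2 = 0")
    case False
    have "Const (w $ 2) * (Var u - (Const (- w $ 1 / w $ 2) + Const (- w $ 3 / w $ 2) * Var v)) =
      Const (w $ 1) + Const (w $ 2) * Var u + Const (w $ 3) * Var v"
      using False by (simp add: right_diff_distrib distrib_left mult.assoc[symmetric] Const_mult[symmetric] Const_uminus)
    then show False using mem ideal_scale_iff[OF I False] nu by metis
  next
    case w2: True
    show False
    proof (cases "w $ 3 = 0")
      case False
      have "Const (w $ 3) * (Var v - (Const (- w $ 1 / w $ 3) + Const 0 * Var u)) =
        Const (w $ 1) + Const (w $ 2) * Var u + Const (w $ 3) * Var v"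
        using False w2 by (simp add: right_diff_distrib distrib_left mult.assoc[symmetric] Const_mult[symmetric] Const_uminus)
      then show False using mem ideal_scale_iff[OF I False] nv by metis
    next
      case True
      with w2 w(1) have "w $ 1 \<noteq> 0" by (auto simp: vec_eq_iff forall_3)
      moreover have "Const (w $ 1) * 1 \<in> I" using mem w2 True by simp
      ultimately have "1 \<in> I" using ideal_scale_iff[OF I] by metis
      then have "f \<in> I" for f using ideal_mult[OF I, of 1 f] by simp
      then show False using nu by blast
    qed
  qed
qed

subsection \<open>Triples of distinct points\<close>

definition pt :: "(3 \<times> coord \<Rightarrow> 'k) \<Rightarrow> 3 \<Rightarrow> coord \<Rightarrow> 'k" where
  "pt q i = (\<lambda>c. q (i, c))"

definition pts_ideal :: "(3 \<times> coord \<Rightarrow> 'k::field) \<Rightarrow> (coord, 'k) mpol set" where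
  "pts_ideal q = {f. \<forall>i. eval f (pt q i) = 0}"

text \<open>The alternant (generalized Vandermonde determinant) of the monomials \<open>b\<close> at
  the three points. It changes by the sign under permutations of the points, and quotients of
  alternants are the chart coordinates of the triple, see \<open>pts_coeff\<close>.\<close>

definition ptdet :: "(3 \<Rightarrow> coord expo) \<Rightarrow> (3 \<times> coord \<Rightarrow> 'k::field) \<Rightarrow> 'k" where
  "ptdet b q = det (\<chi> i j. mval (pt q i) (b j))"

lemma frame_pts: "frame (\<lambda>f. \<chi> i. eval f (pt q i)) (pts_ideal q)"
  unfolding frame_def pts_ideal_def is_ideal_iff by (auto simp: vec_eq_iff)

lemma pts_chart: "inj b \<Longrightarrow> pts_ideal q \<in> hchart b \<longleftrightarrow> ptdet b q \<noteq> 0"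
  using frame_chart[OF frame_pts, of b q] by (simp add: ptdet_def fmat_def)

lemma pts_coeff:
  fixes b :: "3 \<Rightarrow> coord expo"
  assumes "inj b" "ptdet b q \<noteq> 0"
  shows "hcoeff b (pts_ideal q) (m, b k) = ptdet (b(k := m)) q / ptdet b q"
proof -
  have "fmat (\<lambda>f. \<chi> i. eval f (pt q i)) (\<lambda>j. if j = k then monom m else monom (b j)) =
     (\<chi> i j. mval (pt q i) ((b(k := m)) j))"
    by (simp add: fmat_def vec_eq_iff)
  then show ?thesis
    using frame_coeff(2)[OF frame_pts assms(1), of q m k] pts_chart[OF assms(1), of q] assms(2)
    by (simp add: ptdet_def fmat_def)
qed

lemma pts_coeff_unique:
  fixes b :: "3 \<Rightarrow> coord expo"
  assumes "inj b" "ptdet b q \<noteq> 0" "\<And>i. mval (pt q i) m = (\<Sum>j\<in>UNIV. c j * mval (pt q i) (b j))"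
  shows "hcoeff b (pts_ideal q) (m, b j) = c j"
proof -
  have "monom m - lin (mon b) (\<chi> j. c j) \<in> pts_ideal q"
    by (simp add: pts_ideal_def lin_def assms(3))
  from chart_coeff_unique[OF assms(1) _ this] show ?thesis
    using pts_chart[OF assms(1), of q] assms(2) by simp
qed

lemma pts_ideal_eqI:
  fixes b :: "3 \<Rightarrow> coord expo"
  assumes "I \<in> hchart b" "inj b" "I \<subseteq> pts_ideal q" "ptdet b q \<noteq> 0"
  shows "I = pts_ideal q"
  using chart_subset_eq[OF assms(2,1) _ assms(3)] pts_chart[OF assms(2), of q] assms(4) by blast

text \<open>A relation among the monomials \<open>b\<close> modulo \<open>I\<close> would hold at
  the three points and contradict the nonzero alternant, so they form a basis modulo
  \<open>I\<close> too. A function vanishing at the points then reduces modulo \<open>I\<close> to a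
  combination vanishing there, hence to 0.\<close>

lemma Hilb_pts_ideal:
  fixes b :: "3 \<Rightarrow> coord expo"
  assumes "I \<in> Hilb 3" "I \<subseteq> pts_ideal q" "ptdet b q \<noteq> 0"
  shows "I = pts_ideal q"
proof
  obtain \<kappa> where \<kappa>: "frame \<kappa> I" "surj \<kappa>" using Hilb_frame[OF assms(1)] .
  have I: "is_ideal I" using \<kappa> frame_ideal by blast
  have "det (fmat \<kappa> (mon b)) \<noteq> 0"
  proof
    assume "det (fmat \<kappa> (mon b)) = 0"
    then obtain w where w: "w \<noteq> 0" "fmat \<kappa> (mon b) *v w = 0" using det_0_ker by blast
    then have "lin (mon b) w \<in> pts_ideal q"
      using frame_lin[OF \<kappa>(1)] frame_mem[OF \<kappa>(1)] assms(2) by auto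
    then have "fmat (\<lambda>f. \<chi> i. eval f (pt q i)) (mon b) *v w = 0"
      using frame_lin[OF frame_pts[of q], of "mon b" w] by (simp add: pts_ideal_def vec_eq_iff)
    then show False using assms(3) w(1) det_0_ker[of "fmat (\<lambda>f. \<chi> i. eval f (pt q i)) (mon b)"]
      by (auto simp: ptdet_def fmat_def)
  qed
  then have ex: "\<forall>f. \<exists>!c. f - lin (mon b) c \<in> I" using frame_basis[OF \<kappa>(1), of "mon b"] by blast
  show "pts_ideal q \<subseteq> I"
  proof
    fix f assume f: "f \<in> pts_ideal q"
    obtain c where c: "f - lin (mon b) c \<in> I" using ex by blast
    then have "f - (f - lin (mon b) c) \<in> pts_ideal q"
      using f assms(2) by (auto simp: pts_ideal_def)
    then have "fmat (\<lambda>f. \<chi> i. eval f (pt q i)) (mon b) *v c = 0"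
      using frame_lin[OF frame_pts[of q], of "mon b" c] by (simp add: pts_ideal_def vec_eq_iff)
    then have "c = 0" using assms(3) det_0_ker[of "fmat (\<lambda>f. \<chi> i. eval f (pt q i)) (mon b)"]
      by (auto simp: ptdet_def fmat_def)
    with c show "f \<in> I" by simp
  qed
qed fact

subsection \<open>Frobenius splittings on affine charts\<close>

lemma zariski_basic_open:
  "(W, A) \<in> \<A> \<Longrightarrow> h \<in> A \<Longrightarrow> openin (zariski \<A>) {x \<in> W. h x \<noteq> 0}"
  unfolding zariski_def by (rule topology_generated_by_Basis) blast

lemma zariski_chart_open:
  assumes "(W, A) \<in> \<A>" "(\<lambda>_. 1) \<in> A"
  shows "openin (zariski \<A>) W"
  using zariski_basic_open[OF assms] by simp

lemma zariski_topspace: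
  fixes \<A> :: "('p, 'k::field) atlas"
  assumes "\<And>W A. (W, A) \<in> \<A> \<Longrightarrow> (\<lambda>_. 1) \<in> A"
  shows "topspace (zariski \<A>) = \<Union>(fst ` \<A>)"
  unfolding zariski_def topology_generated_by_topspace
proof
  show "\<Union>(fst ` \<A>) \<subseteq> \<Union>{{x \<in> W. h x \<noteq> 0} | W A h. (W, A) \<in> \<A> \<and> h \<in> A}"
  proof
    fix x assume "x \<in> \<Union>(fst ` \<A>)"
    then obtain W A where W: "(W, A) \<in> \<A>" "x \<in> W" by auto
    then have "x \<in> {x \<in> W. (1::'k) \<noteq> 0}" by simp
    with W(1) assms[OF W(1)]
    show "x \<in> \<Union>{{x \<in> W. h x \<noteq> 0} | W A h. (W, A) \<in> \<A> \<and> h \<in> A}" by blast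
  qed
qed force

lemma cut_in [simp]: "x \<in> U \<Longrightarrow> cut U f x = f x"
  and cut_out [simp]: "x \<notin> U \<Longrightarrow> cut U f x = 0"
  and cut_cut: "V \<subseteq> U \<Longrightarrow> cut V (cut U f) = cut V f"
  by (auto simp: cut_def fun_eq_iff)

lemma cut_cong: "(\<And>x. x \<in> U \<Longrightarrow> f x = g x) \<Longrightarrow> cut U f = cut U g"
  by (auto simp: cut_def)

lemma regular_frac:
  assumes "(W, A) \<in> \<A>" "D \<subseteq> W" "g \<in> A" "h \<in> A" "\<And>x. x \<in> D \<Longrightarrow> h x \<noteq> 0"
  shows "cut D (\<lambda>x. g x / h x) \<in> regular \<A> D"
  unfolding regular_def
proof (intro CollectI conjI allI impI ballI)
  fix x assume "x \<in> D"
  then show "\<exists>W A g' h'. (W, A) \<in> \<A> \<and> g' \<in> A \<and> h' \<in> A \<and> x \<in> W \<and> h' x \<noteq> 0 \<and>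
     (\<forall>y\<in>D \<inter> W. h' y \<noteq> 0 \<longrightarrow> cut D (\<lambda>x. g x / h x) y = g' y / h' y)"
    using assms by (intro exI[of _ W] exI[of _ A] exI[of _ g] exI[of _ h]) auto
qed simp

lemma regular_alg:
  assumes "(W, alg G) \<in> \<A>" "D \<subseteq> W" "g \<in> alg G"
  shows "cut D g \<in> regular \<A> D"
  using regular_frac[OF assms alg.const[of 1]] by simp

lemma
  fixes \<A> :: "('p, 'k::field) atlas"
  assumes "frobenius_splitting \<A> \<phi>" "openin (zariski \<A>) U"
  shows split_regular: "f \<in> regular \<A> U \<Longrightarrow> \<phi> U f \<in> regular \<A> U"
    and split_add: "f \<in> regular \<A> U \<Longrightarrow> g \<in> regular \<A> U \<Longrightarrow>
      \<phi> U (\<lambda>x. f x + g x) = (\<lambda>x. \<phi> U f x + \<phi> U g x)"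
    and split_pmult: "f \<in> regular \<A> U \<Longrightarrow> g \<in> regular \<A> U \<Longrightarrow>
      \<phi> U (\<lambda>x. f x ^ CHAR('k) * g x) = (\<lambda>x. f x * \<phi> U g x)"
    and split_restrict: "openin (zariski \<A>) V \<Longrightarrow> V \<subseteq> U \<Longrightarrow> f \<in> regular \<A> U \<Longrightarrow>
      \<phi> V (cut V f) = cut V (\<phi> U f)"
    and split_pow: "f \<in> regular \<A> U \<Longrightarrow> \<phi> U (\<lambda>x. f x ^ CHAR('k)) = f"
proof -
  note * = assms(1)[unfolded frobenius_splitting_def, THEN spec, THEN mp, OF assms(2)]
  show "f \<in> regular \<A> U \<Longrightarrow> \<phi> U f \<in> regular \<A> U"
    by (rule *[THEN conjunct1, THEN bspec])
  show "f \<in> regular \<A> U \<Longrightarrow> g \<in> regular \<A> U \<Longrightarrow> \<phi> U (\<lambda>x. f x + g x) = (\<lambda>x. \<phi> U f x + \<phi> U g x)"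
    by (rule *[THEN conjunct2, THEN conjunct1, THEN bspec, THEN bspec])
  show "f \<in> regular \<A> U \<Longrightarrow> g \<in> regular \<A> U \<Longrightarrow>
      \<phi> U (\<lambda>x. f x ^ CHAR('k) * g x) = (\<lambda>x. f x * \<phi> U g x)"
    by (rule *[THEN conjunct2, THEN conjunct2, THEN conjunct1, THEN bspec, THEN bspec])
  show "openin (zariski \<A>) V \<Longrightarrow> V \<subseteq> U \<Longrightarrow> f \<in> regular \<A> U \<Longrightarrow> \<phi> V (cut V f) = cut V (\<phi> U f)"
    by (rule *[THEN conjunct2, THEN conjunct2, THEN conjunct2, THEN conjunct1, THEN spec, THEN mp, OF conjI, THEN bspec])
  show "f \<in> regular \<A> U \<Longrightarrow> \<phi> U (\<lambda>x. f x ^ CHAR('k)) = f"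
    by (rule *[THEN conjunct2, THEN conjunct2, THEN conjunct2, THEN conjunct2, THEN bspec])
qed

text \<open>Frobenius linearity takes a denominator out of the splitting once it is a p-th power;
  this is why fractions are always expanded to denominators of that form.\<close>

lemma split_frac:
  fixes \<A> :: "('p, 'k::field) atlas"
  assumes \<phi>: "frobenius_splitting \<A> \<phi>" and W: "(W, alg G) \<in> \<A>"
    and D: "openin (zariski \<A>) D" "D \<subseteq> W" "\<And>x. x \<in> D \<Longrightarrow> h x \<noteq> 0"
    and F: "F \<in> alg G" and h: "h \<in> alg G"
    and f: "\<And>x. x \<in> D \<Longrightarrow> f x = F x / h x ^ (CHAR('k) * N)"
  shows "\<phi> D (cut D f) = cut D (\<lambda>x. \<phi> W (cut W F) x / h x ^ N)"
proof -
  have oW: "openin (zariski \<A>) W" by (rule zariski_chart_open[OF W alg.const])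
  define u where "u = cut D (\<lambda>x. 1 / h x ^ N)"
  have u: "u \<in> regular \<A> D"
    unfolding u_def by (rule regular_frac[OF W D(2) alg.const alg_power[OF h]]) (use D(3) in auto)
  have "cut D f = (\<lambda>x. u x ^ CHAR('k) * cut D F x)"
    by (rule ext, rename_tac x, case_tac "x \<in> D") (auto simp: u_def f power_divide power_mult[symmetric] mult.commute)
  then have "\<phi> D (cut D f) = (\<lambda>x. u x * \<phi> D (cut D F) x)"
    using split_pmult[OF \<phi> D(1) u regular_alg[OF W D(2) F]] by simp
  also have "\<phi> D (cut D F) = cut D (\<phi> W (cut W F))"
    using split_restrict[OF \<phi> oW D(1,2) regular_alg[OF W order_refl F]] by (simp add: cut_cut[OF D(2)])
  also have "(\<lambda>x. u x * cut D (\<phi> W (cut W F)) x) = cut D (\<lambda>x. \<phi> W (cut W F) x / h x ^ N)"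
    by (rule ext, rename_tac x, case_tac "x \<in> D") (auto simp: u_def)
  finally show ?thesis .
qed

subsection \<open>Charts of the Hilbert scheme\<close>

lemma hilb_chart: "inj (b :: 3 \<Rightarrow> coord expo) \<Longrightarrow> (hchart b, hring b) \<in> hilb_scheme 3"
  unfolding hilb_scheme_def using card_image[of b UNIV] by force

lemma hilb_chart_alg: "inj (b :: 3 \<Rightarrow> coord expo) \<Longrightarrow>
    (hchart b, alg (range (\<lambda>v I. hcoeff b I v))) \<in> hilb_scheme 3"
  using hilb_chart[of b] by (simp add: chart_ring_alg)

lemma hilb_atlasE:
  assumes "(W, A) \<in> hilb_scheme 3"
  obtains b :: "3 \<Rightarrow> coord expo" where "inj b" "W = hchart b" "A = hring b"
proof -
  from assms obtain B where B: "finite B" "card B = 3" "W = chart B" "A = chart_ring B"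
    unfolding hilb_scheme_def by auto
  from obtain_enum[OF B(1,2)] obtain b :: "3 \<Rightarrow> _" where "inj b" "range b = B" .
  with B that show ?thesis by blast
qed

lemma hilb_open_chart:
  "inj (b :: 3 \<Rightarrow> coord expo) \<Longrightarrow> openin (zariski (hilb_scheme 3 :: (_, 'k::field) atlas)) (hchart b)"
  by (rule zariski_chart_open[OF hilb_chart_alg alg.const])

lemma hilb_open_basic:
  fixes b :: "3 \<Rightarrow> coord expo"
  assumes "inj b" "h \<in> hring b"
  shows "openin (htop) {I \<in> hchart b. h I \<noteq> 0}"
  by (rule zariski_basic_open[OF hilb_chart[OF assms(1)] assms(2)])

lemma hilb_topspace: "topspace (zariski (hilb_scheme 3 :: (_, 'k::field) atlas)) =
    {I. \<exists>b. inj (b :: 3 \<Rightarrow> coord expo) \<and> I \<in> hchart b}"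
proof -
  have "topspace (zariski (hilb_scheme 3 :: (_, 'k::field) atlas)) = \<Union>(fst ` (hilb_scheme 3 :: (_, 'k) atlas))"
    by (rule zariski_topspace) (auto simp: hilb_scheme_def chart_ring_alg intro: alg.const)
  also have "\<dots> = {I. \<exists>b. inj (b :: 3 \<Rightarrow> coord expo) \<and> I \<in> hchart b}"
    (is "?L = ?R")
  proof
    show "?L \<subseteq> ?R" by (auto elim!: hilb_atlasE)
    show "?R \<subseteq> ?L" using hilb_chart by force
  qed
  finally show ?thesis .
qed

lemma chart_coeff_in_ring: "(\<lambda>I. chart_coeff B I v) \<in> chart_ring B"
  unfolding chart_ring_alg by (rule alg.gen) blast

lemmas chart_ring_intros = alg_intros[where G = "range (\<lambda>v I. chart_coeff B I v)" for B, folded chart_ring_alg]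
  chart_coeff_in_ring

text \<open>The determinant of the transition matrix that writes the monomials \<open>b\<close> in
  the basis \<open>b0\<close> modulo \<open>I\<close>. Within the chart of \<open>b0\<close> it
  vanishes exactly off the chart of \<open>b\<close>.\<close>

definition chdet :: "(3 \<Rightarrow> coord expo) \<Rightarrow> (3 \<Rightarrow> coord expo) \<Rightarrow> (coord, 'k::field) mpol set \<Rightarrow> 'k" where
  "chdet b0 b I = det (\<chi> i j. hcoeff b0 I (b j, b0 i))"

lemma chdet_in_ring: "chdet b0 b \<in> hring b0"
  unfolding chdet_def[abs_def] chart_ring_alg by (rule alg_det) (auto intro: alg.gen)

lemma chart_change:
  fixes b b0 :: "3 \<Rightarrow> coord expo" and I :: "(coord, 'k::field) mpol set"
  assumes "inj b0" "inj b" "I \<in> hchart b0"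
  shows "I \<in> hchart b \<longleftrightarrow> chdet b0 b I \<noteq> 0"
    and "I \<in> hchart b \<Longrightarrow>
      hcoeff b I (m, b k) = chdet b0 (b(k := m)) I / chdet b0 b I"
proof -
  obtain \<kappa> where \<kappa>: "frame \<kappa> I"
    and co: "\<And>m j. \<kappa> (monom m) $ j = hcoeff b0 I (m, b0 j)"
    using chart_frame[OF assms(1,3)] by metis
  have eq: "det (fmat \<kappa> (mon c)) = chdet b0 c I" for c
    by (simp add: fmat_def chdet_def co)
  show "I \<in> hchart b \<longleftrightarrow> chdet b0 b I \<noteq> 0"
    using frame_chart[OF \<kappa> assms(2)] eq by metis
  assume I: "I \<in> hchart b"
  have up: "(\<lambda>j. if j = k then monom m else monom (b j)) =
      (mon (b(k := m)) :: 3 \<Rightarrow> (coord, 'k) mpol)" by auto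
  show "hcoeff b I (m, b k) = chdet b0 (b(k := m)) I / chdet b0 b I"
    using frame_coeff(2)[OF \<kappa> assms(2) I, of m k] unfolding up eq .
qed

lemma chart_ring_change:
  fixes b b0 :: "3 \<Rightarrow> coord expo" and g :: "(coord, 'k::field) mpol set \<Rightarrow> 'k"
  assumes "inj b0" "inj b" "g \<in> hring b"
  shows "\<exists>g'\<in>hring b0. \<exists>N. \<forall>I\<in>hchart b0 \<inter> hchart b.
     g I = g' I / chdet b0 b I ^ N"
  using assms(3) unfolding chart_ring_alg[of "range b"]
proof induction
  case (const c)
  show ?case
    by (rule bexI[of _ "\<lambda>_. c"], rule exI[of _ 0]) (auto intro: chart_ring_intros)
next
  case (gen g)
  then obtain m n where g: "g = (\<lambda>I. hcoeff b I (m, n))" by auto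
  show ?case
  proof (cases "n \<in> range b")
    case True
    then obtain k where "n = b k" by auto
    then show ?thesis
      using chart_change(2)[OF assms(1,2), of _ m k] g
      by (intro bexI[of _ "chdet b0 (b(k := m))"] exI[of _ 1]) (auto intro: chdet_in_ring)
  next
    case False
    then show ?thesis using g
      by (intro bexI[of _ "\<lambda>_. 0"] exI[of _ 0]) (auto simp: chart_coeff_outside intro: chart_ring_intros)
  qed
next
  case (add f g)
  then obtain f' g' M N where f': "f' \<in> hring b0"
      "\<forall>I\<in>hchart b0 \<inter> hchart b. f I = f' I / chdet b0 b I ^ M"
    and g': "g' \<in> hring b0"
      "\<forall>I\<in>hchart b0 \<inter> hchart b. g I = g' I / chdet b0 b I ^ N" by blast
  have "(\<lambda>I. f' I * chdet b0 b I ^ N + g' I * chdet b0 b I ^ M) \<in> hring b0"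
    by (intro chart_ring_intros f' g' chdet_in_ring)
  moreover have "\<forall>I\<in>hchart b0 \<inter> hchart b. f I + g I =
     (f' I * chdet b0 b I ^ N + g' I * chdet b0 b I ^ M) / chdet b0 b I ^ (M + N)"
  proof
    fix I :: "(coord, 'k) mpol set" assume I: "I \<in> hchart b0 \<inter> hchart b"
    then have "chdet b0 b I \<noteq> 0" using chart_change(1)[OF assms(1,2)] by blast
    then show "f I + g I = (f' I * chdet b0 b I ^ N + g' I * chdet b0 b I ^ M) / chdet b0 b I ^ (M + N)"
      using f'(2) g'(2) I by (simp add: power_add field_simps)
  qed
  ultimately show ?case by (intro bexI exI)
next
  case (mult f g)
  then obtain f' g' M N where f': "f' \<in> hring b0"
      "\<forall>I\<in>hchart b0 \<inter> hchart b. f I = f' I / chdet b0 b I ^ M"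
    and g': "g' \<in> hring b0"
      "\<forall>I\<in>hchart b0 \<inter> hchart b. g I = g' I / chdet b0 b I ^ N" by blast
  have "(\<lambda>I. f' I * g' I) \<in> hring b0"
    by (intro chart_ring_intros f' g')
  moreover have "\<forall>I\<in>hchart b0 \<inter> hchart b. f I * g I =
     (f' I * g' I) / chdet b0 b I ^ (M + N)"
    using f'(2) g'(2) by (simp add: power_add)
  ultimately show ?case by (intro bexI exI)
qed

lemma hilb_regular_local:
  fixes b0 :: "3 \<Rightarrow> coord expo" and f :: "(coord, 'k::field) mpol set \<Rightarrow> 'k"
  assumes "f \<in> regular (hilb_scheme 3) U" "J \<in> U" "inj b0" "J \<in> hchart b0"
  obtains g h where "g \<in> hring b0" "h \<in> hring b0" "h J \<noteq> 0"
    "\<And>I. I \<in> U \<Longrightarrow> I \<in> hchart b0 \<Longrightarrow> h I \<noteq> 0 \<Longrightarrow> f I = g I / h I"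
proof -
  from assms(1,2) obtain W A g h where W: "(W, A) \<in> hilb_scheme 3" and g: "g \<in> A" and h: "h \<in> A"
    and J: "J \<in> W" "h J \<noteq> 0" and f: "\<And>I. I \<in> U \<Longrightarrow> I \<in> W \<Longrightarrow> h I \<noteq> 0 \<Longrightarrow> f I = g I / h I"
    unfolding regular_def by blast
  from W obtain b :: "3 \<Rightarrow> coord expo" where b: "inj b" "W = hchart b" "A = hring b"
    by (rule hilb_atlasE)
  let ?d = "chdet b0 b :: (coord, 'k) mpol set \<Rightarrow> 'k"
  obtain g' N where g': "g' \<in> hring b0"
    "\<And>I. I \<in> hchart b0 \<Longrightarrow> I \<in> W \<Longrightarrow> g I = g' I / ?d I ^ N"
    using chart_ring_change[OF assms(3) b(1), of g] g b by blast
  obtain h' M where h': "h' \<in> hring b0"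
    "\<And>I. I \<in> hchart b0 \<Longrightarrow> I \<in> W \<Longrightarrow> h I = h' I / ?d I ^ M"
    using chart_ring_change[OF assms(3) b(1), of h] h b by blast
  have in_W: "I \<in> W \<longleftrightarrow> ?d I \<noteq> 0" if "I \<in> hchart b0" for I
    using chart_change(1)[OF assms(3) b(1) that] b(2) by simp
  \<comment> \<open>The extra factor \<open>?d\<close> makes the new denominator vanish outside
    \<open>W\<close>, so its non-vanishing already places \<open>I\<close> in both charts.\<close>
  have 1: "(\<lambda>I. g' I * ?d I ^ M * ?d I) \<in> hring b0"
    by (intro chart_ring_intros g' chdet_in_ring)
  have 2: "(\<lambda>I. h' I * ?d I ^ N * ?d I) \<in> hring b0"
    by (intro chart_ring_intros h' chdet_in_ring)
  have 3: "h' J * ?d J ^ N * ?d J \<noteq> 0"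
    using J in_W[OF assms(4)] h'(2)[OF assms(4)] by auto
  have 4: "f I = g' I * ?d I ^ M * ?d I / (h' I * ?d I ^ N * ?d I)"
    if I: "I \<in> U" "I \<in> hchart b0" "h' I * ?d I ^ N * ?d I \<noteq> 0" for I
  proof -
    have d: "?d I \<noteq> 0" and hI: "h' I \<noteq> 0" using I(3) by auto
    then have W: "I \<in> W" using in_W[OF I(2)] by simp
    have "f I = g I / h I" using f[OF I(1) W] h'(2)[OF I(2) W] d hI by simp
    then show ?thesis using g'(2)[OF I(2) W] h'(2)[OF I(2) W] d hI by (simp add: field_simps)
  qed
  from that[OF 1 2 3 4] show ?thesis .
qed

lemma hilb_open_local:
  fixes b0 :: "3 \<Rightarrow> coord expo" and J :: "(coord, 'k::field) mpol set"
  assumes "openin (htop) U" "J \<in> U" "inj b0" "J \<in> hchart b0"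
  shows "\<exists>h\<in>hring b0. h J \<noteq> 0 \<and> {I \<in> hchart b0. h I \<noteq> 0} \<subseteq> U"
  using assms(1,2) unfolding zariski_def openin_topology_generated_by_iff
proof induction
  case (Int S T)
  then obtain g h where "g \<in> hring b0" "h \<in> hring b0" "g J \<noteq> 0" "h J \<noteq> 0"
    "{I \<in> hchart b0. g I \<noteq> 0} \<subseteq> S" "{I \<in> hchart b0. h I \<noteq> 0} \<subseteq> T" by blast
  then show ?case by (intro bexI[of _ "\<lambda>I. g I * h I"]) (auto intro: chart_ring_intros)
next
  case (UN K)
  then obtain S where S: "S \<in> K" "J \<in> S" by blast
  with UN(2)[OF this] show ?case by blast
next
  case (Basis S)
  then obtain W A h where W: "(W, A) \<in> hilb_scheme 3" "h \<in> A" and S: "S = {x \<in> W. h x \<noteq> 0}" by blast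
  from W(1) obtain b :: "3 \<Rightarrow> coord expo" where b: "inj b" "W = hchart b" "A = hring b"
    by (rule hilb_atlasE)
  let ?d = "chdet b0 b :: (coord, 'k) mpol set \<Rightarrow> 'k"
  obtain h' M where h': "h' \<in> hring b0"
    "\<And>I. I \<in> hchart b0 \<Longrightarrow> I \<in> W \<Longrightarrow> h I = h' I / ?d I ^ M"
    using chart_ring_change[OF assms(3) b(1), of h] W b by blast
  have in_W: "I \<in> W \<longleftrightarrow> ?d I \<noteq> 0" if "I \<in> hchart b0" for I
    using chart_change(1)[OF assms(3) b(1) that] b(2) by simp
  have "(\<lambda>I. h' I * ?d I) \<in> hring b0"
    by (intro chart_ring_intros h' chdet_in_ring)
  moreover have "h' J * ?d J \<noteq> 0"
    using Basis S in_W[OF assms(4)] h'(2)[OF assms(4)] by auto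
  moreover have "{I \<in> hchart b0. h' I * ?d I \<noteq> 0} \<subseteq> S"
    using in_W h'(2) unfolding S by auto
  ultimately show ?case by (intro bexI conjI)
qed simp

text \<open>Compatibility at \<open>J\<close> over an arbitrary open set is reduced to functions in
  the coordinate ring of a single chart, which is the form in which the torus argument can verify
  it.\<close>

lemma compat_local:
  fixes b0 :: "3 \<Rightarrow> coord expo" and \<phi> :: "((coord, 'k::field) mpol set, 'k) sheaf_map"
  assumes \<phi>: "frobenius_splitting (hilb_scheme 3) \<phi>" and p: "1 < CHAR('k)"
    and U: "openin (htop) U" "J \<in> U" and f: "f \<in> ideal_sheaf (hilb_scheme 3) Z U"
    and b0: "inj b0" "J \<in> hchart b0"
    and Z: "\<And>g. g \<in> hring b0 \<Longrightarrow> (\<And>I. I \<in> Z \<Longrightarrow> I \<in> hchart b0 \<Longrightarrow> g I = 0) \<Longrightarrow>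
       \<phi> (hchart b0) (cut (hchart b0) g) J = 0"
  shows "\<phi> U f J = 0"
proof -
  let ?W = "hchart b0 :: (coord, 'k) mpol set set" and ?A = "hring b0 :: (_ \<Rightarrow> 'k) set"
  let ?p = "CHAR('k)"
  have fr: "f \<in> regular (hilb_scheme 3) U" and fZ: "\<And>I. I \<in> Z \<Longrightarrow> I \<in> U \<Longrightarrow> f I = 0"
    using f by (auto simp: ideal_sheaf_def)
  obtain g h where gh: "g \<in> ?A" "h \<in> ?A" "h J \<noteq> 0"
    "\<And>I. I \<in> U \<Longrightarrow> I \<in> ?W \<Longrightarrow> h I \<noteq> 0 \<Longrightarrow> f I = g I / h I"
    using hilb_regular_local[OF fr U(2) b0] by metis
  obtain h1 where h1: "h1 \<in> ?A" "h1 J \<noteq> 0" "{I \<in> ?W. h1 I \<noteq> 0} \<subseteq> U"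
    using hilb_open_local[OF U b0] by blast
  define k where "k I = h I * h1 I" for I
  have k: "k \<in> ?A" unfolding k_def[abs_def] by (intro chart_ring_intros gh h1)
  define D where "D = {I \<in> ?W. k I \<noteq> 0}"
  have D: "openin (htop) D" "D \<subseteq> ?W" "\<And>I. I \<in> D \<Longrightarrow> k I \<noteq> 0" "D \<subseteq> U" "J \<in> D"
    unfolding D_def using hilb_open_basic[OF b0(1) k] h1 gh b0(2) by (auto simp: k_def)
  \<comment> \<open>The power of \<open>k\<close> turns the denominator of \<open>f\<close> into a
    p-th power. Moreover \<open>F\<close> is zero wherever \<open>k\<close> is, so it vanishes on
    all of \<open>Z\<close> in the chart and not just on the part inside \<open>D\<close>.\<close>
  define F where "F I = g I * h1 I * k I ^ (?p - 1)" for I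
  have F: "F \<in> ?A" unfolding F_def[abs_def] by (intro chart_ring_intros gh h1 k)
  have fF: "f I = F I / k I ^ (?p * 1)" if "I \<in> D" for I
  proof -
    have kI: "k I \<noteq> 0" "h I \<noteq> 0" "h1 I \<noteq> 0" using D(3)[OF that] by (auto simp: k_def)
    have "k I ^ ?p = k I * k I ^ (?p - 1)" using p by (metis power_Suc Suc_diff_1 less_trans zero_less_one)
    then have "F I / k I ^ (?p * 1) = g I * h1 I / k I" using kI by (simp add: F_def)
    also have "\<dots> = g I / h I" using kI by (simp add: k_def)
    also have "\<dots> = f I" using gh(4)[OF subsetD[OF D(4) that] subsetD[OF D(2) that] kI(2)] by simp
    finally show ?thesis by simp
  qed
  have "\<phi> D (cut D f) = cut D (\<lambda>I. \<phi> ?W (cut ?W F) I / k I ^ 1)"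
    by (rule split_frac[OF \<phi> hilb_chart_alg[OF b0(1)] D(1-3)])
      (use F k fF in \<open>simp_all add: chart_ring_alg\<close>)
  moreover have "\<phi> D (cut D f) = cut D (\<phi> U f)"
    by (rule split_restrict[OF \<phi> U(1) D(1) D(4) fr])
  ultimately have "cut D (\<phi> U f) J = cut D (\<lambda>I. \<phi> ?W (cut ?W F) I / k I ^ 1) J" by simp
  then have "\<phi> U f J = \<phi> ?W (cut ?W F) J / k J" using D(5) by simp
  also have "\<phi> ?W (cut ?W F) J = 0"
  proof (rule Z[OF F])
    fix I assume I: "I \<in> Z" "I \<in> ?W"
    show "F I = 0"
    proof (cases "k I = 0")
      case True
      then show ?thesis using p by (simp add: F_def)
    next
      case False
      then have "I \<in> D" using I by (simp add: D_def)
      then have "f I = 0" using fZ I(1) D(4) by blast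
      then have "F I / k I ^ (?p * 1) = 0" using fF[OF \<open>I \<in> D\<close>] by simp
      then show ?thesis using False by simp
    qed
  qed
  finally show ?thesis by simp
qed

subsection \<open>Weights and the standard splitting\<close>

definition wt :: "('v::finite \<Rightarrow> nat) \<Rightarrow> 'v expo \<Rightarrow> nat" where
  "wt \<omega> m = (\<Sum>v\<in>UNIV. \<omega> v * lookup m v)"

lemma wt_add: "wt \<omega> (m + n) = wt \<omega> m + wt \<omega> n"
  by (simp add: wt_def lookup_add algebra_simps sum.distrib)

lemma wt_0 [simp]: "wt \<omega> 0 = 0"
  by (simp add: wt_def)

lemma wt_single [simp]: "wt \<omega> (Poly_Mapping.single v n) = \<omega> v * n"
proof -
  have "wt \<omega> (Poly_Mapping.single v n) = (\<Sum>w\<in>UNIV. if w = v then \<omega> v * n else 0)"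
    unfolding wt_def by (rule sum.cong) (auto simp: lookup_single when_def)
  then show ?thesis by simp
qed

lemma mval_scale: "mval (\<lambda>v. t ^ \<omega> v * q v) m = t ^ wt \<omega> m * mval q m"
  for q :: "'v::finite \<Rightarrow> 'k::comm_ring_1"
proof -
  have "mval (\<lambda>v. t ^ \<omega> v * q v) m = (\<Prod>v\<in>UNIV. (t ^ \<omega> v * q v) ^ lookup m v)"
    by (rule mval_superset) auto
  also have "\<dots> = (\<Prod>v\<in>UNIV. t ^ (\<omega> v * lookup m v)) * (\<Prod>v\<in>UNIV. q v ^ lookup m v)"
    by (simp add: power_mult_distrib power_mult prod.distrib)
  also have "(\<Prod>v\<in>UNIV. q v ^ lookup m v) = mval q m" by (rule mval_superset[symmetric]) auto
  finally show ?thesis by (simp add: wt_def power_sum)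
qed

text \<open>Weighted homogeneous polynomial functions. Weights may be zero: for the weight that
  counts only one variable, \<open>Hom \<omega> 0\<close> contains the polynomials in all the
  others.\<close>

definition Hom :: "('v::finite \<Rightarrow> nat) \<Rightarrow> nat \<Rightarrow> (('v \<Rightarrow> 'k::field) \<Rightarrow> 'k) set" where
  "Hom \<omega> n = {eval P | P. \<forall>m\<in>keys P. wt \<omega> m = n}"

lemma Hom_eval: "F \<in> Hom \<omega> n \<Longrightarrow> F \<in> range eval"
  by (auto simp: Hom_def)

lemma Hom_add:
  assumes "F \<in> Hom \<omega> n" "G \<in> Hom \<omega> n"
  shows "(\<lambda>q. F q + G q) \<in> Hom \<omega> n"
proof -
  obtain P Q where P: "F = eval P" "\<forall>m\<in>keys P. wt \<omega> m = n" and Q: "G = eval Q" "\<forall>m\<in>keys Q. wt \<omega> m = n"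
    using assms by (auto simp: Hom_def)
  have "(\<lambda>q. F q + G q) = eval (P + Q)" using P Q by (simp add: fun_eq_iff)
  moreover have "\<forall>m\<in>keys (P + Q). wt \<omega> m = n"
    using P Q Poly_Mapping.keys_add[of P Q] by blast
  ultimately show ?thesis unfolding Hom_def by blast
qed

lemma Hom_mult:
  assumes "F \<in> Hom \<omega> n" "G \<in> Hom \<omega> l"
  shows "(\<lambda>q. F q * G q) \<in> Hom \<omega> (n + l)"
proof -
  obtain P Q where P: "F = eval P" "\<forall>m\<in>keys P. wt \<omega> m = n" and Q: "G = eval Q" "\<forall>m\<in>keys Q. wt \<omega> m = l"
    using assms by (auto simp: Hom_def)
  have "(\<lambda>q. F q * G q) = eval (P * Q)" using P Q by (simp add: fun_eq_iff)
  moreover have "\<forall>m\<in>keys (P * Q). wt \<omega> m = n + l"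
    using P Q Poly_Mapping.keys_mult[of P Q] by (force simp: wt_add)
  ultimately show ?thesis unfolding Hom_def by blast
qed

lemma Hom_zero: "(\<lambda>_. 0) \<in> Hom \<omega> n"
  unfolding Hom_def by (intro CollectI exI[of _ 0]) (simp add: fun_eq_iff)

lemma Hom_const: "(\<lambda>_. c) \<in> Hom \<omega> 0"
  unfolding Hom_def by (intro CollectI exI[of _ "Const c"]) (simp add: fun_eq_iff Const_def split: if_splits)

lemma Hom_scale: "F \<in> Hom \<omega> n \<Longrightarrow> (\<lambda>q. c * F q) \<in> Hom \<omega> n"
  using Hom_mult[OF Hom_const] by fastforce

lemma Hom_uminus: "F \<in> Hom \<omega> n \<Longrightarrow> (\<lambda>q. - F q) \<in> Hom \<omega> n"
  using Hom_scale[of F \<omega> n "-1"] by simp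

lemma Hom_diff: "F \<in> Hom \<omega> n \<Longrightarrow> G \<in> Hom \<omega> n \<Longrightarrow> (\<lambda>q. F q - G q) \<in> Hom \<omega> n"
  using Hom_add[OF _ Hom_uminus] by fastforce

lemma Hom_var: "(\<lambda>q. q v) \<in> Hom \<omega> (\<omega> v)"
  unfolding Hom_def by (intro CollectI exI[of _ "Var v"]) (simp add: fun_eq_iff Var_def monom_def)

lemma Hom_power: "F \<in> Hom \<omega> n \<Longrightarrow> (\<lambda>q. F q ^ l) \<in> Hom \<omega> (n * l)"
proof (induction l)
  case 0
  show ?case using Hom_const[of 1] by simp
next
  case (Suc l)
  then show ?case using Hom_mult[of F \<omega> n "\<lambda>q. F q ^ l" "n * l"] by simp
qed

lemma Hom_sum: "(\<And>i. i \<in> S \<Longrightarrow> F i \<in> Hom \<omega> n) \<Longrightarrow> (\<lambda>q. \<Sum>i\<in>S. F i q) \<in> Hom \<omega> n"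
  by (induction S rule: infinite_finite_induct) (auto intro: Hom_zero Hom_add)

lemma Hom_prod: "(\<And>i. i \<in> S \<Longrightarrow> F i \<in> Hom \<omega> (n i)) \<Longrightarrow> (\<lambda>q. \<Prod>i\<in>S. F i q) \<in> Hom \<omega> (\<Sum>i\<in>S. n i)"
proof (induction S rule: infinite_finite_induct)
  case (insert x S)
  then show ?case using Hom_mult[of "F x" \<omega> "n x" "\<lambda>q. \<Prod>i\<in>S. F i q"] by simp
qed (use Hom_const[of 1] in auto)

lemma Hom_mval: "(\<lambda>q. mval (pt q i) m :: 'k::field) \<in> Hom (\<omega> \<circ> snd) (wt \<omega> m)"
proof -
  have 1: "mval (pt q i) m = (\<Prod>c\<in>UNIV. q (i, c) ^ lookup m c)" for q :: "3 \<times> coord \<Rightarrow> 'k"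
    unfolding pt_def by (rule mval_superset) auto
  have "(\<lambda>q. \<Prod>c\<in>UNIV. q (i, c) ^ lookup m c) \<in> Hom (\<omega> \<circ> snd) (\<Sum>c\<in>UNIV. \<omega> c * lookup m c)"
    using Hom_power[OF Hom_var[of "(i, c)" "\<omega> \<circ> snd" for c]] by (intro Hom_prod) simp
  then show ?thesis by (simp add: 1 wt_def)
qed

lemma Hom_ptdet: "ptdet b \<in> Hom (\<omega> \<circ> snd) (\<Sum>j\<in>UNIV. wt \<omega> (b j))"
proof -
  have "(\<lambda>q. \<Prod>i\<in>UNIV. mval (pt q i) (b (p i))) \<in> Hom (\<omega> \<circ> snd) (\<Sum>j\<in>UNIV. wt \<omega> (b j))"
    if p: "p permutes (UNIV :: 3 set)" for p
  proof -
    have "(\<Sum>i\<in>UNIV. wt \<omega> (b (p i))) = (\<Sum>j\<in>UNIV. wt \<omega> (b j))"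
      using sum.permute[OF p, of "\<lambda>j. wt \<omega> (b j)"] by (simp add: o_def)
    then show ?thesis
      using Hom_prod[of UNIV "\<lambda>i q. mval (pt q i) (b (p i))", OF Hom_mval[of _ _ \<omega>]] by simp
  qed
  then show ?thesis
    unfolding ptdet_def[abs_def] det_def by (intro Hom_sum Hom_scale) simp
qed

lemma ptdet_eval: "ptdet b \<in> range eval"
  using Hom_ptdet[of b "\<lambda>_. 0"] by (rule Hom_eval)

lemma mpol_eq_sum: "P = (\<Sum>m\<in>keys P. Poly_Mapping.single m (lookup P m))"
proof (rule poly_mapping_eqI)
  fix k
  have "(\<Sum>m\<in>keys P. lookup (Poly_Mapping.single m (lookup P m)) k) = (\<Sum>m\<in>keys P. if m = k then lookup P k else 0)"
    by (rule sum.cong) (auto simp: lookup_single when_def)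
  also have "\<dots> = lookup P k" by (simp add: in_keys_iff)
  finally show "lookup P k = lookup (\<Sum>m\<in>keys P. Poly_Mapping.single m (lookup P m)) k"
    by (simp add: lookup_sum)
qed

lemma lookup_monom_mult: "lookup (monom e * P) (e + m) = lookup P m"
  for P :: "('v, 'k::comm_ring_1) mpol"
  by (induction P rule: mpol_induct)
    (auto simp: distrib_left lookup_add monom_def mult_single lookup_single when_def)

lemma keys_monom_mult: "keys (monom e * P) = (+) e ` keys P"
  for P :: "('v, 'k::comm_ring_1) mpol"
proof
  show "keys (monom e * P) \<subseteq> (+) e ` keys P"
    using Poly_Mapping.keys_mult[of "monom e" P] by (auto simp: monom_def split: if_splits)
  show "(+) e ` keys P \<subseteq> keys (monom e * P)"
    by (auto simp: in_keys_iff lookup_monom_mult)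
qed

text \<open>The factor \<open>z\<^sub>1 \<cdots> z\<^sub>N\<close> cancels: the standard splitting is \<open>c z\<^sup>m \<mapsto> c\<^sup>1\<^sup>/\<^sup>p z\<^sup>m\<^sup>/\<^sup>p\<close>.\<close>

lemma eval_Tr:
  fixes P :: "('v::finite, 'k::field) mpol"
  assumes p: "0 < CHAR('k)"
  shows "eval (Tr ((\<Prod>v\<in>UNIV. Var v) ^ (CHAR('k) - 1) * P)) q =
    (\<Sum>m\<in>keys P. proot (lookup P m) *
       (if \<forall>v. CHAR('k) dvd lookup m v then \<Prod>v\<in>UNIV. q v ^ (lookup m v div CHAR('k)) else 0))"
proof -
  let ?p = "CHAR('k)"
  define e :: "'v expo" where "e = (\<Sum>v\<in>UNIV. Poly_Mapping.single v (?p - 1))"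
  have le: "lookup e v = ?p - 1" for v
  proof -
    have "lookup e v = (\<Sum>w\<in>UNIV. if w = v then ?p - 1 else 0)"
      unfolding e_def lookup_sum by (rule sum.cong) (auto simp: lookup_single when_def)
    then show ?thesis by simp
  qed
  have sg: "Var v ^ n = (monom (Poly_Mapping.single v n) :: ('v, 'k) mpol)" for v n
  proof (induction n)
    case (Suc n)
    have "Poly_Mapping.single v (Suc n) = Poly_Mapping.single v 1 + Poly_Mapping.single v n"
      by (simp add: single_add[symmetric])
    with Suc show ?case by (simp add: Var_def monom_add)
  qed simp
  have prod: "(\<Prod>v\<in>S. monom (f v)) = (monom (\<Sum>v\<in>S. f v) :: ('v, 'k) mpol)" if "finite S" for S :: "'v set" and f
    using that by induction (auto simp: monom_add)
  have "(\<Prod>v\<in>UNIV. Var v) ^ (?p - 1) = (\<Prod>v\<in>UNIV. Var v ^ (?p - 1) :: ('v, 'k) mpol)"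
    by (simp add: prod_power_distrib)
  also have "\<dots> = monom e" unfolding sg e_def by (rule prod) simp
  finally have *: "(\<Prod>v\<in>UNIV. Var v) ^ (?p - 1) * P = monom e * P" by simp
  have tm: "eval (Tr_monom (e + m) :: ('v, 'k) mpol) q =
     (if \<forall>v. ?p dvd lookup m v then \<Prod>v\<in>UNIV. q v ^ (lookup m v div ?p) else 0)" for m
  proof -
    have a: "lookup (e + m) v + 1 = lookup m v + ?p" for v using p by (simp add: lookup_add le)
    have b: "(lookup m v + ?p) div ?p - 1 = lookup m v div ?p" for v
      using p by simp
    have c: "mval q (Abs_poly_mapping f) = (\<Prod>v\<in>UNIV. q v ^ f v)" for f
      by (subst mval_superset[of UNIV]) auto
    show ?thesis unfolding Tr_monom_def a b by (simp add: c)
  qed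
  have "Tr (monom e * P) = (\<Sum>m\<in>keys P. Const (proot (lookup P m)) * Tr_monom (e + m))"
    unfolding Tr_def keys_monom_mult by (subst sum.reindex) (auto simp: lookup_monom_mult)
  then show ?thesis unfolding * by (simp add: tm)
qed

text \<open>A monomial of weight \<open>n\<close> that survives the splitting has all exponents
  divisible by p, so p divides \<open>n\<close>, and it becomes a monomial of weight n/p. Acting by
  \<open>t ^ CHAR('k)\<close> expresses this without division or roots of \<open>t\<close>.\<close>

lemma
  fixes F :: "('v::finite \<Rightarrow> 'k::field) \<Rightarrow> 'k"
  assumes "standard_splitting \<psi>" "0 < CHAR('k)" "F \<in> Hom \<omega> n"
  shows standard_kills: "\<not> CHAR('k) dvd n \<Longrightarrow> \<psi> UNIV F q = 0"
    and standard_equivariant: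
      "\<psi> UNIV F (\<lambda>v. (t ^ CHAR('k)) ^ \<omega> v * q v) = t ^ n * \<psi> UNIV F q"
proof -
  let ?p = "CHAR('k)"
  obtain P where P: "F = eval P" "\<And>m. m \<in> keys P \<Longrightarrow> wt \<omega> m = n" using assms(3) by (auto simp: Hom_def)
  have \<psi>: "\<psi> UNIV F q = (\<Sum>m\<in>keys P. proot (lookup P m) *
       (if \<forall>v. ?p dvd lookup m v then \<Prod>v\<in>UNIV. q v ^ (lookup m v div ?p) else 0))" for q
    using assms(1) unfolding standard_splitting_def P(1) eval_Tr[OF assms(2), symmetric] by simp
  {
    assume n: "\<not> ?p dvd n"
    have "\<not> (\<forall>v. ?p dvd lookup m v)" if "m \<in> keys P" for m
    proof
      assume "\<forall>v. ?p dvd lookup m v"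
      then have "?p dvd wt \<omega> m" unfolding wt_def by (intro dvd_sum) simp
      then show False using n P(2)[OF that] by simp
    qed
    then show "\<psi> UNIV F q = 0" unfolding \<psi> by (intro sum.neutral) auto
  }
  have "(\<Prod>v\<in>UNIV. ((t ^ ?p) ^ \<omega> v * q v) ^ (lookup m v div ?p)) =
      t ^ n * (\<Prod>v\<in>UNIV. q v ^ (lookup m v div ?p))"
    if m: "m \<in> keys P" "\<forall>v. ?p dvd lookup m v" for m
  proof -
    have "((t ^ ?p) ^ \<omega> v) ^ (lookup m v div ?p) = t ^ (\<omega> v * lookup m v)" for v
    proof -
      have "lookup m v = ?p * (lookup m v div ?p)" using m(2) by simp
      then have "?p * \<omega> v * (lookup m v div ?p) = \<omega> v * lookup m v"
        by (metis mult.assoc mult.commute)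
      then show ?thesis by (simp only: power_mult[symmetric])
    qed
    then have "(\<Prod>v\<in>UNIV. ((t ^ ?p) ^ \<omega> v * q v) ^ (lookup m v div ?p)) =
      (\<Prod>v\<in>UNIV. t ^ (\<omega> v * lookup m v)) * (\<Prod>v\<in>UNIV. q v ^ (lookup m v div ?p))"
      by (simp add: power_mult_distrib prod.distrib)
    moreover have "(\<Prod>v\<in>UNIV. t ^ (\<omega> v * lookup m v)) = t ^ n"
      using P(2)[OF m(1)] by (simp only: wt_def power_sum[symmetric])
    ultimately show ?thesis by simp
  qed
  then show "\<psi> UNIV F (\<lambda>v. (t ^ ?p) ^ \<omega> v * q v) = t ^ n * \<psi> UNIV F q"
    unfolding \<psi> sum_distrib_left by (intro sum.cong) (auto simp: mult_ac)
qed

subsection \<open>The symmetric product\<close>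

lemma orbit_pt: "orbit q = image_mset (pt q) (mset_set UNIV)"
  by (simp add: orbit_def pt_def[abs_def])

definition sym_inv :: "((3 \<times> coord \<Rightarrow> 'k) \<Rightarrow> 'a) \<Rightarrow> bool" where
  "sym_inv F \<longleftrightarrow> (\<forall>q q'. orbit q = orbit q' \<longrightarrow> F q = F q')"

definition desc :: "((3 \<times> coord \<Rightarrow> 'k) \<Rightarrow> 'a) \<Rightarrow> (coord \<Rightarrow> 'k) multiset \<Rightarrow> 'a" where
  "desc F M = F (SOME q. orbit q = M)"

lemma desc_orbit: "sym_inv F \<Longrightarrow> desc F (orbit q) = F q"
  unfolding desc_def sym_inv_def by (metis (mono_tags, lifting) someI)

lemma orbit_eq_obtain:
  assumes "orbit q = orbit (q' :: 3 \<times> coord \<Rightarrow> 'k)"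
  obtains p :: "3 \<Rightarrow> 3" where "p permutes UNIV" "\<And>i. pt q i = pt q' (p i)"
proof -
  from assms have "image_mset (pt q) (mset_set UNIV) = image_mset (pt q') (mset_set UNIV)"
    by (simp add: orbit_pt)
  from image_mset_eq_implies_permutes[OF finite this]
  obtain p where "p permutes UNIV" "\<forall>i\<in>UNIV. pt q i = pt q' (p i)" .
  then show ?thesis using that by blast
qed

text \<open>A permutation of the points multiplies both alternants by its sign, and the signs
  cancel. Invariant fractions therefore get powers of the square of \<open>ptdet b\<close> as
  denominators.\<close>

lemma sym_inv_ptdet2: "sym_inv (\<lambda>q. ptdet b q * ptdet b' q :: 'k::field)"
  unfolding sym_inv_def
proof (intro allI impI)
  fix q q' :: "3 \<times> coord \<Rightarrow> 'k" assume "orbit q = orbit q'"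
  then obtain p where p: "p permutes (UNIV :: 3 set)" "\<And>i. pt q i = pt q' (p i)"
    using orbit_eq_obtain by blast
  have *: "ptdet c q = of_int (sign p) * ptdet c q'" for c
    unfolding ptdet_def p(2) using det_permute_rows[OF p(1), of "\<chi> i j. mval (pt q' i) (c j)"] by simp
  have "of_int (sign p) * of_int (sign p) = (1 :: 'k)"
    by (simp add: sign_def)
  then show "ptdet b q * ptdet b' q = ptdet b q' * ptdet b' q'"
    unfolding * by (metis mult.assoc mult.commute mult.left_neutral)
qed

lemma sym_inv_add: "sym_inv F \<Longrightarrow> sym_inv G \<Longrightarrow> sym_inv (\<lambda>q. F q + G q)"
  and sym_inv_mult: "sym_inv F \<Longrightarrow> sym_inv G \<Longrightarrow> sym_inv (\<lambda>q. F q * G q)"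
  and sym_inv_power: "sym_inv F \<Longrightarrow> sym_inv (\<lambda>q. F q ^ n)"
  and sym_inv_const: "sym_inv (\<lambda>q. c)"
  unfolding sym_inv_def by metis+

lemmas eval_intros = alg_intros[where G = "range (\<lambda>v q. q v)", folded range_eval_alg]

text \<open>An invariant numerator and denominator let a chart function descend to the symmetric
  product, where \<open>\<sigma>\<close> acts.\<close>

lemma chart_ring_pts:
  fixes b :: "3 \<Rightarrow> coord expo" and f :: "(coord, 'k::field) mpol set \<Rightarrow> 'k"
  assumes "inj b" "f \<in> hring b"
  shows "\<exists>Q\<in>range eval. \<exists>N. sym_inv Q \<and>
    (\<forall>q. ptdet b q \<noteq> 0 \<longrightarrow> f (pts_ideal q) = Q q / (ptdet b q * ptdet b q) ^ N)"
  using assms(2) unfolding chart_ring_alg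
proof induction
  case (const c)
  show ?case
    by (rule bexI[of _ "\<lambda>_. c"], rule exI[of _ 0]) (auto intro: eval_intros sym_inv_const)
next
  case (gen g)
  then obtain m n where g: "g = (\<lambda>I. hcoeff b I (m, n))" by auto
  show ?case
  proof (cases "n \<in> range b")
    case True
    then obtain k where n: "n = b k" by auto
    show ?thesis
    proof (intro bexI exI conjI allI impI)
      show "sym_inv (\<lambda>q. ptdet (b(k := m)) q * ptdet b q :: 'k)" by (rule sym_inv_ptdet2)
      show "(\<lambda>q. ptdet (b(k := m)) q * ptdet b q) \<in> range eval" by (intro eval_intros ptdet_eval)
      fix q :: "3 \<times> coord \<Rightarrow> 'k" assume "ptdet b q \<noteq> 0"
      then show "g (pts_ideal q) = ptdet (b(k := m)) q * ptdet b q / (ptdet b q * ptdet b q) ^ 1"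
        using pts_coeff[OF assms(1), of q m k] by (simp add: g n)
    qed
  next
    case False
    have "g (pts_ideal q) = 0" if "ptdet b q \<noteq> 0" for q
      using chart_coeff_outside[OF _ False, of "pts_ideal q" m] pts_chart[OF assms(1), of q] that
      by (simp add: g)
    then show ?thesis
      by (intro bexI[of _ "\<lambda>_. 0"] exI[of _ 0]) (auto intro: eval_intros sym_inv_const)
  qed
next
  case (add f g)
  obtain P M where P: "P \<in> range eval" "sym_inv P"
    "\<And>q. ptdet b q \<noteq> 0 \<Longrightarrow> f (pts_ideal q) = P q / (ptdet b q * ptdet b q) ^ M" using add.IH(1) by blast
  obtain Q N where Q: "Q \<in> range eval" "sym_inv Q"
    "\<And>q. ptdet b q \<noteq> 0 \<Longrightarrow> g (pts_ideal q) = Q q / (ptdet b q * ptdet b q) ^ N" using add.IH(2) by blast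
  let ?d = "\<lambda>q. ptdet b q * ptdet b q :: 'k"
  show ?case
  proof (intro bexI exI conjI allI impI)
    show "sym_inv (\<lambda>q. P q * ?d q ^ N + Q q * ?d q ^ M)"
      by (intro sym_inv_add sym_inv_mult sym_inv_power P Q sym_inv_ptdet2)
    show "(\<lambda>q. P q * ?d q ^ N + Q q * ?d q ^ M) \<in> range eval"
      by (intro eval_intros P Q ptdet_eval)
    fix q :: "3 \<times> coord \<Rightarrow> 'k" assume "ptdet b q \<noteq> 0"
    then show "f (pts_ideal q) + g (pts_ideal q) = (P q * ?d q ^ N + Q q * ?d q ^ M) / ?d q ^ (M + N)"
      using P(3)[of q] Q(3)[of q] by (simp add: power_add field_simps)
  qed
next
  case (mult f g)
  obtain P M where P: "P \<in> range eval" "sym_inv P"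
    "\<And>q. ptdet b q \<noteq> 0 \<Longrightarrow> f (pts_ideal q) = P q / (ptdet b q * ptdet b q) ^ M" using mult.IH(1) by blast
  obtain Q N where Q: "Q \<in> range eval" "sym_inv Q"
    "\<And>q. ptdet b q \<noteq> 0 \<Longrightarrow> g (pts_ideal q) = Q q / (ptdet b q * ptdet b q) ^ N" using mult.IH(2) by blast
  let ?d = "\<lambda>q. ptdet b q * ptdet b q :: 'k"
  show ?case
  proof (intro bexI exI conjI allI impI)
    show "sym_inv (\<lambda>q. P q * Q q)" by (intro sym_inv_mult P Q)
    show "(\<lambda>q. P q * Q q) \<in> range eval" by (intro eval_intros P Q)
    fix q :: "3 \<times> coord \<Rightarrow> 'k" assume "ptdet b q \<noteq> 0"
    then show "f (pts_ideal q) * g (pts_ideal q) = P q * Q q / ?d q ^ (M + N)"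
      using P(3)[of q] Q(3)[of q] by (simp add: power_add)
  qed
qed

lemma zeros_pts_ideal: "zeros (pts_ideal q) = range (pt q)"
proof
  show "range (pt q) \<subseteq> zeros (pts_ideal q)" by (auto simp: zeros_def pts_ideal_def)
  show "zeros (pts_ideal q) \<subseteq> range (pt q)"
  proof (rule subsetI, rule ccontr)
    fix a assume a: "a \<in> zeros (pts_ideal q)" "a \<notin> range (pt q)"
    then have "\<forall>i. \<exists>c. a c \<noteq> pt q i c" by (metis ext rangeI)
    then obtain c where c: "\<And>i. a (c i) \<noteq> pt q i (c i)" by metis
    \<comment> \<open>One linear factor for each point, chosen in a coordinate that separates it
      from \<open>a\<close>.\<close>
    define f where "f = (\<Prod>i\<in>UNIV. Var (c i) - Const (pt q i (c i)))"
    have "eval f (pt q j) = 0" for j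
      unfolding f_def eval_prod by (rule prod_zero[OF finite]) (auto intro!: bexI[of _ j])
    then have "f \<in> pts_ideal q" by (simp add: pts_ideal_def)
    moreover have "eval f a \<noteq> 0" using c by (simp add: f_def)
    ultimately show False using a(1) by (simp add: zeros_def)
  qed
qed

lemma inj_pt: "ptdet b q \<noteq> 0 \<Longrightarrow> inj (pt q)"
proof (rule ccontr)
  assume d: "ptdet b q \<noteq> 0" and "\<not> inj (pt q)"
  then obtain i j where ij: "i \<noteq> j" "pt q i = pt q j" by (auto simp: inj_def)
  have "ptdet b q = 0"
    unfolding ptdet_def by (rule det_identical_rows[OF ij(1)]) (simp add: row_def ij(2))
  with d show False by simp
qed

lemma orbit_inj: "inj (pt q) \<Longrightarrow> orbit q = mset_set (range (pt q))"
  by (simp add: orbit_pt image_mset_mset_set)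

lemma ptdet_mvv: "ptdet (mvv v) q = (q (2, v) - q (1, v)) * (q (3, v) - q (1, v)) * (q (3, v) - q (2, v))"
  unfolding ptdet_def det_3 by (simp add: pt_def algebra_simps power2_eq_square)

text \<open>The discriminant of \<open>v\<^sup>3 - d v\<^sup>2 - e v - f\<close>.\<close>

definition disc :: "coord \<Rightarrow> (coord, 'k::field) mpol set \<Rightarrow> 'k" where
  "disc v I = (let d = hcoeff (mvv v) I (sg v 3, sg v 2);
                   e = hcoeff (mvv v) I (sg v 3, sg v (Suc 0));
                   f = hcoeff (mvv v) I (sg v 3, 0)
     in d * d * e * e + 4 * e * e * e - 4 * d * d * d * f - 18 * d * e * f - 27 * f * f)"

lemma disc_in_ring: "disc v \<in> hring (mvv v)"
  unfolding disc_def[abs_def] Let_def by (intro chart_ring_intros)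

lemma disc_roots:
  fixes r1 r2 r3 :: "'k::comm_ring_1"
  assumes "d = r1 + r2 + r3" "e = - (r1 * r2 + r1 * r3 + r2 * r3)" "f = r1 * r2 * r3"
  shows "d * d * e * e + 4 * e * e * e - 4 * d * d * d * f - 18 * d * e * f - 27 * f * f =
    ((r2 - r1) * (r3 - r1) * (r3 - r2)) ^ 2"
  unfolding assms by (simp add: algebra_simps power2_eq_square)

lemma cubic_roots:
  fixes d e f :: "'k::alg_closed_field"
  obtains r1 r2 r3 where "d = r1 + r2 + r3" "e = - (r1 * r2 + r1 * r3 + r2 * r3)" "f = r1 * r2 * r3"
proof -
  let ?P = "[:- f, - e, - d, 1:]"
  obtain A where A: "size A = degree ?P" "?P = smult (lead_coeff ?P) (\<Prod>x\<in>#A. [:- x, 1:])"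
    using alg_closed_imp_factorization[of ?P] by auto
  have "size A = Suc (Suc (Suc 0))" using A(1) by simp
  then obtain r1 B where B: "A = add_mset r1 B" "size B = Suc (Suc 0)"
    by (metis size_eq_Suc_imp_eq_union size_add_mset nat.inject)
  then obtain r2 C where C: "B = add_mset r2 C" "size C = Suc 0"
    by (metis size_eq_Suc_imp_eq_union size_add_mset nat.inject)
  then obtain r3 where "C = {#r3#}" by (metis One_nat_def size_1_singleton_mset)
  with B C have A3: "A = {#r1, r2, r3#}" by simp
  have "?P = [:- r1, 1:] * ([:- r2, 1:] * [:- r3, 1:])" using A(2) A3 by simp
  then have "f = r1 * r2 * r3" "e = - (r1 * r2 + r1 * r3 + r2 * r3)" "d = r1 + r2 + r3"
    by (simp_all add: algebra_simps) (metis add.commute add.left_commute add_diff_cancel_left' diff_conv_add_uminus minus_add_distrib minus_minus)+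
  then show ?thesis using that by blast
qed

lemma pts_cubic:
  fixes q :: "3 \<times> coord \<Rightarrow> 'k::field"
  assumes "ptdet (mvv v) q \<noteq> 0"
  defines "C \<equiv> hcoeff (mvv v) (pts_ideal q)"
  shows "C (sg v 3, sg v 2) = q (1, v) + q (2, v) + q (3, v)"
    and "C (sg v 3, sg v (Suc 0)) = - (q (1, v) * q (2, v) + q (1, v) * q (3, v) + q (2, v) * q (3, v))"
    and "C (sg v 3, 0) = q (1, v) * q (2, v) * q (3, v)"
proof -
  let ?c = "trip (q (1, v) * q (2, v) * q (3, v)) (- (q (1, v) * q (2, v) + q (1, v) * q (3, v) + q (2, v) * q (3, v)))
    (q (1, v) + q (2, v) + q (3, v))"
  have *: "C (sg v 3, mvv v j) = ?c j" for j
    unfolding C_def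
  proof (rule pts_coeff_unique[OF inj_mvv assms(1)])
    have "\<forall>i. mval (pt q i) (sg v 3) = (\<Sum>j\<in>UNIV. ?c j * mval (pt q i) (mvv v j))"
      unfolding sum_3 forall_3 by (simp add: pt_def algebra_simps power2_eq_square power3_eq_cube)
    then show "mval (pt q i) (sg v 3) = (\<Sum>j\<in>UNIV. ?c j * mval (pt q i) (mvv v j))" for i by blast
  qed
  show "C (sg v 3, sg v 2) = q (1, v) + q (2, v) + q (3, v)" using *[of 3] by simp
  show "C (sg v 3, sg v (Suc 0)) = - (q (1, v) * q (2, v) + q (1, v) * q (3, v) + q (2, v) * q (3, v))"
    using *[of 2] by simp
  show "C (sg v 3, 0) = q (1, v) * q (2, v) * q (3, v)" using *[of 1] by simp
qed

text \<open>The relations for u and v^3 alone reduce every polynomial to 1, v, v^2, whatever ideal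
  \<open>K\<close> contains them.\<close>

lemma mvv_span:
  fixes u v :: coord and K :: "(coord, 'k::field) mpol set"
  assumes K: "is_ideal K" and uv: "u \<noteq> v"
    and 1: "Var u - lin (mon (mvv v)) a \<in> K"
    and 2: "Var v ^ 3 - lin (mon (mvv v)) c \<in> K"
  shows "f \<in> mod_span K (mon (mvv v))"
proof -
  let ?S = "mod_span K (mon (mvv v))"
  note add = mod_span_add[OF K] and cst = mod_span_Const[OF K] and KS = mod_span_ideal[OF K]
  have e: "1 \<in> ?S" "Var v \<in> ?S" "Var v ^ 2 \<in> ?S"
    using mod_span_basis[OF K, of "mon (mvv v)" 1] mod_span_basis[OF K, of "mon (mvv v)" 2]
      mod_span_basis[OF K, of "mon (mvv v)" 3] by (simp_all add: monom_sg)
  have "Var v ^ 3 \<in> ?S" using add[OF KS[OF 2] mod_span_lin[OF K, of "mon (mvv v)" c]] by simp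
  then have "Var v * monom (mvv v j) \<in> ?S" for j
    using exhaust_3[of j] e by (auto simp: monom_sg power2_eq_square power3_eq_cube mult.assoc)
  then have v: "Var v * f \<in> ?S" if "f \<in> ?S" for f using mod_span_mult[OF K _ that] by blast
  have u: "Var u * f \<in> ?S" if "f \<in> ?S" for f
  proof -
    have "Var u * f = f * (Var u - lin (mon (mvv v)) a) + (Const (a $ 1) * f + (Const (a $ 2) * (Var v * f)
       + Const (a $ 3) * (Var v * (Var v * f))))"
      by (simp add: lin_trip monom_sg algebra_simps power2_eq_square)
    also have "\<dots> \<in> ?S" by (intro add cst v that KS[OF ideal_mult[OF K 1]])
    finally show ?thesis .
  qed
  show ?thesis by (rule mod_span_UNIV[OF K uv e(1) u v])
qed

text \<open>Let \<open>K\<close> be the part of \<open>I\<close> that vanishes at the point. Both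
  defining relations lie in \<open>K\<close>, so any \<open>f\<close> in \<open>I\<close> equals a
  combination of 1, v, v^2 modulo \<open>K\<close>. That combination lies in \<open>I\<close>, hence
  is 0, and so \<open>f\<close> itself lies in \<open>K\<close>.\<close>

lemma root_in_zeros:
  fixes u v :: coord
  assumes I: "I \<in> hchart (mvv v)" and uv: "u \<noteq> v"
  defines "C \<equiv> hcoeff (mvv v) I"
  assumes r: "r ^ 3 = C (sg v 3, 0) + C (sg v 3, sg v (Suc 0)) * r + C (sg v 3, sg v 2) * r ^ 2"
  shows "(\<lambda>c. if c = v then r else C (sg u 1, 0) + C (sg u 1, sg v (Suc 0)) * r + C (sg u 1, sg v 2) * r ^ 2)
    \<in> zeros I" (is "?P \<in> zeros I")
proof -
  define a where "a = (\<chi> j. C (sg u 1, mvv v j))"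
  define c where "c = (\<chi> j. C (sg v 3, mvv v j))"
  have 1: "Var u - lin (mon (mvv v)) a \<in> I"
    using chart_coeff_mem[OF inj_mvv I, of "sg u 1"] unfolding a_def C_def by (simp add: monom_sg)
  have 2: "Var v ^ 3 - lin (mon (mvv v)) c \<in> I"
    using chart_coeff_mem[OF inj_mvv I, of "sg v 3"] unfolding c_def C_def monom_sg .
  have 3: "eval (Var u - lin (mon (mvv v)) a) ?P = 0" using uv by (simp add: lin_trip monom_sg a_def)
  have 4: "eval (Var v ^ 3 - lin (mon (mvv v)) c) ?P = 0" using r by (simp add: lin_trip monom_sg c_def)
  have K: "is_ideal (I \<inter> {f. eval f ?P = 0})"
    using chart_ideal[OF I] by (auto simp: is_ideal_iff)
  show ?thesis unfolding zeros_def
  proof (intro CollectI ballI)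
    fix f assume f: "f \<in> I"
    have "f \<in> mod_span (I \<inter> {f. eval f ?P = 0}) (mon (mvv v))"
      by (rule mvv_span[OF K uv, where a = a and c = c]) (use 1 2 3 4 in auto)
    then obtain w where w: "f - lin (mon (mvv v)) w \<in> I \<inter> {f. eval f ?P = 0}"
      unfolding mod_span_def by auto
    have "f - (f - lin (mon (mvv v)) w) \<in> I" using ideal_diff[OF chart_ideal[OF I] f] w by blast
    then have "w = 0" using chart_lin_eq_0[OF inj_mvv I] by simp
    with w show "eval f ?P = 0" by simp
  qed
qed

text \<open>Triples with pairwise distinct v-coordinates whose ideal lies in the chart of
  \<open>b\<close>. Distinct v-coordinates are demanded, not merely distinct points, because on the
  chart of \<open>mvv v\<close> this is the non-vanishing of one regular function, the
  discriminant.\<close>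

definition good :: "coord \<Rightarrow> (3 \<Rightarrow> coord expo) \<Rightarrow> (3 \<times> coord \<Rightarrow> 'k::field) set" where
  "good v b = {q. ptdet (mvv v) q \<noteq> 0 \<and> ptdet b q \<noteq> 0}"

text \<open>Hence the ideals of good triples form an open set. Conversely to the computation of the
  discriminant, the roots of the cubic lift to three points of \<open>zeros I\<close> on the curve u
  = a + b v + c v^2, and an inclusion between two ideals of the same chart is an equality.\<close>

lemma pts_locus:
  fixes u v :: coord
  assumes uv: "u \<noteq> v" and b: "inj b"
  shows "pts_ideal ` good v b =
    {I \<in> hchart (mvv v). disc v (I :: (coord, 'k::alg_closed_field) mpol set) \<noteq> 0} \<inter> hchart b"
    (is "?L = ?R")
proof
  show "?L \<subseteq> ?R"
  proof
    fix I assume "I \<in> ?L"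
    then obtain q where q: "I = pts_ideal q" "ptdet (mvv v) q \<noteq> 0" "ptdet b q \<noteq> 0" by (auto simp: good_def)
    have "disc v I = ((q (2, v) - q (1, v)) * (q (3, v) - q (1, v)) * (q (3, v) - q (2, v))) ^ 2"
      unfolding disc_def Let_def q(1) using pts_cubic[OF q(2)] by (intro disc_roots) auto
    then have "disc v I \<noteq> 0" using q(2) by (simp add: ptdet_mvv)
    then show "I \<in> ?R" using q pts_chart[OF inj_mvv[of v], of q] pts_chart[OF b, of q] by auto
  qed
  show "?R \<subseteq> ?L"
  proof
    fix I assume "I \<in> ?R"
    then have I: "I \<in> hchart (mvv v)" "disc v I \<noteq> 0" "I \<in> hchart b" by auto
    let ?C = "hcoeff (mvv v) I"
    obtain r1 r2 r3 where r: "?C (sg v 3, sg v 2) = r1 + r2 + r3"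
      "?C (sg v 3, sg v (Suc 0)) = - (r1 * r2 + r1 * r3 + r2 * r3)" "?C (sg v 3, 0) = r1 * r2 * r3"
      by (rule cubic_roots)
    have "disc v I = ((r2 - r1) * (r3 - r1) * (r3 - r2)) ^ 2"
      unfolding disc_def Let_def using r by (intro disc_roots) auto
    then have ne: "(r2 - r1) * (r3 - r1) * (r3 - r2) \<noteq> 0" using I(2) by auto
    define P where "P s = (\<lambda>w. if w = v then s else
        ?C (sg u 1, 0) + ?C (sg u 1, sg v (Suc 0)) * s + ?C (sg u 1, sg v 2) * s ^ 2)" for s
    define q where "q = (\<lambda>(i, w). P (trip r1 r2 r3 i) w)"
    have d: "ptdet (mvv v) q \<noteq> 0" using ne by (simp add: ptdet_mvv q_def P_def)
    have "\<forall>i. P (trip r1 r2 r3 i) \<in> zeros I"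
      unfolding forall_3 P_def
      by (intro conjI root_in_zeros[OF I(1) uv]; unfold r trip_simps)
        (simp_all add: algebra_simps power2_eq_square power3_eq_cube)
    then have "I \<subseteq> pts_ideal q" by (auto simp: zeros_def pts_ideal_def pt_def q_def)
    from pts_ideal_eqI[OF I(1) inj_mvv this d] have Iq: "I = pts_ideal q" .
    then have "ptdet b q \<noteq> 0" using I(3) pts_chart[OF b, of q] by simp
    with d Iq show "I \<in> ?L" by (auto simp: good_def)
  qed
qed

subsection \<open>Transfer of the splitting to triples of points\<close>

lemma Hom_scale_arg: "F \<in> Hom \<omega> n \<Longrightarrow> F (\<lambda>v. t ^ \<omega> v * q v) = t ^ n * F q"
proof -
  assume "F \<in> Hom \<omega> n"
  then obtain P where P: "F = eval P" "\<And>m. m \<in> keys P \<Longrightarrow> wt \<omega> m = n" by (auto simp: Hom_def)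
  have e: "eval P q = (\<Sum>m\<in>keys P. lookup P m * mval q m)" for q
    by (rule eval_superset) auto
  show ?thesis
    unfolding P(1) e sum_distrib_left by (intro sum.cong) (auto simp: mval_scale P(2))
qed

locale induced =
  fixes \<psi> :: "(3 \<times> coord \<Rightarrow> 'k::alg_closed_field, 'k) sheaf_map"
    and \<sigma> :: "((coord \<Rightarrow> 'k) multiset, 'k) sheaf_map"
    and \<phi> :: "((coord, 'k) mpol set, 'k) sheaf_map"
  assumes char: "CHAR('k) > fact 3"
    and std: "standard_splitting \<psi>"
    and quot: "quotient_splitting \<psi> \<sigma>"
    and ind: "induced_splitting TYPE(3) \<sigma> \<phi>"
begin

lemma p_gt: "CHAR('k) > 6" "CHAR('k) > 1" "CHAR('k) > 0"
  using char by (simp_all add: fact_numeral)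

lemma p_prime: "prime CHAR('k)"
  using prime_CHAR_semidom p_gt(3) by blast

lemma of_nat_ne: "0 < n \<Longrightarrow> n < CHAR('k) \<Longrightarrow> of_nat n \<noteq> (0 :: 'k)"
  by (metis nat_dvd_not_less of_nat_eq_0_iff_char_dvd)

lemma phi_split: "frobenius_splitting (hilb_scheme 3) \<phi>"
  using ind by (simp add: induced_splitting_def)

lemma psi_split: "frobenius_splitting affine_space \<psi>"
  using std by (simp add: standard_splitting_def)

lemma affine_atlas: "(UNIV, alg (range (\<lambda>v q. q v))) \<in> (affine_space :: (3 \<times> coord \<Rightarrow> 'k, 'k) atlas)"
  by (simp add: affine_space_def range_eval_alg)

lemma cut_UNIV [simp]: "cut UNIV f = f"
  by (simp add: cut_def)

lemma affine_regular: "F \<in> range eval \<Longrightarrow> F \<in> regular affine_space (UNIV :: (3 \<times> coord \<Rightarrow> 'k) set)"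
  using regular_alg[OF affine_atlas subset_UNIV[of UNIV], of F] unfolding range_eval_alg by simp

lemma affine_open: "openin (zariski affine_space) (UNIV :: (3 \<times> coord \<Rightarrow> 'k) set)"
  by (rule zariski_chart_open[OF affine_atlas alg.const])

abbreviation T where "T \<equiv> \<psi> UNIV"

lemma T_add: "F \<in> range eval \<Longrightarrow> G \<in> range eval \<Longrightarrow> T (\<lambda>q. F q + G q) = (\<lambda>q. T F q + T G q)"
  by (intro split_add[OF psi_split affine_open] affine_regular)

lemma T_pmult: "F \<in> range eval \<Longrightarrow> G \<in> range eval \<Longrightarrow> T (\<lambda>q. F q ^ CHAR('k) * G q) = (\<lambda>q. F q * T G q)"
  by (intro split_pmult[OF psi_split affine_open] affine_regular)

lemma T_pow: "F \<in> range eval \<Longrightarrow> T (\<lambda>q. F q ^ CHAR('k)) = F"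
  by (intro split_pow[OF psi_split affine_open] affine_regular)

lemma T_kills: "F \<in> Hom \<omega> n \<Longrightarrow> \<not> CHAR('k) dvd n \<Longrightarrow> T F = (\<lambda>_. 0)"
  using standard_kills[OF std p_gt(3)] by blast

lemma T_0: "T (\<lambda>_. 0) = (\<lambda>_. 0)"
  by (rule T_kills[OF Hom_zero[where n = 1]]) (use p_gt in auto)

lemma T_sum: "(\<And>i. i \<in> S \<Longrightarrow> F i \<in> range eval) \<Longrightarrow>
    T (\<lambda>q. \<Sum>i\<in>S. F i q) = (\<lambda>q. \<Sum>i\<in>S. T (F i) q)"
proof (induction S rule: infinite_finite_induct)
  case (insert x S)
  have "(\<lambda>q. \<Sum>i\<in>S. F i q) \<in> range eval" using insert.prems by (intro eval_intros) auto
  with insert show ?case using T_add[of "F x" "\<lambda>q. \<Sum>i\<in>S. F i q"] by simp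
qed (simp_all add: T_0)

text \<open>The link between \<open>\<phi>\<close> and the standard splitting: restrict to the open
  set of good triples, pass to the symmetric product, pull back along \<open>orbit\<close>, and take
  out the p-th power in the denominator.\<close>

lemma phi_pts:
  fixes b :: "3 \<Rightarrow> coord expo" and f :: "(coord, 'k) mpol set \<Rightarrow> 'k"
  assumes uv: "u \<noteq> v" and b: "inj b" and f: "f \<in> hring b"
    and F: "F \<in> range eval" and fF: "\<And>q. q \<in> good v b \<Longrightarrow> f (pts_ideal q) = F q / ptdet b q ^ (CHAR('k) * N)"
    and q: "q \<in> good v b"
  shows "\<phi> (hchart b) (cut (hchart b) f) (pts_ideal q) = T F q / ptdet b q ^ N"
proof -
  let ?W = "hchart b :: (coord, 'k) mpol set set"
  let ?sym = "sym_product TYPE(3) :: (_, 'k) atlas"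
  let ?A = "{f. f \<circ> (orbit :: (3 \<times> coord \<Rightarrow> 'k) \<Rightarrow> _) \<in> range eval}"
  have atlas: "(range (orbit :: (3 \<times> coord \<Rightarrow> 'k) \<Rightarrow> _), ?A) \<in> ?sym" by (simp add: sym_product_def)
  define \<delta> where "\<delta> q = (ptdet (mvv v) q * ptdet (mvv v) q) * (ptdet b q * ptdet b q)" for q :: "3 \<times> coord \<Rightarrow> 'k"
  have \<delta>: "sym_inv \<delta>" "\<delta> \<in> range eval"
    unfolding \<delta>_def[abs_def] by (intro sym_inv_mult sym_inv_ptdet2) (intro eval_intros ptdet_eval)
  have good: "q \<in> good v b \<longleftrightarrow> \<delta> q \<noteq> 0" for q by (simp add: good_def \<delta>_def)
  have descA: "desc G \<in> ?A" "desc G \<circ> orbit = G" if "sym_inv G" "G \<in> range eval" for G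
  proof -
    show *: "desc G \<circ> orbit = G" using desc_orbit[OF that(1)] by auto
    then show "desc G \<in> ?A" using that(2) by simp
  qed
  define U where "U = {M \<in> range (orbit :: (3 \<times> coord \<Rightarrow> 'k) \<Rightarrow> _). desc \<delta> M \<noteq> 0}"
  have U: "openin (zariski ?sym) U" "U \<subseteq> range (orbit :: (3 \<times> coord \<Rightarrow> 'k) \<Rightarrow> _)"
    unfolding U_def using zariski_basic_open[OF atlas descA(1)[OF \<delta>]] by auto
  have orbU: "orbit q \<in> U \<longleftrightarrow> q \<in> good v b" for q
    by (simp add: U_def good desc_orbit[OF \<delta>(1)])
  have Ugood: "\<exists>q\<in>good v b. M = orbit q" if "M \<in> U" for M
    using that U(2) orbU by auto
  have inj: "inj (pt q)" if "q \<in> good v b" for q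
    using that inj_pt by (auto simp: good_def)
  have cyc: "cycle (pts_ideal q) = orbit q" if "q \<in> good v b" for q
    using orbit_inj[OF inj[OF that]] by (simp add: cycle_def zeros_pts_ideal)
  have count: "\<forall>M\<in>U. \<forall>a. count M a \<le> 1"
  proof (intro ballI allI)
    fix M a assume "M \<in> U"
    then obtain q where q: "q \<in> good v b" "M = orbit q" using Ugood by blast
    then show "count M a \<le> 1" using orbit_inj[OF inj[OF q(1)]] by (simp add: count_mset_set')
  qed
  define V where "V = {I \<in> distinct_locus 3. cycle I \<in> U}"
  have V: "V = pts_ideal ` good v b"
  proof (intro equalityI subsetI)
    fix I :: "(coord, 'k) mpol set" assume "I \<in> V"
    then have I: "I \<in> Hilb 3" "finite (zeros I)" "cycle I \<in> U"
      by (auto simp: V_def distinct_locus_def)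
    obtain q where q: "q \<in> good v b" "cycle I = orbit q" using Ugood[OF I(3)] by blast
    have "zeros I = set_mset (cycle I)" using I(2) by (simp add: cycle_def)
    also have "\<dots> = range (pt q)" by (simp add: q(2) orbit_pt)
    finally have "I \<subseteq> pts_ideal q" by (auto simp: zeros_def pts_ideal_def)
    then have "I = pts_ideal q" using Hilb_pts_ideal[OF I(1)] q(1) by (auto simp: good_def)
    with q(1) show "I \<in> pts_ideal ` good v b" by blast
  next
    fix I :: "(coord, 'k) mpol set" assume "I \<in> pts_ideal ` good v b"
    then obtain q where q: "q \<in> good v b" "I = pts_ideal q" by blast
    have "I \<in> Hilb 3" using chart_Hilb[OF b, of I] pts_chart[OF b, of q] q by (simp add: good_def)
    moreover have "card (zeros I) = 3" using card_image[OF inj[OF q(1)]] by (simp add: q(2) zeros_pts_ideal)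
    moreover have "finite (zeros I)" by (simp add: q(2) zeros_pts_ideal)
    ultimately show "I \<in> V" using cyc[OF q(1)] orbU[of q] q by (simp add: V_def distinct_locus_def)
  qed
  have VW: "V \<subseteq> ?W" and oV: "openin (htop) V"
    unfolding V pts_locus[OF uv b]
    using openin_Int[OF hilb_open_basic[OF inj_mvv disc_in_ring] hilb_open_chart[OF b]] by auto
  have oW: "openin (htop) ?W" by (rule hilb_open_chart[OF b])
  \<comment> \<open>This invariant fraction serves only to descend \<open>f\<close> along
    \<open>orbit\<close>. The fraction with numerator \<open>F\<close>, whose numerator and
    denominator need not be separately invariant, is the one to which the splitting is
    applied.\<close>
  obtain Q K where Q: "Q \<in> range eval" "sym_inv Q"
    "\<And>q. ptdet b q \<noteq> 0 \<Longrightarrow> f (pts_ideal q) = Q q / (ptdet b q * ptdet b q) ^ K"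
    using chart_ring_pts[OF b f] by blast
  define G where "G q = (ptdet b q * ptdet b q) ^ K" for q :: "3 \<times> coord \<Rightarrow> 'k"
  have G: "G \<in> range eval" "sym_inv G"
    unfolding G_def[abs_def] by (intro eval_intros ptdet_eval) (intro sym_inv_power sym_inv_ptdet2)
  define f' where "f' = cut U (\<lambda>M. desc Q M / desc G M)"
  have f'_orb: "f' (orbit q) = f (pts_ideal q)" if "q \<in> good v b" for q
    using that Q(3)[of q] orbU[of q]
    by (simp add: f'_def desc_orbit[OF Q(2)] desc_orbit[OF G(2)] good_def G_def)
  have "desc G M \<noteq> 0" if "M \<in> U" for M
    using Ugood[OF that] by (auto simp: desc_orbit[OF G(2)] good_def G_def)
  then have f'_reg: "f' \<in> regular ?sym U"
    unfolding f'_def by (intro regular_frac[OF atlas U(2) descA(1)[OF Q(2,1)] descA(1)[OF G(2,1)]])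
  have "\<phi> V (cut V (f' \<circ> cycle)) = cut V (\<sigma> U f' \<circ> cycle)"
    using ind U(1) count f'_reg unfolding induced_splitting_def agrees_on_distinct_locus_def
    by (simp add: V_def Let_def)
  also have "cut V (f' \<circ> cycle) = cut V (cut ?W f)"
    unfolding cut_cut[OF VW] by (rule cut_cong) (auto simp: V cyc f'_orb)
  also have "\<phi> V (cut V (cut ?W f)) = cut V (\<phi> ?W (cut ?W f))"
    using split_restrict[OF phi_split oW oV VW regular_alg[OF hilb_chart_alg[OF b] order_refl f[unfolded chart_ring_alg]]] .
  finally have "cut V (\<phi> ?W (cut ?W f)) (pts_ideal q) = cut V (\<sigma> U f' \<circ> cycle) (pts_ideal q)"
    by (rule fun_cong)
  moreover have "pts_ideal q \<in> V" using q V by blast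
  ultimately have "\<phi> ?W (cut ?W f) (pts_ideal q) = (\<sigma> U f' \<circ> orbit) q"
    using cyc[OF q] by simp
  also have "\<sigma> U f' \<circ> orbit = \<psi> (orbit -` U) (f' \<circ> orbit)"
    using quot U(1) f'_reg unfolding quotient_splitting_def by blast
  also have orb: "orbit -` U = good v b" using orbU by auto
  also have "f' \<circ> orbit = cut (good v b) (\<lambda>q. F q / ptdet b q ^ (CHAR('k) * N))"
  proof
    fix q show "(f' \<circ> orbit) q = cut (good v b) (\<lambda>q. F q / ptdet b q ^ (CHAR('k) * N)) q"
      using f'_orb[of q] fF[of q] orbU[of q] by (cases "q \<in> good v b") (auto simp: f'_def)
  qed
  also have "\<psi> (good v b) (cut (good v b) (\<lambda>q. F q / ptdet b q ^ (CHAR('k) * N))) =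
     cut (good v b) (\<lambda>q. \<psi> UNIV (cut UNIV F) q / ptdet b q ^ N)"
  proof (rule split_frac[OF psi_split affine_atlas])
    have "good v b = {q \<in> UNIV. \<delta> q \<noteq> 0}" using good by auto
    then show "openin (zariski affine_space) (good v b :: (3 \<times> coord \<Rightarrow> 'k) set)"
      using zariski_basic_open[OF affine_atlas, of \<delta>] \<delta>(2) by (simp add: range_eval_alg)
  qed (use F ptdet_eval[of b] in \<open>auto simp: good_def range_eval_alg\<close>)
  finally show ?thesis using q by simp
qed

text \<open>Near \<open>\<gamma> 0\<close> the regular function is g/h with both terms polynomial
  along \<open>\<gamma>\<close>. The polynomial g - H h vanishes for all but finitely many
  \<open>t\<close>, hence also at 0.\<close>

lemma curve_value:
  fixes b :: "3 \<Rightarrow> coord expo"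
  assumes b: "inj b" and \<Phi>: "\<Phi> \<in> regular (hilb_scheme 3) (hchart b)"
    and \<gamma>: "\<And>t. \<gamma> t \<in> hchart b" "\<And>x. polyfun (\<lambda>t :: 'k. hcoeff b (\<gamma> t) x)"
    and H: "polyfun H" "\<And>t. t \<noteq> 0 \<Longrightarrow> \<Phi> (\<gamma> t) = H t"
  shows "\<Phi> (\<gamma> 0) = H 0"
proof -
  obtain g h where gh: "g \<in> hring b" "h \<in> hring b" "h (\<gamma> 0) \<noteq> 0"
    "\<And>I. I \<in> hchart b \<Longrightarrow> h I \<noteq> 0 \<Longrightarrow> \<Phi> I = g I / h I"
    using hilb_regular_local[OF \<Phi> \<gamma>(1) b \<gamma>(1)] by metis
  have pf: "polyfun (\<lambda>t. k (\<gamma> t))" if "k \<in> hring b" for k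
    using that unfolding chart_ring_alg by (rule polyfun_alg) (use \<gamma>(2) in auto)
  have "g (\<gamma> 0) - H 0 * h (\<gamma> 0) = 0"
  proof (rule polyfun_eq_0[where f = "\<lambda>t. g (\<gamma> t) - H t * h (\<gamma> t)" and g = "\<lambda>t. h (\<gamma> t)" and s = 0 and E = "{0}" and t = 0])
    show "polyfun (\<lambda>t. g (\<gamma> t) - H t * h (\<gamma> t))" by (intro polyfun_intros pf gh H)
    fix t assume t: "t \<notin> {0 :: 'k}" "h (\<gamma> t) \<noteq> 0"
    then show "g (\<gamma> t) - H t * h (\<gamma> t) = 0" using gh(4)[OF \<gamma>(1) t(2)] H(2)[of t] by simp
  qed (use gh pf in auto)
  then show ?thesis using gh(4)[OF \<gamma>(1) gh(3)] gh(3) by (simp add: field_simps)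
qed

text \<open>The weight of the denominator \<open>ptdet b\<close> is discounted, so \<open>n\<close> is the weight of \<open>f\<close> itself.\<close>

definition homog :: "(3 \<Rightarrow> coord expo) \<Rightarrow> coord \<Rightarrow> (coord \<Rightarrow> nat) \<Rightarrow> nat \<Rightarrow> ((coord, 'k) mpol set \<Rightarrow> 'k) \<Rightarrow> bool" where
  "homog b v \<omega> n f \<longleftrightarrow> (\<exists>F N. F \<in> Hom (\<omega> \<circ> snd) (n + (\<Sum>j\<in>UNIV. wt \<omega> (b j)) * (CHAR('k) * N)) \<and>
     (\<forall>q\<in>good v b. f (pts_ideal q) = F q / ptdet b q ^ (CHAR('k) * N)))"

lemma homog_mult:
  assumes "homog b v \<omega> n f" "homog b v \<omega> m g"
  shows "homog b v \<omega> (n + m) (\<lambda>I. f I * g I)"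
proof -
  let ?S = "\<Sum>j\<in>UNIV. wt \<omega> (b j)" and ?p = "CHAR('k)"
  obtain F M where F: "F \<in> Hom (\<omega> \<circ> snd) (n + ?S * (?p * M))"
    "\<forall>q\<in>good v b. f (pts_ideal q) = F q / ptdet b q ^ (?p * M)" using assms(1) by (auto simp: homog_def)
  obtain G N where G: "G \<in> Hom (\<omega> \<circ> snd) (m + ?S * (?p * N))"
    "\<forall>q\<in>good v b. g (pts_ideal q) = G q / ptdet b q ^ (?p * N)" using assms(2) by (auto simp: homog_def)
  have "(n + ?S * (?p * M)) + (m + ?S * (?p * N)) = n + m + ?S * (?p * (M + N))"
    by (simp add: algebra_simps)
  with Hom_mult[OF F(1) G(1)] have "(\<lambda>q. F q * G q) \<in> Hom (\<omega> \<circ> snd) (n + m + ?S * (?p * (M + N)))"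
    by metis
  moreover have "\<forall>q\<in>good v b. f (pts_ideal q) * g (pts_ideal q) = F q * G q / ptdet b q ^ (?p * (M + N))"
    using F(2) G(2) by (simp add: distrib_left power_add)
  ultimately show ?thesis unfolding homog_def by blast
qed

lemma homog_const: "homog b v \<omega> 0 (\<lambda>_. c)"
  unfolding homog_def by (intro exI[of _ "\<lambda>_. c"] exI[of _ 0]) (simp add: Hom_const)

lemma homog_power: "homog b v \<omega> n f \<Longrightarrow> homog b v \<omega> (n * l) (\<lambda>I. f I ^ l)"
proof (induction l)
  case 0
  show ?case using homog_const[of b v \<omega> 1] by simp
next
  case (Suc l)
  then show ?case using homog_mult[of b v \<omega> n f "n * l" "\<lambda>I. f I ^ l"] by simp
qed

lemma homog_prod: "(\<And>i. i \<in> S \<Longrightarrow> homog b v \<omega> (n i) (f i)) \<Longrightarrow>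
    homog b v \<omega> (\<Sum>i\<in>S. n i) (\<lambda>I. \<Prod>i\<in>S. f i I)"
proof (induction S rule: infinite_finite_induct)
  case (insert x S)
  then show ?case using homog_mult[of b v \<omega> "n x" "f x"] by simp
qed (simp_all add: homog_const)

text \<open>The coordinate is a quotient of two alternants whose weights differ by
  \<open>wt \<omega> m - wt \<omega> (b k)\<close>; expanding by
  \<open>ptdet b ^ (CHAR('k) - 1)\<close> makes the denominator a p-th power. The assumption on
  weights keeps the natural subtraction exact.\<close>

lemma homog_coeff:
  assumes b: "inj b" and le: "wt \<omega> (b k) \<le> wt \<omega> m"
  shows "homog b v \<omega> (wt \<omega> m - wt \<omega> (b k)) (\<lambda>I. hcoeff b I (m, b k))"
proof -
  let ?S = "\<Sum>j\<in>UNIV. wt \<omega> (b j)" and ?p = "CHAR('k)"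
  have "(\<Sum>j\<in>UNIV. wt \<omega> ((b(k := m)) j)) = wt \<omega> m + (\<Sum>j\<in>UNIV - {k}. wt \<omega> (b j))"
    by (subst sum.remove[of _ k]) auto
  moreover have "?S = wt \<omega> (b k) + (\<Sum>j\<in>UNIV - {k}. wt \<omega> (b j))"
    by (subst sum.remove[of _ k]) auto
  ultimately have S: "(\<Sum>j\<in>UNIV. wt \<omega> ((b(k := m)) j)) = wt \<omega> m - wt \<omega> (b k) + ?S" using le by simp
  have p: "?p = Suc (?p - 1)" using p_gt by simp
  have "(\<lambda>q. ptdet (b(k := m)) q * ptdet b q ^ (?p - 1)) \<in>
     Hom (\<omega> \<circ> snd) (wt \<omega> m - wt \<omega> (b k) + ?S + ?S * (?p - 1))"
    unfolding S[symmetric] by (intro Hom_mult Hom_power Hom_ptdet)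
  also have "wt \<omega> m - wt \<omega> (b k) + ?S + ?S * (?p - 1) = wt \<omega> m - wt \<omega> (b k) + ?S * (?p * 1)"
    by (subst (2) p) (simp add: algebra_simps)
  finally have 1: "(\<lambda>q. ptdet (b(k := m)) q * ptdet b q ^ (?p - 1)) \<in>
     Hom (\<omega> \<circ> snd) (wt \<omega> m - wt \<omega> (b k) + ?S * (?p * 1))" .
  have 2: "\<forall>q\<in>(good v b :: (3 \<times> coord \<Rightarrow> 'k) set). hcoeff b (pts_ideal q) (m, b k) =
     ptdet (b(k := m)) q * ptdet b q ^ (?p - 1) / ptdet b q ^ (?p * 1)"
  proof
    fix q :: "3 \<times> coord \<Rightarrow> 'k" assume "q \<in> good v b"
    then have d: "ptdet b q \<noteq> 0" by (simp add: good_def)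
    have "ptdet b q ^ ?p = ptdet b q * ptdet b q ^ (?p - 1)" by (subst p) simp
    then show "hcoeff b (pts_ideal q) (m, b k) =
      ptdet (b(k := m)) q * ptdet b q ^ (?p - 1) / ptdet b q ^ (?p * 1)"
      using pts_coeff[OF b d, of m k] d by simp
  qed
  from 1 2 show ?thesis unfolding homog_def by blast
qed

lemma phi_kills:
  assumes "u \<noteq> v" "inj b" "f \<in> hring b" "homog b v \<omega> n f" "\<not> CHAR('k) dvd n" "q \<in> good v b"
  shows "\<phi> (hchart b) (cut (hchart b) f) (pts_ideal q) = 0"
proof -
  obtain F N where F: "F \<in> Hom (\<omega> \<circ> snd) (n + (\<Sum>j\<in>UNIV. wt \<omega> (b j)) * (CHAR('k) * N))"
    "\<And>q. q \<in> good v b \<Longrightarrow> f (pts_ideal q) = F q / ptdet b q ^ (CHAR('k) * N)"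
    using assms(4) unfolding homog_def by blast
  have "\<not> CHAR('k) dvd (n + (\<Sum>j\<in>UNIV. wt \<omega> (b j)) * (CHAR('k) * N))"
    using assms(5) by (simp add: dvd_add_left_iff)
  then have "T F = (\<lambda>_. 0)" by (rule T_kills[OF F(1)])
  then show ?thesis using phi_pts[OF assms(1-3) Hom_eval[OF F(1)] F(2) assms(6)] by simp
qed

definition scale_pts :: "(coord \<Rightarrow> nat) \<Rightarrow> 'k \<Rightarrow> (3 \<times> coord \<Rightarrow> 'k) \<Rightarrow> 3 \<times> coord \<Rightarrow> 'k" where
  "scale_pts \<omega> t q = (\<lambda>x. t ^ (\<omega> \<circ> snd) x * q x)"

lemma ptdet_scale: "ptdet b (scale_pts \<omega> t q) = t ^ (\<Sum>j\<in>UNIV. wt \<omega> (b j)) * ptdet b q"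
  unfolding scale_pts_def by (rule Hom_scale_arg[OF Hom_ptdet])

lemma good_scale: "t \<noteq> 0 \<Longrightarrow> q \<in> good v b \<Longrightarrow> scale_pts \<omega> t q \<in> good v b"
  by (simp add: good_def ptdet_scale)

lemma homog_scale:
  assumes "homog b v \<omega> n f" "q \<in> good v b" "t \<noteq> 0"
  shows "f (pts_ideal (scale_pts \<omega> t q)) = t ^ n * f (pts_ideal q)"
proof -
  obtain F N where F: "F \<in> Hom (\<omega> \<circ> snd) (n + (\<Sum>j\<in>UNIV. wt \<omega> (b j)) * (CHAR('k) * N))"
    "\<And>q. q \<in> good v b \<Longrightarrow> f (pts_ideal q) = F q / ptdet b q ^ (CHAR('k) * N)"
    using assms(1) unfolding homog_def by blast
  show ?thesis
    unfolding F(2)[OF assms(2)] F(2)[OF good_scale[OF assms(3,2)]] ptdet_scale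
    unfolding scale_pts_def Hom_scale_arg[OF F(1)]
    using assms(3) by (simp add: power_add power_mult power_mult_distrib)
qed

lemma phi_scale:
  assumes "u \<noteq> v" "inj b" "f \<in> hring b" "homog b v \<omega> n f" "q \<in> good v b" "t \<noteq> 0"
  defines "\<Phi> \<equiv> \<phi> (hchart b) (cut (hchart b) f)"
  shows "\<Phi> (pts_ideal (scale_pts \<omega> (t ^ CHAR('k)) q)) = t ^ n * \<Phi> (pts_ideal q)"
proof -
  let ?p = "CHAR('k)" and ?S = "\<Sum>j\<in>UNIV. wt \<omega> (b j)"
  obtain F N where F: "F \<in> Hom (\<omega> \<circ> snd) (n + ?S * (?p * N))"
    "\<And>q. q \<in> good v b \<Longrightarrow> f (pts_ideal q) = F q / ptdet b q ^ (?p * N)"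
    using assms(4) unfolding homog_def by blast
  have q': "scale_pts \<omega> (t ^ ?p) q \<in> good v b" using good_scale[OF _ assms(5)] assms(6) by simp
  have "T F (scale_pts \<omega> (t ^ ?p) q) = t ^ (n + ?S * (?p * N)) * T F q"
    unfolding scale_pts_def by (rule standard_equivariant[OF std p_gt(3) F(1)])
  moreover have "ptdet b (scale_pts \<omega> (t ^ ?p) q) ^ N = t ^ (?S * (?p * N)) * ptdet b q ^ N"
    unfolding ptdet_scale by (simp add: power_mult_distrib power_mult[symmetric] mult_ac)
  ultimately show ?thesis
    unfolding \<Phi>_def using phi_pts[OF assms(1-3) Hom_eval[OF F(1)] F(2)] assms(5,6) q'
    by (simp add: power_add)
qed

text \<open>Suppose that a one-parameter torus contracts the chart onto \<open>Z\<close> (via \<open>\<pi>\<close>), so that all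
  weights of coordinate functions are nonnegative. The splitting divides weights by \<open>p\<close>; hence it
  maps the ideal of \<open>Z\<close>, which is spanned by functions of positive weight, into itself. This is
  tested at \<open>J\<close> along the orbit of a triple of distinct points degenerating to \<open>J\<close>.\<close>

lemma contracted_vanish:
  fixes b :: "3 \<Rightarrow> coord expo"
  assumes uv: "u \<noteq> v" and b: "inj b"
  defines "W \<equiv> hchart b :: (coord, 'k) mpol set set"
    and "\<xi> \<equiv> \<lambda>I. hcoeff b I"
  assumes H1': "\<And>m k. m \<notin> range b \<Longrightarrow> (wt \<omega> (b k) = wt \<omega> m \<and> (\<forall>I\<in>W. \<xi> (\<pi> I) (m, b k) = \<xi> I (m, b k))) \<or>
      (wt \<omega> (b k) < wt \<omega> m \<and> (\<forall>I\<in>Z \<inter> W. \<xi> I (m, b k) = 0))"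
    and H2: "\<And>I. I \<in> W \<Longrightarrow> \<pi> I \<in> Z \<inter> W"
    and q: "q \<in> good v b" "\<pi> (pts_ideal q) = J"
    and g: "g \<in> hring b" "\<And>I. I \<in> Z \<Longrightarrow> I \<in> W \<Longrightarrow> g I = 0"
  shows "\<phi> W (cut W g) J = 0"
proof -
  \<comment> \<open>Coordinates that vanish on the whole chart, such as those of two different basis
    monomials, are set aside: for them the truncated difference \<open>d\<close> need not be a
    weight.\<close>
  define null where "null x \<longleftrightarrow> (\<forall>I\<in>W. \<xi> I x = 0)" for x
  define d where "d x = wt \<omega> (fst x) - wt \<omega> (snd x)" for x :: "coord expo \<times> coord expo"
  have H1: "(\<forall>I\<in>W. \<xi> I (m, b k) = 0) \<or> (wt \<omega> (b k) = wt \<omega> m \<and> (\<forall>I\<in>W. \<xi> (\<pi> I) (m, b k) = \<xi> I (m, b k))) \<or>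
      (wt \<omega> (b k) < wt \<omega> m \<and> (\<forall>I\<in>Z \<inter> W. \<xi> I (m, b k) = 0))" for m k
  proof (cases "m \<in> range b")
    case True
    then obtain i where i: "m = b i" by blast
    have "\<xi> I (b i, b k) = (if i = k then 1 else 0)" if "I \<in> W" for I
      using that by (simp add: chart_coeff_self[OF b] \<xi>_def W_def)
    then show ?thesis using H2 by (cases "i = k") (auto simp: i)
  next
    case False
    from H1'[OF this] show ?thesis by blast
  qed
  have W_pts: "pts_ideal q \<in> W" if "q \<in> good v b" for q
    using that pts_chart[OF b, of q] by (simp add: W_def good_def)
  have J: "J \<in> Z \<inter> W" using H2[OF W_pts[OF q(1)]] q(2) by simp
  have nn: "\<exists>k. snd x = b k \<and> wt \<omega> (b k) \<le> wt \<omega> (fst x) \<and>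
      (d x = 0 \<longrightarrow> (\<forall>I\<in>W. \<xi> (\<pi> I) x = \<xi> I x)) \<and> (d x > 0 \<longrightarrow> (\<forall>I\<in>Z \<inter> W. \<xi> I x = 0))"
    if x: "\<not> null x" for x
  proof (cases x)
    case (Pair m n)
    have "n \<in> range b" using x chart_coeff_outside[of _ "range b" n m] Pair
      unfolding null_def W_def \<xi>_def by blast
    then obtain k where k: "n = b k" by blast
    from H1[of m k] x show ?thesis
      unfolding null_def d_def Pair k by (intro exI[of _ k]) auto
  qed
  \<comment> \<open>The torus orbit of the triple, completed at \<open>t = 0\<close> by its limit
    \<open>J\<close>: coordinates of weight 0 agree with those of \<open>J\<close>, and those of
    positive weight tend to 0.\<close>
  define \<gamma> where "\<gamma> t = (if t = 0 then J else pts_ideal (scale_pts \<omega> t q))" for t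
  have \<gamma>W: "\<gamma> t \<in> W" for t using J W_pts[OF good_scale[OF _ q(1)]] by (simp add: \<gamma>_def)
  have \<gamma>\<xi>: "\<xi> (\<gamma> t) x = (if null x then 0 else t ^ d x * \<xi> (pts_ideal q) x)" for t x
  proof (cases "null x")
    case True
    then show ?thesis using \<gamma>W by (simp add: null_def)
  next
    case False
    obtain k where k: "snd x = b k" "wt \<omega> (b k) \<le> wt \<omega> (fst x)"
      "d x = 0 \<Longrightarrow> \<forall>I\<in>W. \<xi> (\<pi> I) x = \<xi> I x" "d x > 0 \<Longrightarrow> \<forall>I\<in>Z \<inter> W. \<xi> I x = 0"
      using nn[OF False] by auto
    show ?thesis
    proof (cases "t = 0")
      case True
      show ?thesis
      proof (cases "d x = 0")
        case True
        then show ?thesis using k(3) False W_pts[OF q(1)] q(2) \<open>t = 0\<close> by (auto simp: \<gamma>_def)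
      next
        case False
        then show ?thesis using k(4) J \<open>t = 0\<close> by (simp add: \<gamma>_def)
      qed
    next
      case t: False
      have x: "(fst x, b k) = x" using k(1) by (metis prod.collapse)
      show ?thesis
        using homog_scale[OF homog_coeff[OF b k(2), of v] q(1) t] False t
        unfolding x by (simp add: \<gamma>_def \<xi>_def d_def k(1))
    qed
  qed
  have pos: "\<phi> W (cut W f) J = 0"
    if f: "f \<in> hring b" "homog b v \<omega> n f" "n > 0" for f n
  proof -
    let ?\<Phi> = "\<phi> W (cut W f)"
    have reg: "?\<Phi> \<in> regular (hilb_scheme 3) W" unfolding W_def
      by (intro split_regular[OF phi_split hilb_open_chart[OF b]] regular_alg[OF hilb_chart_alg[OF b] order_refl])
        (use f(1) in \<open>simp add: chart_ring_alg\<close>)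
    \<comment> \<open>The identity of \<open>phi_scale\<close> for nonzero \<open>t\<close> extends
      to \<open>t = 0\<close>, where the positive weight \<open>n\<close> makes the right-hand side
      0.\<close>
    have "?\<Phi> (\<gamma> (0 ^ CHAR('k))) = 0 ^ n * ?\<Phi> (pts_ideal q)"
    proof (rule curve_value[OF b reg[unfolded W_def], of "\<lambda>t. \<gamma> (t ^ CHAR('k))", folded W_def])
      show "\<gamma> (t ^ CHAR('k)) \<in> W" for t by (rule \<gamma>W)
      show "polyfun (\<lambda>t. hcoeff b (\<gamma> (t ^ CHAR('k))) x)" for x
        using \<gamma>\<xi>[unfolded \<xi>_def] by (cases "null x") (auto intro!: polyfun_intros)
      show "polyfun (\<lambda>t. t ^ n * ?\<Phi> (pts_ideal q))" by (intro polyfun_intros)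
      fix t :: 'k assume t: "t \<noteq> 0"
      show "?\<Phi> (\<gamma> (t ^ CHAR('k))) = t ^ n * ?\<Phi> (pts_ideal q)"
        using phi_scale[OF uv b f(1,2) q(1) t] t by (simp add: \<gamma>_def W_def)
    qed
    then show ?thesis using p_gt f(3) by (simp add: \<gamma>_def zero_power)
  qed
  obtain P where P: "g = (\<lambda>I. eval P (\<xi> I))" using g(1) by (auto simp: chart_ring_def \<xi>_def)
  define trm where "trm \<mu> I = lookup P \<mu> * mval (\<xi> I) \<mu>" for \<mu> I
  define w where "w \<mu> = (\<Sum>x\<in>keys \<mu>. d x * lookup \<mu> x)" for \<mu> :: "(coord expo \<times> coord expo) expo"
  define nul where "nul \<mu> \<longleftrightarrow> (\<exists>x\<in>keys \<mu>. null x)" for \<mu> :: "(coord expo \<times> coord expo) expo"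
  have gsum: "g I = (\<Sum>\<mu>\<in>keys P. trm \<mu> I)" for I
    unfolding P trm_def by (rule eval_superset) auto
  have trm_ring: "trm \<mu> \<in> hring b" for \<mu>
    unfolding trm_def[abs_def] mval_def \<xi>_def by (intro chart_ring_intros)
  have t_nul: "trm \<mu> I = 0" if nu: "nul \<mu>" "I \<in> W" for \<mu> I
  proof -
    obtain x where x: "x \<in> keys \<mu>" "\<xi> I x = 0" using nu unfolding nul_def null_def by blast
    then have "lookup \<mu> x \<noteq> 0" by (simp add: in_keys_iff)
    then have "mval (\<xi> I) \<mu> = 0"
      unfolding mval_def using x by (intro prod_zero) (auto intro!: bexI[of _ x] simp: zero_power)
    then show ?thesis by (simp add: trm_def)
  qed
  have t_pos: "trm \<mu> I = 0" if nu: "\<not> nul \<mu>" "w \<mu> > 0" "I \<in> Z \<inter> W" for \<mu> I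
  proof -
    obtain x where x: "x \<in> keys \<mu>" "d x > 0"
      using nu(2) unfolding w_def by (metis (no_types, lifting) gr0I mult_0 sum.neutral not_less_zero)
    then have "\<xi> I x = 0" using nn[of x] nu(1,3) by (auto simp: nul_def)
    moreover have "lookup \<mu> x \<noteq> 0" using x(1) by (simp add: in_keys_iff)
    ultimately have "mval (\<xi> I) \<mu> = 0"
      unfolding mval_def using x(1) by (intro prod_zero) (auto intro!: bexI[of _ x] simp: zero_power)
    then show ?thesis by (simp add: trm_def)
  qed
  have t_zero: "trm \<mu> (\<pi> I) = trm \<mu> I" if "\<not> nul \<mu>" "w \<mu> = 0" "I \<in> W" for \<mu> I
  proof -
    have "\<xi> (\<pi> I) x = \<xi> I x" if x: "x \<in> keys \<mu>" for x
    proof -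
      have "lookup \<mu> x \<noteq> 0" using x by (simp add: in_keys_iff)
      moreover have "d x * lookup \<mu> x = 0" using \<open>w \<mu> = 0\<close> x unfolding w_def by simp
      ultimately have "d x = 0" by simp
      then show ?thesis using nn[of x] \<open>\<not> nul \<mu>\<close> x \<open>I \<in> W\<close> by (auto simp: nul_def)
    qed
    then show ?thesis unfolding trm_def mval_def by simp
  qed
  \<comment> \<open>Only terms of positive weight matter: the sum of the terms of weight 0 is
    unchanged by \<open>\<pi>\<close>, and at \<open>\<pi> I\<close>, a point of \<open>Z\<close>,
    it equals \<open>g (\<pi> I) = 0\<close> because all other terms vanish there.\<close>
  define S where "S = {\<mu> \<in> keys P. \<not> nul \<mu> \<and> w \<mu> > 0}"
  have g_S: "g I = (\<Sum>\<mu>\<in>S. trm \<mu> I)" if I: "I \<in> W" for I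
  proof -
    define S0 where "S0 = {\<mu> \<in> keys P. \<not> nul \<mu> \<and> w \<mu> = 0}"
    define S1 where "S1 = {\<mu> \<in> keys P. nul \<mu>}"
    have fin: "finite S" "finite S0" "finite S1" by (simp_all add: S_def S0_def S1_def)
    have split: "keys P = S1 \<union> (S0 \<union> S)" "S1 \<inter> (S0 \<union> S) = {}" "S0 \<inter> S = {}"
      by (auto simp: S_def S0_def S1_def)
    have gsp: "g I = (\<Sum>\<mu>\<in>S1. trm \<mu> I) + ((\<Sum>\<mu>\<in>S0. trm \<mu> I) + (\<Sum>\<mu>\<in>S. trm \<mu> I))" for I
      unfolding gsum split(1) using fin split(2,3) by (simp add: sum.union_disjoint)
    have z1: "(\<Sum>\<mu>\<in>S1. trm \<mu> I) = 0" if "I \<in> W" for I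
      by (rule sum.neutral) (use t_nul that in \<open>auto simp: S1_def\<close>)
    have \<pi>I: "\<pi> I \<in> Z \<inter> W" by (rule H2[OF I])
    have "(\<Sum>\<mu>\<in>S. trm \<mu> (\<pi> I)) = 0"
      by (rule sum.neutral) (use t_pos \<pi>I in \<open>auto simp: S_def\<close>)
    moreover have "(\<Sum>\<mu>\<in>S0. trm \<mu> (\<pi> I)) = (\<Sum>\<mu>\<in>S0. trm \<mu> I)"
      by (rule sum.cong) (use t_zero I in \<open>auto simp: S0_def\<close>)
    ultimately have "(\<Sum>\<mu>\<in>S0. trm \<mu> I) = 0"
      using gsp[of "\<pi> I"] g(2)[of "\<pi> I"] z1[of "\<pi> I"] \<pi>I by simp
    then show ?thesis using gsp[of I] z1[OF I] by simp
  qed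
  have reg: "cut W f \<in> regular (hilb_scheme 3) W" if "f \<in> hring b" for f
    unfolding W_def by (rule regular_alg[OF hilb_chart_alg[OF b] order_refl]) (use that in \<open>simp add: chart_ring_alg\<close>)
  have oW: "openin (htop) W" unfolding W_def by (rule hilb_open_chart[OF b])
  have "\<phi> W (cut W (\<lambda>I. \<Sum>\<mu>\<in>R. trm \<mu> I)) J = 0" if "R \<subseteq> S" for R
  proof -
    have "finite R" using that finite_subset[of R S] by (simp add: S_def)
    then show ?thesis using that
    proof induction
      case empty
      have "(\<lambda>_. 0) \<in> regular (hilb_scheme 3) W" using reg[of "\<lambda>_. 0"] by (simp add: cut_def chart_ring_intros)
      from split_pow[OF phi_split oW this] show ?case using p_gt by (simp add: cut_def zero_power fun_eq_iff)
    next
      case (insert \<mu> R)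
      have "cut W (\<lambda>I. \<Sum>\<mu>\<in>insert \<mu> R. trm \<mu> I) = (\<lambda>I. cut W (trm \<mu>) I + cut W (\<lambda>I. \<Sum>\<mu>\<in>R. trm \<mu> I) I)"
        using insert.hyps by (auto simp: cut_def)
      moreover have "(\<lambda>I. \<Sum>\<mu>\<in>R. trm \<mu> I) \<in> hring b" by (intro chart_ring_intros trm_ring)
      ultimately have "\<phi> W (cut W (\<lambda>I. \<Sum>\<mu>\<in>insert \<mu> R. trm \<mu> I)) J = \<phi> W (cut W (trm \<mu>)) J"
        using split_add[OF phi_split oW reg[OF trm_ring[of \<mu>]] reg] insert by simp
      also have "\<dots> = 0"
      proof (rule pos[OF trm_ring])
        have \<mu>: "\<not> nul \<mu>" "w \<mu> > 0" using insert.prems by (auto simp: S_def)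
        show "w \<mu> > 0" by fact
        have "homog b v \<omega> (d x * lookup \<mu> x) (\<lambda>I. \<xi> I x ^ lookup \<mu> x)" if x: "x \<in> keys \<mu>" for x
        proof -
          obtain k where k: "snd x = b k" "wt \<omega> (b k) \<le> wt \<omega> (fst x)" using nn[of x] \<mu>(1) x by (auto simp: nul_def)
          have "x = (fst x, b k)" using k(1) by (metis prod.collapse)
          then show ?thesis
            using homog_power[OF homog_coeff[OF b k(2), of v], of "lookup \<mu> x"] k(1) by (simp add: \<xi>_def d_def)
        qed
        then have "homog b v \<omega> (w \<mu>) (\<lambda>I. \<Prod>x\<in>keys \<mu>. \<xi> I x ^ lookup \<mu> x)"
          unfolding w_def by (rule homog_prod)
        from homog_mult[OF homog_const[of b v \<omega> "lookup P \<mu>"] this]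
        show "homog b v \<omega> (w \<mu>) (trm \<mu>)" by (simp add: trm_def[abs_def] mval_def)
      qed
      finally show ?case .
    qed
  qed
  moreover have "cut W g = cut W (\<lambda>I. \<Sum>\<mu>\<in>S. trm \<mu> I)" by (rule cut_cong) (rule g_S)
  ultimately show ?thesis by simp
qed

end

subsection \<open>Coordinates on the chart of \<open>1, v, v\<^sup>2\<close>\<close>

lemma chart_coeff_eqI:
  fixes b :: "3 \<Rightarrow> coord expo"
  assumes "inj b" "I \<in> hchart b" "f - lin (mon b) w \<in> I" "f = monom m"
  shows "hcoeff b I (m, b j) = w $ j"
  using chart_coeff_unique[OF assms(1,2)] assms(3,4) by blast

text \<open>Multiplication by v shifts the coefficients of the expansion by one place, and the v^3
  that appears is reduced again.\<close>

lemma mvv_coeff_v: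
  assumes I: "I \<in> hchart (mvv v)"
  defines "C \<equiv> hcoeff (mvv v) I"
  shows "C (sg v 1 + m, mvv v j) =
    trip 0 (C (m, 0)) (C (m, sg v (Suc 0))) j + C (m, sg v 2) * C (sg v 3, mvv v j)"
proof -
  define w where "w = (\<chi> j. C (m, mvv v j))"
  define c where "c = (\<chi> j. C (sg v 3, mvv v j))"
  have 1: "monom m - lin (mon (mvv v)) w \<in> I"
    using chart_coeff_mem[OF inj_mvv I, of m] unfolding w_def C_def .
  have 2: "Var v ^ 3 - lin (mon (mvv v)) c \<in> I"
    using chart_coeff_mem[OF inj_mvv I, of "sg v 3"] unfolding c_def C_def monom_sg .
  have "Var v * (monom m - lin (mon (mvv v)) w) + Const (w $ 3) * (Var v ^ 3 - lin (mon (mvv v)) c) \<in> I"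
    by (intro ideal_add ideal_mult chart_ideal[OF I] 1 2)
  also have "Var v * (monom m - lin (mon (mvv v)) w) + Const (w $ 3) * (Var v ^ 3 - lin (mon (mvv v)) c) =
     Var v * monom m - lin (mon (mvv v)) ((\<chi> i. trip 0 (w $ 1) (w $ 2) i) + w $ 3 *s c)"
    by (simp add: lin_add lin_scale lin_trip monom_sg Const_add Const_mult algebra_simps power2_eq_square power3_eq_cube)
  finally have "C (sg v 1 + m, mvv v j) = ((\<chi> i. trip 0 (w $ 1) (w $ 2) i) + w $ 3 *s c) $ j"
    unfolding C_def by (intro chart_coeff_eqI[OF inj_mvv I]) (simp_all add: monom_add monom_sg)
  then show ?thesis by (simp add: w_def c_def)
qed

text \<open>Here the expansion u = a + b v + c v^2 is multiplied by the monomial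
  \<open>m\<close>.\<close>

lemma mvv_coeff_u:
  assumes I: "I \<in> hchart (mvv v)"
  defines "C \<equiv> hcoeff (mvv v) I"
  shows "C (sg u 1 + m, mvv v j) = C (sg u 1, 0) * C (m, mvv v j) +
    C (sg u 1, sg v (Suc 0)) * C (sg v 1 + m, mvv v j) +
    C (sg u 1, sg v 2) * C (sg v 1 + (sg v 1 + m), mvv v j)"
proof -
  define a where "a = (\<chi> j. C (sg u 1, mvv v j))"
  define w where "w m = (\<chi> j. C (m, mvv v j))" for m
  have 1: "monom m - lin (mon (mvv v)) (w m) \<in> I" for m
    using chart_coeff_mem[OF inj_mvv I, of m] unfolding w_def C_def .
  have 2: "Var u - lin (mon (mvv v)) a \<in> I"
    using chart_coeff_mem[OF inj_mvv I, of "sg u 1"] unfolding a_def C_def by (simp add: monom_sg)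
  have "monom m * (Var u - lin (mon (mvv v)) a) + (Const (a $ 1) * (monom m - lin (mon (mvv v)) (w m))
     + (Const (a $ 2) * (monom (sg v 1 + m) - lin (mon (mvv v)) (w (sg v 1 + m)))
     + Const (a $ 3) * (monom (sg v 1 + (sg v 1 + m)) - lin (mon (mvv v)) (w (sg v 1 + (sg v 1 + m)))))) \<in> I"
    (is "?E \<in> I") by (intro ideal_add ideal_mult chart_ideal[OF I] 1 2)
  also have "?E = Var u * monom m - lin (mon (mvv v)) (a $ 1 *s w m + a $ 2 *s w (sg v 1 + m)
     + a $ 3 *s w (sg v 1 + (sg v 1 + m)))"
    by (simp add: lin_add lin_scale lin_trip[of _ _ _ a] monom_add monom_sg algebra_simps power2_eq_square)
  finally have "C (sg u 1 + m, mvv v j) = (a $ 1 *s w m + a $ 2 *s w (sg v 1 + m)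
     + a $ 3 *s w (sg v 1 + (sg v 1 + m))) $ j"
    unfolding C_def by (intro chart_coeff_eqI[OF inj_mvv I]) (simp_all add: monom_add monom_sg)
  then show ?thesis by (simp add: w_def a_def)
qed

lemma expo_eq: "u \<noteq> v \<Longrightarrow> m = sg u (lookup m u) + sg v (lookup m v)" for u v :: coord
proof (rule poly_mapping_eqI)
  fix c assume "u \<noteq> v"
  then show "lookup m c = lookup (sg u (lookup m u) + sg v (lookup m v)) c"
    using coord_cases[of u v c] by (auto simp: lookup_add lookup_single when_def)
qed

text \<open>By the two recursions every coordinate of the chart is a polynomial in the six
  coefficients of u and v^3, so a family has to be checked on these alone.\<close>

lemma mvv_coeff_polyfun:
  fixes u v :: coord and \<gamma> :: "'k::field \<Rightarrow> (coord, 'k) mpol set"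
  assumes uv: "u \<noteq> v" and \<gamma>: "\<And>t. \<gamma> t \<in> hchart (mvv v)"
    and a: "\<And>j. polyfun (\<lambda>t. hcoeff (mvv v) (\<gamma> t) (sg u 1, mvv v j))"
    and c: "\<And>j. polyfun (\<lambda>t. hcoeff (mvv v) (\<gamma> t) (sg v 3, mvv v j))"
  shows "polyfun (\<lambda>t. hcoeff (mvv v) (\<gamma> t) x)"
proof -
  let ?C = "\<lambda>t. hcoeff (mvv v) (\<gamma> t)"
  define P where "P m \<longleftrightarrow> (\<forall>j. polyfun (\<lambda>t. ?C t (m, mvv v j)))" for m
  have trip: "polyfun (\<lambda>t. trip 0 (f t) (g t) j)" if "polyfun f" "polyfun g" for f g :: "'k \<Rightarrow> 'k" and j
    using that exhaust_3[of j] by (auto intro: polyfun_const)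
  have Pv: "P (sg v 1 + m)" if "P m" for m
  proof -
    have P1: "polyfun (\<lambda>t. ?C t (m, 0))" "polyfun (\<lambda>t. ?C t (m, sg v (Suc 0)))" "polyfun (\<lambda>t. ?C t (m, sg v 2))"
      using that[unfolded P_def, rule_format, of 1] that[unfolded P_def, rule_format, of 2]
        that[unfolded P_def, rule_format, of 3] by simp_all
    show ?thesis unfolding P_def mvv_coeff_v[OF \<gamma>, where m = m] by (intro allI polyfun_intros trip P1 c)
  qed
  have Pu: "P (sg u 1 + m)" if "P m" for m
  proof -
    have a': "polyfun (\<lambda>t. ?C t (sg u 1, 0))" "polyfun (\<lambda>t. ?C t (sg u 1, sg v (Suc 0)))" "polyfun (\<lambda>t. ?C t (sg u 1, sg v 2))"
      using a[of 1] a[of 2] a[of 3] by simp_all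
    have Pm: "polyfun (\<lambda>t. ?C t (m, mvv v j))" "polyfun (\<lambda>t. ?C t (sg v 1 + m, mvv v j))"
      "polyfun (\<lambda>t. ?C t (sg v 1 + (sg v 1 + m), mvv v j))" for j
      using that Pv[OF that] Pv[OF Pv[OF that]] by (auto simp: P_def)
    show ?thesis unfolding P_def mvv_coeff_u[OF \<gamma>, where u = u and m = m] by (intro allI polyfun_intros a' Pm)
  qed
  have S: "sg w (Suc i) + m = sg w 1 + (sg w i + m)" for w i m
    by (simp add: add.assoc[symmetric] single_add[symmetric])
  have "P 0"
    unfolding P_def
  proof
    fix j
    have "?C t (mvv v 1, mvv v j) = (if 1 = j then 1 else 0)" for t
      by (rule chart_coeff_self[OF inj_mvv \<gamma>])
    then show "polyfun (\<lambda>t. ?C t (0, mvv v j))" by (simp add: polyfun_const)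
  qed
  have "P (sg v l)" for l
  proof (induction l)
    case (Suc l)
    have "sg v (Suc l) = sg v 1 + sg v l" using S[of v l 0] by simp
    with Pv[OF Suc] show ?case by simp
  qed (simp add: \<open>P 0\<close>)
  then have "P (sg u i + sg v l)" for i l
  proof (induction i)
    case (Suc i)
    from Pu[OF Suc(1)[OF Suc(2)]] show ?case unfolding S .
  qed simp
  then have Pm: "P m" for m using expo_eq[OF uv, of m] by metis
  obtain m n where x: "x = (m, n)" by (cases x)
  show ?thesis
  proof (cases "n \<in> range (mvv v)")
    case True
    then show ?thesis using Pm[of m] x by (auto simp: P_def)
  next
    case False
    then show ?thesis using chart_coeff_outside[OF \<gamma> False] x by (simp add: polyfun_const)
  qed
qed

text \<open>The coordinates of a chart thus determine the ideal; this separates points in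
  \<open>hilb_closed_point\<close>.\<close>

lemma chart_mem_iff:
  fixes b :: "3 \<Rightarrow> coord expo"
  assumes b: "inj b" and I: "I \<in> hchart b"
  shows "f \<in> I \<longleftrightarrow> (\<forall>j. (\<Sum>m\<in>keys f. lookup f m * hcoeff b I (m, b j)) = 0)"
proof -
  obtain \<kappa> where \<kappa>: "frame \<kappa> I" "\<And>m j. \<kappa> (monom m) $ j = hcoeff b I (m, b j)"
    using chart_frame[OF b I] by metis
  have z: "\<kappa> 0 = 0" using frame_diff[OF \<kappa>(1), of 0 0] by simp
  have s: "\<kappa> (sum g S) = (\<Sum>m\<in>S. \<kappa> (g m))" if "finite S" for g and S :: "coord expo set"
    using that by induction (simp_all add: z frame_add[OF \<kappa>(1)])
  have "\<kappa> f = \<kappa> (\<Sum>m\<in>keys f. Const (lookup f m) * monom m)"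
    unfolding single_eq_Const_monom[symmetric] using mpol_eq_sum[of f] by simp
  also have "\<dots> = (\<Sum>m\<in>keys f. lookup f m *s \<kappa> (monom m))"
    by (simp add: s frame_scale[OF \<kappa>(1)])
  finally have "\<kappa> f $ j = (\<Sum>m\<in>keys f. lookup f m * hcoeff b I (m, b j))" for j
    by (simp add: \<kappa>(2))
  then show ?thesis unfolding frame_mem[OF \<kappa>(1)] vec_eq_iff by simp
qed

text \<open>Each root of the cubic is the v-coordinate of a point in \<open>zeros I\<close>, so all
  three roots are 0. The u-coordinate of the point with v = 0 is the constant coefficient of
  u.\<close>

lemma punctual_mvv:
  fixes u v :: coord and I :: "(coord, 'k::alg_closed_field) mpol set"
  assumes I: "I \<in> hchart (mvv v)" and uv: "u \<noteq> v" and z: "zeros I \<subseteq> {\<lambda>_. 0}"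
  defines "C \<equiv> hcoeff (mvv v) I"
  shows "C (sg v 3, mvv v j) = 0" "C (sg u 1, 0) = 0"
proof -
  obtain r1 r2 r3 where r: "C (sg v 3, sg v 2) = r1 + r2 + r3"
      "C (sg v 3, sg v (Suc 0)) = - (r1 * r2 + r1 * r3 + r2 * r3)" "C (sg v 3, 0) = r1 * r2 * r3"
    by (rule cubic_roots)
  have root: "s = 0 \<and> C (sg u 1, 0) = 0"
    if "s ^ 3 = C (sg v 3, 0) + C (sg v 3, sg v (Suc 0)) * s + C (sg v 3, sg v 2) * s ^ 2" for s
  proof -
    have "(\<lambda>c. if c = v then s else C (sg u 1, 0) + C (sg u 1, sg v (Suc 0)) * s + C (sg u 1, sg v 2) * s ^ 2) = (\<lambda>_. 0)"
      using root_in_zeros[OF I uv that[unfolded C_def]] z unfolding C_def by blast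
    from fun_cong[OF this, of v] fun_cong[OF this, of u] show ?thesis using uv by auto
  qed
  have "r1 = 0 \<and> C (sg u 1, 0) = 0" "r2 = 0" "r3 = 0"
    using root[of r1] root[of r2] root[of r3] unfolding r
    by (simp_all add: algebra_simps power2_eq_square power3_eq_cube)
  then have "C (sg v 3, sg v 2) = 0" "C (sg v 3, sg v (Suc 0)) = 0" "C (sg v 3, 0) = 0" and u0: "C (sg u 1, 0) = 0"
    using r by auto
  then show "C (sg v 3, mvv v j) = 0" using exhaust_3[of j] by auto
  show "C (sg u 1, 0) = 0" by (rule u0)
qed

subsection \<open>The two curves\<close>

text \<open>For parameters not both 0 this is the ideal generated by v^3, uv, u^2 and \<alpha> v^2 -
  \<beta> u, see \<open>pcurve_eq_ideal_gen\<close>. Conditions on coefficients are used because the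
  frames of the quotient can be read off from them. The parameters (0, 1) give the ideal of u and
  v^3, and (1, 0) the square of the maximal ideal.\<close>

definition pcurve :: "coord \<Rightarrow> coord \<Rightarrow> 'k \<Rightarrow> 'k \<Rightarrow> (coord, 'k::field) mpol set" where
  "pcurve u v \<alpha> \<beta> = {f. lookup f 0 = 0 \<and> lookup f (sg v 1) = 0 \<and>
     \<alpha> * lookup f (sg u 1) + \<beta> * lookup f (sg v 2) = 0}"

definition Curve :: "coord \<Rightarrow> coord \<Rightarrow> (coord, 'k::field) mpol set set" where
  "Curve u v = {pcurve u v \<alpha> \<beta> | \<alpha> \<beta>. (\<alpha>, \<beta>) \<noteq> (0, 0)}"

lemma lookup_mult_Const [simp]:
  fixes P :: "('v, 'k::comm_ring_1) mpol"
  shows "lookup (P * Const c) m = c * lookup P m"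
  by (simp add: mult.commute[of P])

lemma lookup_Var_mult_0: "lookup k c = 0 \<Longrightarrow> lookup (Var c * f) k = 0"
  for f :: "('v, 'k::comm_ring_1) mpol"
proof (rule ccontr)
  assume k: "lookup k c = 0" and "lookup (Var c * f) k \<noteq> 0"
  then have "k \<in> keys (monom (Poly_Mapping.single c 1) * f)" by (simp add: in_keys_iff Var_def)
  then obtain m where "k = Poly_Mapping.single c 1 + m" unfolding keys_monom_mult by auto
  then show False using k by (simp add: lookup_add)
qed

lemma lookup_Var_mult: "lookup (Var c * f) (Poly_Mapping.single c 1 + m) = lookup f m"
  for f :: "('v, 'k::comm_ring_1) mpol"
  unfolding Var_def by (rule lookup_monom_mult)

text \<open>Multiplying an element by a variable makes all four coefficients in the definition
  vanish, since it has no constant term and no term in v.\<close>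

lemma pcurve_ideal:
  fixes u v :: coord
  assumes uv: "u \<noteq> v"
  shows "is_ideal (pcurve u v \<alpha> (\<beta> :: 'k::field))"
proof -
  let ?K = "pcurve u v \<alpha> \<beta>"
  have add: "f + g \<in> ?K" if "f \<in> ?K" "g \<in> ?K" for f g
  proof -
    have "\<alpha> * lookup (f + g) (sg u 1) + \<beta> * lookup (f + g) (sg v 2) =
       (\<alpha> * lookup f (sg u 1) + \<beta> * lookup f (sg v 2)) + (\<alpha> * lookup g (sg u 1) + \<beta> * lookup g (sg v 2))"
      by (simp add: lookup_add algebra_simps)
    then show ?thesis using that by (simp add: pcurve_def lookup_add)
  qed
  have cst: "Const c * f \<in> ?K" if "f \<in> ?K" for f c
  proof -
    have "\<alpha> * lookup (Const c * f) (sg u 1) + \<beta> * lookup (Const c * f) (sg v 2) =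
       c * (\<alpha> * lookup f (sg u 1) + \<beta> * lookup f (sg v 2))"
      by (simp add: algebra_simps)
    then show ?thesis using that by (simp add: pcurve_def)
  qed
  have var: "Var c * f \<in> ?K" if "f \<in> ?K" for f c
  proof -
    have f: "lookup f 0 = 0" "lookup f (sg v 1) = 0" using that by (auto simp: pcurve_def)
    have 2: "sg v 2 = sg v 1 + sg v 1" by (simp add: single_add[symmetric] numeral_2_eq_2)
    have "lookup (Var c * f) (sg w 1) = 0" for w
      using lookup_Var_mult[of c f 0] lookup_Var_mult_0[of "sg w 1" c f] f
      by (cases "c = w") (auto simp: lookup_single when_def)
    moreover have "lookup (Var c * f) (sg v 2) = 0"
      using lookup_Var_mult[of c f "sg v 1"] lookup_Var_mult_0[of "sg v 2" c f] f
      by (cases "c = v") (auto simp: 2 lookup_single lookup_add when_def)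
    ultimately show ?thesis using lookup_Var_mult_0[of 0 c f] by (simp add: pcurve_def)
  qed
  have "h * f \<in> ?K" if f: "f \<in> ?K" for h f
  proof -
    define S where "S = {h. h * f \<in> ?K}"
    have "h \<in> S"
      by (rule mpol_coord_closure[of S])
        (use f add cst var in \<open>auto simp: S_def distrib_right mult.assoc\<close>)
    then show ?thesis by (simp add: S_def)
  qed
  then show ?thesis using add unfolding is_ideal_iff by (auto simp: pcurve_def)
qed

lemma pcurve_frame:
  fixes u v :: coord
  assumes uv: "u \<noteq> v"
  shows "frame (\<lambda>f. \<chi> i. trip (lookup f 0) (lookup f (sg v 1)) (\<alpha> * lookup f (sg u 1) + \<beta> * lookup f (sg v 2)) i)
    (pcurve u v \<alpha> (\<beta> :: 'k::field))"
  unfolding frame_def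
  by (intro conjI allI pcurve_ideal[OF uv])
    (auto simp: vec_eq_iff forall_3 lookup_add algebra_simps pcurve_def)

text \<open>The components are ordered as in \<open>muv u v\<close>, while
  \<open>pcurve_frame\<close> follows \<open>mvv v\<close>; with \<alpha> = 1, respectively \<beta>
  = 1, the frame matrix is the identity.\<close>

lemma pcurve_frame':
  fixes u v :: coord
  assumes uv: "u \<noteq> v"
  shows "frame (\<lambda>f. \<chi> i. trip (lookup f 0) (\<alpha> * lookup f (sg u 1) + \<beta> * lookup f (sg v 2)) (lookup f (sg v 1)) i)
    (pcurve u v \<alpha> (\<beta> :: 'k::field))"
  unfolding frame_def
  by (intro conjI allI pcurve_ideal[OF uv])
    (auto simp: vec_eq_iff forall_3 lookup_add algebra_simps pcurve_def)

lemma pcurve_mvv: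
  fixes u v :: coord and \<alpha> :: "'k::field"
  assumes uv: "u \<noteq> v"
  shows "pcurve u v \<alpha> 1 \<in> hchart (mvv v)"
    and "hcoeff (mvv v) (pcurve u v \<alpha> 1) (m, mvv v j) =
      trip (if m = 0 then 1 else 0) (if m = sg v 1 then 1 else 0)
        ((if m = sg u 1 then \<alpha> else 0) + (if m = sg v 2 then 1 else 0)) j"
proof -
  let ?\<kappa> = "\<lambda>f :: (coord, 'k) mpol. (\<chi> i. trip (lookup f 0) (lookup f (sg v 1)) (\<alpha> * lookup f (sg u 1) + 1 * lookup f (sg v 2)) i)"
  note fr = pcurve_frame[OF uv, of \<alpha> 1]
  have M: "fmat ?\<kappa> (mon (mvv v)) = mat 1"
    unfolding fmat_def mat_def vec_eq_iff forall_3 using uv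
    by (simp add: lookup_monom sg_eq_iff sg_neq)
  show *: "pcurve u v \<alpha> 1 \<in> hchart (mvv v)"
    using frame_chart[OF fr inj_mvv[of v]] M by simp
  have "(\<chi> j. hcoeff (mvv v) (pcurve u v \<alpha> 1) (m, mvv v j)) = ?\<kappa> (monom m)"
    using frame_coeff(1)[OF fr inj_mvv *, of m] unfolding M by simp
  then have "hcoeff (mvv v) (pcurve u v \<alpha> 1) (m, mvv v j) = ?\<kappa> (monom m) $ j"
    by (simp add: vec_eq_iff)
  also have "\<dots> = trip (if m = 0 then 1 else 0) (if m = sg v 1 then 1 else 0)
        ((if m = sg u 1 then \<alpha> else 0) + (if m = sg v 2 then 1 else 0)) j"
    by (simp add: lookup_monom)
  finally show "hcoeff (mvv v) (pcurve u v \<alpha> 1) (m, mvv v j) =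
      trip (if m = 0 then 1 else 0) (if m = sg v 1 then 1 else 0)
        ((if m = sg u 1 then \<alpha> else 0) + (if m = sg v 2 then 1 else 0)) j" .
qed

lemma pcurve_muv:
  fixes u v :: coord and \<beta> :: "'k::field"
  assumes uv: "u \<noteq> v"
  shows "pcurve u v 1 \<beta> \<in> hchart (muv u v)"
    and "hcoeff (muv u v) (pcurve u v 1 \<beta>) (m, muv u v j) =
      trip (if m = 0 then 1 else 0) ((if m = sg u 1 then 1 else 0) + (if m = sg v 2 then \<beta> else 0))
        (if m = sg v 1 then 1 else 0) j"
proof -
  let ?\<kappa> = "\<lambda>f :: (coord, 'k) mpol. (\<chi> i. trip (lookup f 0) (1 * lookup f (sg u 1) + \<beta> * lookup f (sg v 2)) (lookup f (sg v 1)) i)"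
  note fr = pcurve_frame'[OF uv, of 1 \<beta>]
  have M: "fmat ?\<kappa> (mon (muv u v)) = mat 1"
    unfolding fmat_def mat_def vec_eq_iff forall_3 using uv
    by (simp add: lookup_monom sg_eq_iff sg_neq)
  show *: "pcurve u v 1 \<beta> \<in> hchart (muv u v)"
    using frame_chart[OF fr inj_muv[OF uv]] M by simp
  have "(\<chi> j. hcoeff (muv u v) (pcurve u v 1 \<beta>) (m, muv u v j)) = ?\<kappa> (monom m)"
    using frame_coeff(1)[OF fr inj_muv[OF uv] *, of m] unfolding M by simp
  then have "hcoeff (muv u v) (pcurve u v 1 \<beta>) (m, muv u v j) = ?\<kappa> (monom m) $ j"
    by (simp add: vec_eq_iff)
  also have "\<dots> = trip (if m = 0 then 1 else 0) ((if m = sg u 1 then 1 else 0) + (if m = sg v 2 then \<beta> else 0))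
        (if m = sg v 1 then 1 else 0) j"
    by (simp add: lookup_monom)
  finally show "hcoeff (muv u v) (pcurve u v 1 \<beta>) (m, muv u v j) =
      trip (if m = 0 then 1 else 0) ((if m = sg u 1 then 1 else 0) + (if m = sg v 2 then \<beta> else 0))
        (if m = sg v 1 then 1 else 0) j" .
qed

lemma pcurve_scale: "c \<noteq> 0 \<Longrightarrow> pcurve u v (c * \<alpha>) (c * \<beta>) = pcurve u v \<alpha> \<beta>"
proof -
  assume "c \<noteq> 0"
  moreover have "c * \<alpha> * x + c * \<beta> * y = c * (\<alpha> * x + \<beta> * y)" for x y by (simp add: algebra_simps)
  ultimately show ?thesis by (simp add: pcurve_def)
qed

lemma pcurve_cases:
  assumes "(\<alpha>, \<beta>) \<noteq> (0, 0)"
  shows "\<beta> \<noteq> 0 \<Longrightarrow> pcurve u v \<alpha> \<beta> = pcurve u v (\<alpha> / \<beta>) 1"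
    and "\<alpha> \<noteq> 0 \<Longrightarrow> pcurve u v \<alpha> \<beta> = pcurve u v 1 (\<beta> / \<alpha>)"
  using pcurve_scale[of \<beta> u v "\<alpha> / \<beta>" 1] pcurve_scale[of \<alpha> u v 1 "\<beta> / \<alpha>"] by auto

lemma CurveI: "(\<alpha>, \<beta>) \<noteq> (0, 0) \<Longrightarrow> pcurve u v \<alpha> \<beta> \<in> Curve u v"
  unfolding Curve_def by blast

lemma Curve_eq: "Curve u v = insert (pcurve u v 1 0) (range (\<lambda>\<alpha>. pcurve u v \<alpha> 1))"
proof
  show "Curve u v \<subseteq> insert (pcurve u v 1 0) (range (\<lambda>\<alpha>. pcurve u v \<alpha> 1))"
  proof
    fix I assume "I \<in> Curve u v"
    then obtain \<alpha> \<beta> where I: "I = pcurve u v \<alpha> \<beta>" "(\<alpha>, \<beta>) \<noteq> (0, 0)" by (auto simp: Curve_def)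
    show "I \<in> insert (pcurve u v 1 0) (range (\<lambda>\<alpha>. pcurve u v \<alpha> 1))"
      using pcurve_cases[OF I(2), of u v] I by (cases "\<beta> = 0") auto
  qed
qed (auto intro: CurveI)

lemma Curve_eq': "Curve u v = insert (pcurve u v 0 1) (range (\<lambda>\<beta>. pcurve u v 1 \<beta>))"
proof
  show "Curve u v \<subseteq> insert (pcurve u v 0 1) (range (\<lambda>\<beta>. pcurve u v 1 \<beta>))"
  proof
    fix I assume "I \<in> Curve u v"
    then obtain \<alpha> \<beta> where I: "I = pcurve u v \<alpha> \<beta>" "(\<alpha>, \<beta>) \<noteq> (0, 0)" by (auto simp: Curve_def)
    show "I \<in> insert (pcurve u v 0 1) (range (\<lambda>\<beta>. pcurve u v 1 \<beta>))"
      using pcurve_cases[OF I(2), of u v] I by (cases "\<alpha> = 0") auto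
  qed
qed (auto intro: CurveI)

lemma monom_notin_chart:
  fixes b :: "3 \<Rightarrow> coord expo"
  assumes "inj b" "I \<in> hchart b"
  shows "monom (b j) \<notin> I"
proof
  assume "monom (b j) \<in> I"
  then have "lin (mon b) (axis j 1) \<in> I" by (simp add: lin_axis)
  from chart_lin_eq_0[OF assms this] show False by simp
qed

lemma pcurve_not_mvv:
  fixes u v :: coord
  assumes uv: "u \<noteq> v"
  shows "pcurve u v \<alpha> (0 :: 'k::field) \<notin> hchart (mvv v)" "pcurve u v \<alpha> \<beta> \<notin> hchart (mvv u)"
    "pcurve u v 0 \<beta> \<notin> hchart (muv u v)"
proof -
  have "monom (mvv v 3) \<in> pcurve u v \<alpha> (0 :: 'k)"
    using uv by (simp add: pcurve_def lookup_monom sg_eq_iff sg_neq)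
  then show "pcurve u v \<alpha> (0 :: 'k) \<notin> hchart (mvv v)" using monom_notin_chart[OF inj_mvv] by blast
  have "monom (mvv u 3) \<in> pcurve u v \<alpha> \<beta>"
    using uv by (simp add: pcurve_def lookup_monom sg_eq_iff sg_neq)
  then show "pcurve u v \<alpha> \<beta> \<notin> hchart (mvv u)" using monom_notin_chart[OF inj_mvv] by blast
  have "monom (muv u v 2) \<in> pcurve u v 0 \<beta>"
    using uv by (simp add: pcurve_def lookup_monom sg_eq_iff sg_neq)
  then show "pcurve u v 0 \<beta> \<notin> hchart (muv u v)" using monom_notin_chart[OF inj_muv[OF uv]] by blast
qed

lemma Curve_mvv:
  fixes u v :: coord
  assumes "u \<noteq> v" "I \<in> Curve u v" "I \<in> hchart (mvv v)"
  obtains \<alpha> where "I = pcurve u v \<alpha> 1"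
  using assms pcurve_not_mvv(1)[OF assms(1)] by (auto simp: Curve_eq)

lemma Curve_muv:
  fixes u v :: coord
  assumes "u \<noteq> v" "I \<in> Curve u v" "I \<in> hchart (muv u v)"
  obtains \<beta> where "I = pcurve u v 1 \<beta>"
  using assms pcurve_not_mvv(3)[OF assms(1)] by (auto simp: Curve_eq')

lemma pcurve_swap: "pcurve u v 1 0 = pcurve v u 1 0"
  by (auto simp: pcurve_def)

section \<open>Generators of the ideals on the curves\<close>

lemma power_ge: "n \<le> i \<Longrightarrow> x ^ i = x ^ (i - n) * x ^ n" for x :: "'a::monoid_mult"
  by (simp add: power_add[symmetric])

lemma lookup_Var_power: "lookup (Var v ^ n :: (coord, 'k::comm_ring_1) mpol) m = (if m = sg v n then 1 else 0)"
  unfolding monom_sg[symmetric] lookup_monom by auto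

lemma lookup_Var: "lookup (Var v :: (coord, 'k::comm_ring_1) mpol) m = (if m = sg v (Suc 0) then 1 else 0)"
  using lookup_Var_power[of v 1 m] by simp

text \<open>Apart from the terms in u and v^2, every monomial of \<open>f\<close> is divisible by
  v^3, uv or u^2; the linear condition makes the remaining two terms a multiple of the fourth
  generator. An arbitrary \<open>G\<close> allows the result to serve for other generating sets and
  for ideals known only by their charts.\<close>

lemma pcurve_gen:
  fixes u v :: coord and a b :: "'k::field"
  assumes uv: "u \<noteq> v" and ab: "(a, b) \<noteq> (0, 0)" and G: "is_ideal G"
    and gens: "Var v ^ 3 \<in> G" "Var u * Var v \<in> G" "Var u ^ 2 \<in> G" "Const a * Var v ^ 2 + Const b * Var u \<in> G"
  shows "pcurve u v a (- b) \<subseteq> G"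
proof
  fix f assume "f \<in> pcurve u v a (- b)"
  then have f: "lookup f 0 = 0" "lookup f (sg v 1) = 0" "a * lookup f (sg u 1) = b * lookup f (sg v 2)"
    by (auto simp: pcurve_def)
  have m: "monom m \<in> G" if m: "m \<noteq> 0" "m \<noteq> sg v 1" "m \<noteq> sg u 1" "m \<noteq> sg v 2" for m
  proof -
    define i l where "i = lookup m u" and "l = lookup m v"
    have m_eq: "m = sg u i + sg v l" using expo_eq[OF uv, of m] by (simp add: i_def l_def)
    then have mon: "monom m = Var u ^ i * Var v ^ l" by (simp add: monom_add monom_sg)
    consider "i \<ge> 2" | "i \<ge> 1" "l \<ge> 1" | "l \<ge> 3" | "i = 0 \<and> l = 0" | "i = 0 \<and> l = 1" | "i = 0 \<and> l = 2" | "i = 1 \<and> l = 0"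
      by linarith
    then show ?thesis
    proof cases
      case 1
      have "monom m = (Var u ^ (i - 2) * Var v ^ l) * Var u ^ 2"
        unfolding mon by (subst power_ge[OF 1]) (simp add: mult_ac)
      then show ?thesis using ideal_mult[OF G gens(3)] by metis
    next
      case 2
      have "monom m = (Var u ^ (i - 1) * Var v ^ (l - 1)) * (Var u * Var v)"
        unfolding mon by (subst power_ge[OF 2(1)], subst power_ge[OF 2(2)]) (simp add: mult_ac)
      then show ?thesis using ideal_mult[OF G gens(2)] by metis
    next
      case 3
      have "monom m = (Var u ^ i * Var v ^ (l - 3)) * Var v ^ 3"
        unfolding mon by (subst power_ge[OF 3]) (simp add: mult_ac)
      then show ?thesis using ideal_mult[OF G gens(1)] by metis
    qed (use m m_eq in auto)
  qed
  have ne: "sg u 1 \<noteq> sg v 2" using uv by (simp add: sg_eq_iff)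
  define g where "g = f - Const (lookup f (sg u 1)) * Var u - Const (lookup f (sg v 2)) * Var v ^ 2"
  have lg: "lookup g m = (if m = sg u 1 \<or> m = sg v 2 then 0 else lookup f m)" for m
    using ne by (auto simp: g_def lookup_minus lookup_Var lookup_Var_power)
  have "(\<Sum>m\<in>keys g. Const (lookup g m) * monom m) \<in> G"
  proof (intro ideal_sum[OF G] ideal_mult[OF G])
    fix n assume "n \<in> keys g"
    then have "lookup g n \<noteq> 0" by (simp add: in_keys_iff)
    then show "monom n \<in> G" using lg[of n] f by (intro m) (auto split: if_splits)
  qed
  then have gG: "g \<in> G" unfolding single_eq_Const_monom[symmetric] mpol_eq_sum[of g, symmetric] .
  have "Const (lookup f (sg u 1)) * Var u + Const (lookup f (sg v 2)) * Var v ^ 2 \<in> G"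
  proof (cases "b = 0")
    case True
    with ab have a: "a \<noteq> 0" by simp
    then have u0: "lookup f (sg u 1) = 0" using f(3) True by simp
    have "Const (lookup f (sg v 2) / a) * (Const a * Var v ^ 2 + Const b * Var u) \<in> G"
      by (rule ideal_mult[OF G gens(4)])
    then show ?thesis using True a u0 by (simp add: mult.assoc[symmetric] Const_mult[symmetric])
  next
    case False
    have "Const (lookup f (sg u 1) / b) * (Const a * Var v ^ 2 + Const b * Var u) \<in> G"
      by (rule ideal_mult[OF G gens(4)])
    moreover have "lookup f (sg u 1) / b * a = lookup f (sg v 2)" using f(3) False by (simp add: field_simps)
    ultimately show ?thesis using False
      by (simp add: distrib_left mult.assoc[symmetric] Const_mult[symmetric] add.commute)
  qed
  from ideal_add[OF G gG this] show "f \<in> G" by (simp add: g_def algebra_simps)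
qed

lemma pcurve_eq_ideal_gen:
  fixes u v :: coord and a b :: "'k::field"
  assumes uv: "u \<noteq> v" and ab: "(a, b) \<noteq> (0, 0)"
  shows "ideal_gen {Var v ^ 3, Var u * Var v, Var u ^ 2, Const a * Var v ^ 2 + Const b * Var u} = pcurve u v a (- b)"
    (is "ideal_gen ?S = _")
proof
  show "pcurve u v a (- b) \<subseteq> ideal_gen ?S"
    by (rule pcurve_gen[OF uv ab is_ideal_gen]) (simp_all add: ideal_gen_base)
  show "ideal_gen ?S \<subseteq> pcurve u v a (- b)"
  proof (rule ideal_gen_minimal[OF _ pcurve_ideal[OF uv]])
    have 1: "Var u * Var v = (monom (sg u 1 + sg v 1) :: (coord, 'k) mpol)" by (simp add: monom_add monom_sg)
    have 2: "Var w ^ n = (monom (sg w n) :: (coord, 'k) mpol)" for w n by (simp add: monom_sg)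
    have 3: "Var u = (monom (sg u 1) :: (coord, 'k) mpol)" by (simp add: monom_sg)
    have 4: "sg u 1 + sg v 1 \<noteq> sg w n" for w n
    proof
      assume "sg u 1 + sg v 1 = sg w n"
      then have "lookup (sg u 1 + sg v 1) u = lookup (sg w n) u" "lookup (sg u 1 + sg v 1) v = lookup (sg w n) v" by auto
      then show False using uv by (auto simp: lookup_add lookup_single when_def split: if_splits)
    qed
    have 5: "sg u 1 + sg v 1 \<noteq> 0" using 4[of u 0] by simp
    show "?S \<subseteq> pcurve u v a (- b)"
      unfolding 1 2 pcurve_def using uv 4 5
      by (simp add: lookup_monom lookup_add sg_eq_iff sg_neq 3)
  qed
qed

section \<open>Weights of single variables and of monomials\<close>

lemma Hom0_var: "y \<noteq> x \<Longrightarrow> (\<lambda>q. q y) \<in> Hom (\<lambda>z. if z = x then 1 else 0) 0"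
  using Hom_var[of y "\<lambda>z. if z = x then 1 else 0"] by simp

lemma Hom0_mult: "F \<in> Hom \<omega> 0 \<Longrightarrow> G \<in> Hom \<omega> 0 \<Longrightarrow> (\<lambda>q. F q * G q) \<in> Hom \<omega> 0"
  using Hom_mult[of F \<omega> 0 G 0] by simp

lemma Hom0_power: "F \<in> Hom \<omega> 0 \<Longrightarrow> (\<lambda>q. F q ^ n) \<in> Hom \<omega> 0"
  using Hom_power[of F \<omega> 0 n] by simp

lemmas Hom0_intros = Hom0_var Hom0_mult Hom0_power Hom_add Hom_diff Hom_const

lemma var_eval: "(\<lambda>q :: 'v::finite \<Rightarrow> 'k::field. q x) \<in> range eval"
  using Hom_eval[OF Hom_var[of x "\<lambda>_. 0"]] .

text \<open>The weights (2, 1) of (u, v) give u and v^2 the same weight, so the torus fixes the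
  curve pointwise. With (3, 1), next, u outweighs 1, v, v^2, and the chart of \<open>mvv v\<close>
  contracts to a point; with (1, 1) the same happens to the chart of \<open>muv u v\<close>.\<close>

lemma expo_wt_21:
  fixes u v :: coord
  assumes "u \<noteq> v"
  shows "m = 0 \<or> m = sg v 1 \<or> m = sg v 2 \<or> m = sg u 1 \<or> 3 \<le> wt (\<lambda>c. if c = u then 2 else 1) m"
proof -
  define i l where "i = lookup m u" and "l = lookup m v"
  have m: "m = sg u i + sg v l" using expo_eq[OF assms, of m] by (simp add: i_def l_def)
  then have w: "wt (\<lambda>c. if c = u then 2 else 1) m = 2 * i + l" using assms by (auto simp: wt_add)
  consider "2 * i + l \<ge> 3" | "i = 0 \<and> l = 0" | "i = 0 \<and> l = 1" | "i = 0 \<and> l = 2" | "i = 1 \<and> l = 0"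
    by linarith
  then show ?thesis by cases (auto simp: m w[unfolded m])
qed

lemma expo_wt_31:
  fixes u v :: coord
  assumes "u \<noteq> v"
  shows "m = 0 \<or> m = sg v 1 \<or> m = sg v 2 \<or> 3 \<le> wt (\<lambda>c. if c = u then 3 else 1) m"
proof -
  define i l where "i = lookup m u" and "l = lookup m v"
  have m: "m = sg u i + sg v l" using expo_eq[OF assms, of m] by (simp add: i_def l_def)
  then have w: "wt (\<lambda>c. if c = u then 3 else 1) m = 3 * i + l" using assms by (auto simp: wt_add)
  consider "3 * i + l \<ge> 3" | "i = 0 \<and> l = 0" | "i = 0 \<and> l = 1" | "i = 0 \<and> l = 2"
    by linarith
  then show ?thesis by cases (auto simp: m w[unfolded m])
qed

lemma expo_wt_11:
  fixes u v :: coord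
  assumes "u \<noteq> v"
  shows "m = 0 \<or> m = sg v 1 \<or> m = sg u 1 \<or> 2 \<le> wt (\<lambda>_. 1) m"
proof -
  define i l where "i = lookup m u" and "l = lookup m v"
  have m: "m = sg u i + sg v l" using expo_eq[OF assms, of m] by (simp add: i_def l_def)
  then have w: "wt (\<lambda>_. 1) m = i + l" using assms by (auto simp: wt_add)
  consider "i + l \<ge> 2" | "i = 0 \<and> l = 0" | "i = 0 \<and> l = 1" | "i = 1 \<and> l = 0"
    by linarith
  then show ?thesis by cases (auto simp: m w[unfolded m One_nat_def])
qed

context induced
begin

subsection \<open>Explicit values of the splitting\<close>

lemma p_odd: "odd CHAR('k)"
  using prime_odd_nat[OF p_prime] p_gt by simp

lemma two_ne: "(2 :: 'k) \<noteq> 0"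
  using of_nat_ne[of 2] p_gt by simp

text \<open>In the binomial expansion the exponents of \<open>q x\<close> run from 1 to p, and
  \<open>T\<close> kills all but the p-th power, which is then taken out by Frobenius
  linearity.\<close>

lemma T_linear_part:
  fixes x :: "3 \<times> coord"
  defines "\<omega> \<equiv> \<lambda>z. if z = x then 1 else (0::nat)"
  assumes A: "A \<in> Hom \<omega> 0" and L: "L \<in> Hom \<omega> 0" and G: "G \<in> Hom \<omega> 0"
  shows "T (\<lambda>q. G q * (q x * A q + L q) ^ (CHAR('k) - 1) * q x) =
    (\<lambda>q. q x * T (\<lambda>q. G q * A q ^ (CHAR('k) - 1)) q)"
proof -
  let ?n = "CHAR('k) - 1"
  have pn: "CHAR('k) = Suc ?n" using p_gt by simp
  define F where "F k q = of_nat (?n choose k) * (G q * A q ^ k * L q ^ (?n - k) * q x ^ Suc k)" for k and q :: "3 \<times> coord \<Rightarrow> 'k"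
  have F: "F k \<in> Hom \<omega> (Suc k)" for k
  proof -
    have "(\<lambda>q. G q * A q ^ k * L q ^ (?n - k) * q x ^ Suc k) \<in> Hom \<omega> (0 + 0 * k + 0 * (?n - k) + \<omega> x * Suc k)"
      by (intro Hom_mult Hom_power Hom_var A L G)
    then show ?thesis unfolding F_def[abs_def] by (intro Hom_scale) (simp add: \<omega>_def)
  qed
  have "(\<lambda>q. G q * (q x * A q + L q) ^ ?n * q x) = (\<lambda>q. \<Sum>k\<le>?n. F k q)"
  proof
    fix q :: "3 \<times> coord \<Rightarrow> 'k"
    show "G q * (q x * A q + L q) ^ ?n * q x = (\<Sum>k\<le>?n. F k q)"
      unfolding binomial_ring sum_distrib_left sum_distrib_right F_def
      by (intro sum.cong) (simp_all add: power_mult_distrib mult_ac)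
  qed
  then have "T (\<lambda>q. G q * (q x * A q + L q) ^ ?n * q x) = (\<lambda>q. \<Sum>k\<le>?n. T (F k) q)"
    using T_sum[of "{..?n}" F] Hom_eval[OF F] by simp
  also have "\<dots> = T (F ?n)"
  proof
    fix q
    have "T (F k) q = 0" if "k \<in> {..?n} - {?n}" for k
    proof -
      have "Suc k < CHAR('k)" using that pn by auto
      then have "\<not> CHAR('k) dvd Suc k" by (simp add: nat_dvd_not_less)
      then show ?thesis using T_kills[OF F[of k]] by simp
    qed
    then show "(\<Sum>k\<le>?n. T (F k) q) = T (F ?n) q"
      by (subst sum.remove[of _ ?n]) (auto intro!: sum.neutral)
  qed
  also have "F ?n = (\<lambda>q. q x ^ CHAR('k) * (G q * A q ^ ?n))"
  proof
    fix q :: "3 \<times> coord \<Rightarrow> 'k"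
    have "q x ^ CHAR('k) = q x ^ Suc ?n" using pn by simp
    then show "F ?n q = q x ^ CHAR('k) * (G q * A q ^ ?n)" by (simp add: F_def mult_ac)
  qed
  also have "T \<dots> = (\<lambda>q. q x * T (\<lambda>q. G q * A q ^ ?n) q)"
    by (rule T_pmult[OF var_eval Hom_eval[OF Hom0_mult[OF G Hom0_power[OF A]]]])
  finally show ?thesis .
qed

text \<open>After \<open>T_linear_part\<close> the argument of \<open>T\<close> is G A^(p-1) with A
  = v_j^2 - v_k^2. The part of G free of v_i is -A, which gives (-A)^p for odd p and is mapped to
  -A; the other part has degree one in v_i and is killed.\<close>

lemma T_one:
  fixes u v :: coord and i j k :: 3
  assumes uv: "u \<noteq> v" and ij: "i \<noteq> j" "i \<noteq> k"
    and L: "L \<in> Hom (\<lambda>z. if z = (i, u) then 1 else 0) 0"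
  shows "T (\<lambda>q. ((q (i, v) + q (j, v) + q (k, v)) * (q (k, v) - q (j, v))) *
      (q (i, u) * (q (j, v) ^ 2 - q (k, v) ^ 2) + L q) ^ (CHAR('k) - 1) * q (i, u)) =
    (\<lambda>q. - (q (i, u) * (q (j, v) ^ 2 - q (k, v) ^ 2)))"
proof -
  let ?n = "CHAR('k) - 1"
  have pn: "CHAR('k) = Suc ?n" using p_gt by simp
  define A where "A q = q (j, v) ^ 2 - q (k, v) ^ 2" for q :: "3 \<times> coord \<Rightarrow> 'k"
  define G where "G q = (q (i, v) + q (j, v) + q (k, v)) * (q (k, v) - q (j, v))" for q :: "3 \<times> coord \<Rightarrow> 'k"
  define G1 where "G1 q = q (i, v) * ((q (k, v) - q (j, v)) * A q ^ ?n)" for q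
  have 1: "T (\<lambda>q. G q * (q (i, u) * A q + L q) ^ ?n * q (i, u)) = (\<lambda>q. q (i, u) * T (\<lambda>q. G q * A q ^ ?n) q)"
    unfolding A_def[abs_def] G_def[abs_def]
    by (rule T_linear_part[OF _ L]) (use uv in \<open>intro Hom0_intros; auto\<close>)+
  have "(\<lambda>q. (q (k, v) - q (j, v)) * A q ^ ?n) \<in> Hom (\<lambda>z. if z = (i, v) then 1 else 0) 0"
    unfolding A_def by (intro Hom0_intros) (use ij in auto)
  from Hom_mult[OF Hom_var[of "(i, v)"] this]
  have G1: "G1 \<in> Hom (\<lambda>z. if z = (i, v) then 1 else 0) 1" unfolding G1_def[abs_def] by simp
  have mA: "(\<lambda>q. - A q) \<in> range eval"
    unfolding A_def by (intro eval_intros var_eval)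
  have "G q * A q ^ ?n = G1 q + (- A q) ^ CHAR('k)" for q
  proof -
    have "(- A q) ^ CHAR('k) = - (A q ^ CHAR('k))" using p_odd by simp
    also have "A q ^ CHAR('k) = A q * A q ^ ?n" by (subst pn) simp
    finally show ?thesis by (simp add: G_def G1_def A_def algebra_simps power2_eq_square)
  qed
  then have "T (\<lambda>q. G q * A q ^ ?n) = (\<lambda>q. T G1 q + T (\<lambda>q. (- A q) ^ CHAR('k)) q)"
    using T_add[OF Hom_eval[OF G1], of "\<lambda>q. (- A q) ^ CHAR('k)"] mA by (simp add: eval_intros)
  also have "\<dots> = (\<lambda>q. - A q)"
    unfolding T_pow[OF mA] using T_kills[OF G1] p_gt by simp
  finally have 2: "T (\<lambda>q. G q * A q ^ ?n) = (\<lambda>q. - A q)" .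
  have "T (\<lambda>q. G q * (q (i, u) * A q + L q) ^ ?n * q (i, u)) = (\<lambda>q. - (q (i, u) * A q))"
    unfolding 1 2 by simp
  then show ?thesis unfolding G_def A_def .
qed

lemma ptdet_uv:
  fixes u v :: coord
  assumes "u \<noteq> v"
  shows "ptdet ((mvv v)(2 := sg u 1)) q = q (1, u) * (q (2, v) ^ 2 - q (3, v) ^ 2) +
      q (2, u) * (q (3, v) ^ 2 - q (1, v) ^ 2) + q (3, u) * (q (1, v) ^ 2 - q (2, v) ^ 2)"
    and "ptdet ((mvv v)(3 := sg u 1)) q = q (1, u) * (q (3, v) - q (2, v)) +
      q (2, u) * (q (1, v) - q (3, v)) + q (3, u) * (q (2, v) - q (1, v))"
  unfolding ptdet_def det_3 by (simp_all add: pt_def algebra_simps)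

text \<open>The p - 1 factors of b and the one of c have \<open>ptdet (mvv v) ^ CHAR('k)\<close> as
  common denominator. The numerator splits into three summands, one for each u-coordinate in
  \<open>?C\<close>; as \<open>?B\<close> is linear in the same coordinate, \<open>T_one\<close>
  applies cyclically, and the results add up to \<open>- ?B q\<close>.\<close>

lemma phi_first:
  fixes u v :: coord
  assumes uv: "u \<noteq> v" and q: "q \<in> good v (mvv v)"
  defines "W \<equiv> hchart (mvv v) :: (coord, 'k) mpol set set"
    and "C \<equiv> hcoeff (mvv v)"
  shows "\<phi> W (cut W (\<lambda>I. C I (sg v 3, sg v 2) * C I (sg u 1, sg v 1) ^ (CHAR('k) - 1) * C I (sg u 1, sg v 2)))
     (pts_ideal q) = - C (pts_ideal q) (sg u 1, sg v 1)"
proof -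
  let ?n = "CHAR('k) - 1"
  have pn: "CHAR('k) = Suc ?n" using p_gt by simp
  let ?B = "ptdet ((mvv v)(2 := sg u 1)) :: _ \<Rightarrow> 'k" and ?C = "ptdet ((mvv v)(3 := sg u 1)) :: _ \<Rightarrow> 'k"
  let ?e = "\<lambda>q :: 3 \<times> coord \<Rightarrow> 'k. q (1, v) + q (2, v) + q (3, v)"
  define F where "F q = ?e q * ?B q ^ ?n * ?C q" for q
  have F: "F \<in> range eval" unfolding F_def[abs_def] by (intro eval_intros var_eval ptdet_eval)
  have B: "C (pts_ideal q) (sg u 1, sg v 1) = ?B q / ptdet (mvv v) q" if "q \<in> good v (mvv v)" for q
    using pts_coeff[OF inj_mvv[of v], of q "sg u 1" 2] that by (simp add: C_def good_def)
  have C: "C (pts_ideal q) (sg u 1, sg v 2) = ?C q / ptdet (mvv v) q" if "q \<in> good v (mvv v)" for q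
    using pts_coeff[OF inj_mvv[of v], of q "sg u 1" 3] that by (simp add: C_def good_def)
  have "\<phi> W (cut W (\<lambda>I. C I (sg v 3, sg v 2) * C I (sg u 1, sg v 1) ^ ?n * C I (sg u 1, sg v 2))) (pts_ideal q)
     = T F q / ptdet (mvv v) q ^ 1"
    unfolding W_def
  proof (rule phi_pts[OF uv inj_mvv _ F _ q])
    show "(\<lambda>I. C I (sg v 3, sg v 2) * C I (sg u 1, sg v 1) ^ ?n * C I (sg u 1, sg v 2)) \<in> hring (mvv v)"
      unfolding C_def by (intro chart_ring_intros)
    fix q :: "3 \<times> coord \<Rightarrow> 'k" assume q: "q \<in> good v (mvv v)"
    then have d: "ptdet (mvv v) q \<noteq> 0" by (simp add: good_def)
    have "ptdet (mvv v) q ^ CHAR('k) = ptdet (mvv v) q * ptdet (mvv v) q ^ ?n" by (subst pn) simp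
    then show "C (pts_ideal q) (sg v 3, sg v 2) * C (pts_ideal q) (sg u 1, sg v 1) ^ ?n * C (pts_ideal q) (sg u 1, sg v 2)
       = F q / ptdet (mvv v) q ^ (CHAR('k) * 1)"
      unfolding B[OF q] C[OF q] F_def unfolding C_def pts_cubic(1)[OF d]
      by (simp add: power_divide mult_ac)
  qed
  moreover have "T F = (\<lambda>q. - ?B q)"
  proof -
    let ?b = "\<lambda>j k (q :: 3 \<times> coord \<Rightarrow> 'k). q (j, v) ^ 2 - q (k, v) ^ 2"
    define F' where "F' i j k L q = ((q (i, v) + q (j, v) + q (k, v)) * (q (k, v) - q (j, v))) *
      (q (i, u) * ?b j k q + L q) ^ ?n * q (i, u)" for i j k L and q :: "3 \<times> coord \<Rightarrow> 'k"
    define L1 where "L1 q = q (2, u) * ?b 3 1 q + q (3, u) * ?b 1 2 q" for q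
    define L2 where "L2 q = q (1, u) * ?b 2 3 q + q (3, u) * ?b 1 2 q" for q
    define L3 where "L3 q = q (1, u) * ?b 2 3 q + q (2, u) * ?b 3 1 q" for q
    have L: "L1 \<in> Hom (\<lambda>z. if z = (1, u) then 1 else 0) 0"
      "L2 \<in> Hom (\<lambda>z. if z = (2, u) then 1 else 0) 0"
      "L3 \<in> Hom (\<lambda>z. if z = (3, u) then 1 else 0) 0"
      unfolding L1_def[abs_def] L2_def[abs_def] L3_def[abs_def]
      by (intro Hom0_intros; use uv in simp)+
    have ev: "F' i j k L \<in> range eval" if "L \<in> range eval" for i j k L
      unfolding F'_def[abs_def] by (intro eval_intros var_eval that)
    note ev = ev[OF Hom_eval[OF L(1)]] ev[OF Hom_eval[OF L(2)]] ev[OF Hom_eval[OF L(3)]]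
    have "F = (\<lambda>q. F' 1 2 3 L1 q + (F' 2 3 1 L2 q + F' 3 1 2 L3 q))"
    proof
      fix q
      have B1: "?B q = q (1, u) * ?b 2 3 q + L1 q" "?B q = q (2, u) * ?b 3 1 q + L2 q"
        "?B q = q (3, u) * ?b 1 2 q + L3 q"
        unfolding ptdet_uv[OF uv] by (simp_all add: L1_def L2_def L3_def)
      have "F' 1 2 3 L1 q = ?e q * (q (3, v) - q (2, v)) * ?B q ^ ?n * q (1, u)"
        unfolding F'_def B1(1)[symmetric] by simp
      moreover have "F' 2 3 1 L2 q = ?e q * (q (1, v) - q (3, v)) * ?B q ^ ?n * q (2, u)"
        unfolding F'_def B1(2)[symmetric] by (simp add: add_ac)
      moreover have "F' 3 1 2 L3 q = ?e q * (q (2, v) - q (1, v)) * ?B q ^ ?n * q (3, u)"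
        unfolding F'_def B1(3)[symmetric] by (simp add: add_ac)
      ultimately show "F q = F' 1 2 3 L1 q + (F' 2 3 1 L2 q + F' 3 1 2 L3 q)"
        unfolding F_def ptdet_uv(2)[OF uv] by (simp add: ring_distribs mult_ac)
    qed
    then have "T F = (\<lambda>q. T (F' 1 2 3 L1) q + (T (F' 2 3 1 L2) q + T (F' 3 1 2 L3) q))"
      using T_add[OF ev(1), of "\<lambda>q. F' 2 3 1 L2 q + F' 3 1 2 L3 q"] T_add[OF ev(2,3)] ev by (simp add: eval_intros)
    also have "\<dots> = (\<lambda>q. - ?B q)"
    proof
      fix q
      show "T (F' 1 2 3 L1) q + (T (F' 2 3 1 L2) q + T (F' 3 1 2 L3) q) = - ?B q"
        unfolding F'_def[abs_def] ptdet_uv(1)[OF uv]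
        using T_one[OF uv _ _ L(1), of 2 3] T_one[OF uv _ _ L(2), of 3 1] T_one[OF uv _ _ L(3), of 1 2] by simp
    qed
    finally show ?thesis .
  qed
  ultimately show ?thesis using B[OF q] by simp
qed

text \<open>Identities on triples of distinct points extend to punctual ideals, which are limits of the
  triples with \<open>v\<close>-coordinates \<open>0, t, - t\<close> on the same parabola.\<close>

lemma extend_to_punctual:
  fixes u v :: coord
  assumes uv: "u \<noteq> v" and J: "J \<in> hchart (mvv v)" "zeros J \<subseteq> {\<lambda>_. 0}"
    and \<Phi>: "\<Phi> \<in> regular (hilb_scheme 3) (hchart (mvv v))" and h: "h \<in> hring (mvv v)"
    and eq: "\<And>q. q \<in> good v (mvv v) \<Longrightarrow> \<Phi> (pts_ideal q) = h (pts_ideal q)"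
  shows "\<Phi> J = (h J :: 'k)"
proof -
  let ?C = "hcoeff (mvv v)"
  define \<beta> c where "\<beta> = ?C J (sg u 1, sg v 1)" and "c = ?C J (sg u 1, sg v 2)"
  have J3: "?C J (sg v 3, mvv v j) = 0" for j by (rule punctual_mvv(1)[OF J(1) uv J(2)])
  have J1: "?C J (sg u 1, mvv v j) = trip 0 \<beta> c j" for j
    using punctual_mvv(2)[OF J(1) uv J(2)] exhaust_3[of j] by (auto simp: \<beta>_def c_def)
  define q where "q t = (\<lambda>(i, w). let s = trip 0 t (- t) i in if w = v then s else \<beta> * s + c * s ^ 2)" for t
  have qv: "q t (i, v) = trip 0 t (- t) i"
    and qu: "q t (i, u) = \<beta> * trip 0 t (- t) i + c * trip 0 t (- t) i ^ 2" for t i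
    using uv by (simp_all add: q_def Let_def)
  have good: "q t \<in> good v (mvv v)" if "t \<noteq> 0" for t
  proof -
    have "ptdet (mvv v) (q t) = 2 * t ^ 3" by (simp add: ptdet_mvv qv power3_eq_cube)
    then show ?thesis using that two_ne by (simp add: good_def)
  qed
  define \<gamma> where "\<gamma> t = (if t = 0 then J else pts_ideal (q t))" for t
  have \<gamma>W: "\<gamma> t \<in> hchart (mvv v)" for t
    using J(1) good[of t] pts_chart[OF inj_mvv[of v], of "q t"] by (simp add: \<gamma>_def good_def)
  have c1: "?C (\<gamma> t) (sg u 1, mvv v j) = trip 0 \<beta> c j" for t j
  proof (cases "t = 0")
    case False
    then have d: "ptdet (mvv v) (q t) \<noteq> 0" using good by (simp add: good_def)
    have "?C (pts_ideal (q t)) (sg u 1, mvv v j) = trip 0 \<beta> c j"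
      by (rule pts_coeff_unique[OF inj_mvv d]) (simp add: sum_3 pt_def qu qv)
    with False show ?thesis by (simp add: \<gamma>_def)
  qed (use J1 in \<open>simp add: \<gamma>_def\<close>)
  have c3: "?C (\<gamma> t) (sg v 3, mvv v j) = trip 0 (t ^ 2) 0 j" for t j
  proof (cases "t = 0")
    case True
    then show ?thesis using J3[of j] exhaust_3[of j] by (auto simp: \<gamma>_def)
  next
    case False
    then have d: "ptdet (mvv v) (q t) \<noteq> 0" using good by (simp add: good_def)
    have "\<forall>i. trip 0 t (- t) i ^ 3 = t ^ 2 * trip 0 t (- t) i"
      unfolding forall_3 by (simp add: power2_eq_square power3_eq_cube)
    then have "?C (pts_ideal (q t)) (sg v 3, mvv v j) = trip 0 (t ^ 2) 0 j"
      by (intro pts_coeff_unique[OF inj_mvv d]) (simp add: sum_3 pt_def qv)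
    with False show ?thesis by (simp add: \<gamma>_def)
  qed
  have pf: "polyfun (\<lambda>t. ?C (\<gamma> t) x)" for x
  proof (rule mvv_coeff_polyfun[OF uv \<gamma>W])
    show "polyfun (\<lambda>t. ?C (\<gamma> t) (sg u 1, mvv v j))" for j unfolding c1 by (rule polyfun_const)
    show "polyfun (\<lambda>t. ?C (\<gamma> t) (sg v 3, mvv v j))" for j
      unfolding c3 using exhaust_3[of j] polyfun_power[OF polyfun_id, of 2] by (auto intro: polyfun_const)
  qed
  have "\<Phi> (\<gamma> 0) = h (\<gamma> 0)"
  proof (rule curve_value[OF inj_mvv \<Phi> \<gamma>W pf])
    show "polyfun (\<lambda>t. h (\<gamma> t))"
      by (rule polyfun_alg[OF h[unfolded chart_ring_alg]]) (use pf in auto)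
    show "\<Phi> (\<gamma> t) = h (\<gamma> t)" if "t \<noteq> 0" for t using eq[OF good[OF that]] that by (simp add: \<gamma>_def)
  qed
  then show ?thesis by (simp add: \<gamma>_def)
qed

subsection \<open>Compatibility of the curves and points\<close>

lemma vanish_Curve_mvv:
  fixes u v :: coord
  assumes uv: "u \<noteq> v" and g: "g \<in> hring (mvv v)"
    "\<And>I. I \<in> Curve u v \<Longrightarrow> I \<in> hchart (mvv v) \<Longrightarrow> g I = 0"
  shows "\<phi> (hchart (mvv v)) (cut (hchart (mvv v)) g) (pcurve u v \<alpha> 1) = 0"
proof -
  let ?W = "hchart (mvv v) :: (coord, 'k) mpol set set" and ?C = "hcoeff (mvv v)"
  \<comment> \<open>Of the six coefficients of u and v^3 only that of v^2 in u has weight 0, so the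
    contraction keeps it and sets the others to 0.\<close>
  let ?\<pi> = "\<lambda>I. pcurve u v (?C I (sg u 1, sg v 2)) 1"
  let ?\<omega> = "\<lambda>c. if c = u then 2 else 1 :: nat"
  \<comment> \<open>Three points on the parabola u = \<alpha> v^2, with v equal to 0, 1, -1; their
    torus limit is the prescribed point of the curve.\<close>
  define q where "q = (\<lambda>(i, w). let s = trip 0 1 (- 1) i in if w = v then s else \<alpha> * s ^ 2)"
  have qv: "q (i, v) = trip 0 1 (- 1) i" and qu: "q (i, u) = \<alpha> * trip 0 1 (- 1) i ^ 2" for i
    using uv by (simp_all add: q_def Let_def)
  have d: "ptdet (mvv v) q \<noteq> 0" using two_ne by (simp add: ptdet_mvv qv)
  have "?C (pts_ideal q) (sg u 1, mvv v 3) = trip 0 0 \<alpha> 3"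
    by (rule pts_coeff_unique[OF inj_mvv d]) (simp add: sum_3 pt_def qu qv)
  then have \<pi>q: "?\<pi> (pts_ideal q) = pcurve u v \<alpha> 1" by simp
  have wb: "wt ?\<omega> (mvv v 1) = 0" "wt ?\<omega> (mvv v 2) = 1" "wt ?\<omega> (mvv v 3) = 2" using uv by auto
  have le2: "wt ?\<omega> (mvv v k) \<le> 2" for k using exhaust_3[of k] wb by auto
  have CW: "?C I (m, mvv v k) = trip (if m = 0 then 1 else 0) (if m = sg v 1 then 1 else 0)
        ((if m = sg u 1 then \<alpha>' else 0) + (if m = sg v 2 then 1 else 0)) k" if "I = pcurve u v \<alpha>' 1"
    for I :: "(coord, 'k) mpol set" and \<alpha>' m k
    unfolding that by (rule pcurve_mvv(2)[OF uv])
  show ?thesis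
  proof (rule contracted_vanish[where \<omega> = ?\<omega> and \<pi> = ?\<pi> and Z = "Curve u v" and b = "mvv v",
        OF uv inj_mvv _ _ _ \<pi>q g])
    show "q \<in> good v (mvv v)" using d by (simp add: good_def)
    show "?\<pi> I \<in> Curve u v \<inter> ?W" if "I \<in> ?W" for I
      using pcurve_mvv(1)[OF uv] by (auto intro!: CurveI)
    fix m k assume m: "m \<notin> range (mvv v)"
    consider (u) "m = sg u 1" | (big) "m \<notin> {0, sg v 1, sg v 2, sg u 1}" "3 \<le> wt ?\<omega> m"
      using expo_wt_21[OF uv, of m] m by (fastforce simp: range_trip)
    then show "(wt ?\<omega> (mvv v k) = wt ?\<omega> m \<and> (\<forall>I\<in>?W. ?C (?\<pi> I) (m, mvv v k) = ?C I (m, mvv v k))) \<or>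
        (wt ?\<omega> (mvv v k) < wt ?\<omega> m \<and> (\<forall>I\<in>Curve u v \<inter> ?W. ?C I (m, mvv v k) = 0))"
    proof cases
      case u
      have wu: "wt ?\<omega> m = 2" by (simp add: u)
      show ?thesis
      proof (cases "k = 3")
        case True
        then show ?thesis using wu wb CW[OF refl, of _ m 3] uv by (simp add: u sg_eq_iff sg_neq)
      next
        case False
        then have k: "k = 1 \<or> k = 2" using exhaust_3[of k] by auto
        have "?C I (m, mvv v k) = 0" if I: "I \<in> Curve u v \<inter> ?W" for I
        proof -
          obtain \<alpha>' where "I = pcurve u v \<alpha>' 1" using Curve_mvv[OF uv] I by blast
          from CW[OF this, of m k] show ?thesis using k uv by (auto simp: u sg_eq_iff sg_neq)
        qed
        moreover have "wt ?\<omega> (mvv v k) < wt ?\<omega> m" using wu wb k by auto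
        ultimately show ?thesis by blast
      qed
    next
      case big
      have "?C I (m, mvv v k) = 0" if I: "I \<in> Curve u v \<inter> ?W" for I
      proof -
        obtain \<alpha>' where "I = pcurve u v \<alpha>' 1" using Curve_mvv[OF uv] I by blast
        from CW[OF this, of m k] show ?thesis using big(1) exhaust_3[of k] by auto
      qed
      moreover have "wt ?\<omega> (mvv v k) < wt ?\<omega> m" using le2[of k] big(2) by linarith
      ultimately show ?thesis by blast
    qed
  qed
qed

lemma vanish_point_mvv:
  fixes u v :: coord
  assumes uv: "u \<noteq> v" and g: "g \<in> hring (mvv v)" "g (pcurve u v 0 1) = 0"
  shows "\<phi> (hchart (mvv v)) (cut (hchart (mvv v)) g) (pcurve u v 0 1) = 0"
proof -
  let ?W = "hchart (mvv v) :: (coord, 'k) mpol set set" and ?C = "hcoeff (mvv v)"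
  let ?\<pi> = "\<lambda>_ :: (coord, 'k) mpol set. pcurve u v 0 (1 :: 'k)"
  \<comment> \<open>Weight 3 for u makes every remaining coordinate positive, so the contraction is
    constant.\<close>
  let ?\<omega> = "\<lambda>c. if c = u then 3 else 1 :: nat"
  define q where "q = (\<lambda>(i, w). if w = v then trip 0 1 (- 1) i else (0 :: 'k))"
  have qv: "q (i, v) = trip 0 1 (- 1) i" for i :: 3 by (simp add: q_def)
  have d: "ptdet (mvv v) q \<noteq> 0" using two_ne by (simp add: ptdet_mvv qv)
  have wb: "wt ?\<omega> (mvv v 1) = 0" "wt ?\<omega> (mvv v 2) = 1" "wt ?\<omega> (mvv v 3) = 2" using uv by auto
  have le2: "wt ?\<omega> (mvv v k) \<le> 2" for k using exhaust_3[of k] wb by auto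
  show ?thesis
  proof (rule contracted_vanish[where \<omega> = ?\<omega> and \<pi> = ?\<pi> and Z = "{pcurve u v 0 1}" and b = "mvv v",
        OF uv inj_mvv _ _ _ refl g(1)])
    show "q \<in> good v (mvv v)" using d by (simp add: good_def)
    show "pcurve u v 0 1 \<in> {pcurve u v 0 1} \<inter> ?W" using pcurve_mvv(1)[OF uv] by auto
    show "g I = 0" if "I \<in> {pcurve u v 0 1}" for I using g(2) that by simp
    fix m k assume m: "m \<notin> range (mvv v)"
    consider (big) "m \<notin> {0, sg v 1, sg v 2}" "3 \<le> wt ?\<omega> m"
      using expo_wt_31[OF uv, of m] m by (fastforce simp: range_trip)
    then show "(wt ?\<omega> (mvv v k) = wt ?\<omega> m \<and> (\<forall>I\<in>?W. ?C (?\<pi> I) (m, mvv v k) = ?C I (m, mvv v k))) \<or>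
        (wt ?\<omega> (mvv v k) < wt ?\<omega> m \<and> (\<forall>I\<in>{pcurve u v 0 1} \<inter> ?W. ?C I (m, mvv v k) = 0))"
    proof cases
      case big
      have "?C (pcurve u v 0 1) (m, mvv v k) = 0"
        unfolding pcurve_mvv(2)[OF uv] using big(1) exhaust_3[of k] by auto
      moreover have "wt ?\<omega> (mvv v k) < wt ?\<omega> m" using le2[of k] big(2) by linarith
      ultimately show ?thesis by blast
    qed
  qed
qed

lemma muv_example:
  fixes u v :: coord
  assumes uv: "u \<noteq> v"
  obtains q :: "3 \<times> coord \<Rightarrow> 'k" where "q \<in> good u (muv u v)"
    "hcoeff (muv u v) (pts_ideal q) (sg v 2, sg u 1) = 0"
proof -
  \<comment> \<open>The points (u, v) = (0, 0), (1, 0), (-1, 1) have distinct u-coordinates and are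
    not collinear. They satisfy v^2 = v, so the coefficient of u in v^2 is 0.\<close>
  define q where "q = (\<lambda>(i, w). if w = v then trip 0 0 1 i else (trip 0 1 (- 1) i :: 'k))"
  have qv: "q (i, v) = trip 0 0 1 i" and qu: "q (i, u) = trip 0 1 (- 1) i" for i :: 3
    using uv by (simp_all add: q_def)
  have d: "ptdet (mvv u) q \<noteq> 0" using two_ne by (simp add: ptdet_mvv qu)
  have d': "ptdet (muv u v) q \<noteq> 0" unfolding ptdet_def det_3 by (simp add: pt_def qu qv)
  have "\<forall>i. trip 0 0 1 i ^ 2 = (trip 0 0 1 i :: 'k)" unfolding forall_3 by simp
  then have "hcoeff (muv u v) (pts_ideal q) (sg v 2, muv u v 2) = trip 0 0 1 2"
    by (intro pts_coeff_unique[OF inj_muv[OF uv] d']) (simp add: sum_3 pt_def qu qv)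
  then show ?thesis using that[of q] d d' by (simp add: good_def)
qed

lemma vanish_Curve_muv:
  fixes u v :: coord
  assumes uv: "u \<noteq> v" and g: "g \<in> hring (muv u v)"
    "\<And>I. I \<in> Curve u v \<Longrightarrow> I \<in> hchart (muv u v) \<Longrightarrow> g I = 0"
  shows "\<phi> (hchart (muv u v)) (cut (hchart (muv u v)) g) (pcurve u v 1 0) = 0"
proof -
  let ?W = "hchart (muv u v) :: (coord, 'k) mpol set set" and ?C = "hcoeff (muv u v)"
  \<comment> \<open>In this chart the coefficient of u in v^2 is the parameter of the curve and is
    the coordinate kept by the contraction.\<close>
  let ?\<pi> = "\<lambda>I. pcurve u v 1 (?C I (sg v 2, sg u 1))"
  let ?\<omega> = "\<lambda>c. if c = u then 2 else 1 :: nat"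
  obtain q where q: "q \<in> good u (muv u v)" "?C (pts_ideal q) (sg v 2, sg u 1) = (0 :: 'k)"
    using muv_example[OF uv] .
  then have \<pi>q: "?\<pi> (pts_ideal q) = pcurve u v 1 0" by simp
  have wb: "wt ?\<omega> (muv u v 1) = 0" "wt ?\<omega> (muv u v 2) = 2" "wt ?\<omega> (muv u v 3) = 1" using uv by auto
  have le2: "wt ?\<omega> (muv u v k) \<le> 2" for k using exhaust_3[of k] wb by auto
  have CW: "?C I (m, muv u v k) = trip (if m = 0 then 1 else 0) ((if m = sg u 1 then 1 else 0) + (if m = sg v 2 then \<beta> else 0))
        (if m = sg v 1 then 1 else 0) k" if "I = pcurve u v 1 \<beta>"
    for I :: "(coord, 'k) mpol set" and \<beta> m k
    unfolding that by (rule pcurve_muv(2)[OF uv])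
  show ?thesis
  proof (rule contracted_vanish[where \<omega> = ?\<omega> and \<pi> = ?\<pi> and Z = "Curve u v" and b = "muv u v",
        OF uv[symmetric] inj_muv[OF uv] _ _ q(1) \<pi>q g])
    show "?\<pi> I \<in> Curve u v \<inter> ?W" if "I \<in> ?W" for I
      using pcurve_muv(1)[OF uv] by (auto intro!: CurveI)
    fix m k assume m: "m \<notin> range (muv u v)"
    consider (v2) "m = sg v 2" | (big) "m \<notin> {0, sg v 1, sg v 2, sg u 1}" "3 \<le> wt ?\<omega> m"
      using expo_wt_21[OF uv, of m] m by (fastforce simp: range_trip)
    then show "(wt ?\<omega> (muv u v k) = wt ?\<omega> m \<and> (\<forall>I\<in>?W. ?C (?\<pi> I) (m, muv u v k) = ?C I (m, muv u v k))) \<or>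
        (wt ?\<omega> (muv u v k) < wt ?\<omega> m \<and> (\<forall>I\<in>Curve u v \<inter> ?W. ?C I (m, muv u v k) = 0))"
    proof cases
      case v2
      have wu: "wt ?\<omega> m = 2" using uv by (simp add: v2)
      show ?thesis
      proof (cases "k = 2")
        case True
        then show ?thesis using wu wb CW[OF refl, of _ m 2] uv by (simp add: v2 sg_eq_iff sg_neq)
      next
        case False
        then have k: "k = 1 \<or> k = 3" using exhaust_3[of k] by auto
        have "?C I (m, muv u v k) = 0" if I: "I \<in> Curve u v \<inter> ?W" for I
        proof -
          obtain \<beta> where "I = pcurve u v 1 \<beta>" using Curve_muv[OF uv] I by blast
          from CW[OF this, of m k] show ?thesis using k uv by (auto simp: v2 sg_eq_iff sg_neq)
        qed
        moreover have "wt ?\<omega> (muv u v k) < wt ?\<omega> m" using wu wb k by auto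
        ultimately show ?thesis by blast
      qed
    next
      case big
      have "?C I (m, muv u v k) = 0" if I: "I \<in> Curve u v \<inter> ?W" for I
      proof -
        obtain \<beta> where "I = pcurve u v 1 \<beta>" using Curve_muv[OF uv] I by blast
        from CW[OF this, of m k] show ?thesis using big(1) exhaust_3[of k] by auto
      qed
      moreover have "wt ?\<omega> (muv u v k) < wt ?\<omega> m" using le2[of k] big(2) by linarith
      ultimately show ?thesis by blast
    qed
  qed
qed

lemma vanish_point_muv:
  fixes u v :: coord
  assumes uv: "u \<noteq> v" and g: "g \<in> hring (muv u v)" "g (pcurve u v 1 0) = 0"
  shows "\<phi> (hchart (muv u v)) (cut (hchart (muv u v)) g) (pcurve u v 1 0) = 0"
proof -
  let ?W = "hchart (muv u v) :: (coord, 'k) mpol set set" and ?C = "hcoeff (muv u v)"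
  let ?\<pi> = "\<lambda>_ :: (coord, 'k) mpol set. pcurve u v 1 (0 :: 'k)"
  \<comment> \<open>Total degree: monomials outside the basis have degree at least 2, those in it at
    most 1, so all weights are positive.\<close>
  let ?\<omega> = "\<lambda>_ :: coord. 1 :: nat"
  obtain q :: "3 \<times> coord \<Rightarrow> 'k" where q: "q \<in> good u (muv u v)"
    using muv_example[OF uv] by blast
  have wb: "wt ?\<omega> (muv u v 1) = 0" "wt ?\<omega> (muv u v 2) = 1" "wt ?\<omega> (muv u v 3) = 1" by auto
  have le1: "wt ?\<omega> (muv u v k) \<le> 1" for k using exhaust_3[of k] wb by auto
  show ?thesis
  proof (rule contracted_vanish[where \<omega> = ?\<omega> and \<pi> = ?\<pi> and Z = "{pcurve u v 1 0}" and b = "muv u v",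
        OF uv[symmetric] inj_muv[OF uv] _ _ q refl g(1)])
    show "pcurve u v 1 0 \<in> {pcurve u v 1 0} \<inter> ?W" using pcurve_muv(1)[OF uv] by auto
    show "g I = 0" if "I \<in> {pcurve u v 1 0}" for I using g(2) that by simp
    fix m k assume m: "m \<notin> range (muv u v)"
    consider (big) "m \<notin> {0, sg v 1, sg u 1}" "2 \<le> wt ?\<omega> m"
      using expo_wt_11[OF uv, of m] m by (fastforce simp: range_trip)
    then show "(wt ?\<omega> (muv u v k) = wt ?\<omega> m \<and> (\<forall>I\<in>?W. ?C (?\<pi> I) (m, muv u v k) = ?C I (m, muv u v k))) \<or>
        (wt ?\<omega> (muv u v k) < wt ?\<omega> m \<and> (\<forall>I\<in>{pcurve u v 1 0} \<inter> ?W. ?C I (m, muv u v k) = 0))"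
    proof cases
      case big
      have "?C (pcurve u v 1 0) (m, muv u v k) = 0"
        unfolding pcurve_muv(2)[OF uv] using big(1) exhaust_3[of k] by auto
      moreover have "wt ?\<omega> (muv u v k) < wt ?\<omega> m" using le1[of k] big(2) by linarith
      ultimately show ?thesis by blast
    qed
  qed
qed

lemma compatI:
  assumes "\<And>U f J. openin (htop) U \<Longrightarrow> f \<in> ideal_sheaf (hilb_scheme 3) Z U \<Longrightarrow>
     J \<in> Z \<Longrightarrow> J \<in> U \<Longrightarrow> \<phi> U f J = 0"
  shows "compatibly_split (hilb_scheme 3) \<phi> Z"
  unfolding compatibly_split_def
proof (intro allI impI image_subsetI)
  fix U f assume U: "openin (htop) U" and f: "f \<in> ideal_sheaf (hilb_scheme 3) Z U"
  have "f \<in> regular (hilb_scheme 3) U" using f by (simp add: ideal_sheaf_def)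
  from split_regular[OF phi_split U this] assms[OF U f]
  show "\<phi> U f \<in> ideal_sheaf (hilb_scheme 3) Z U" by (auto simp: ideal_sheaf_def)
qed

lemma compat_Curve:
  fixes u v :: coord
  assumes uv: "u \<noteq> v"
  shows "compatibly_split (hilb_scheme 3) \<phi> (Curve u v)"
proof (rule compatI)
  fix U :: "(coord, 'k) mpol set set" and f J assume U: "openin (htop) U" and f: "f \<in> ideal_sheaf (hilb_scheme 3) (Curve u v) U"
    and J: "J \<in> Curve u v" "J \<in> U"
  show "\<phi> U f J = 0"
  proof (cases "J = pcurve u v 1 0")
    case True
    show ?thesis
      by (rule compat_local[OF phi_split p_gt(2) U J(2) f inj_muv[OF uv]])
        (use True pcurve_muv(1)[OF uv] vanish_Curve_muv[OF uv] in auto)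
  next
    case False
    then obtain \<alpha> where \<alpha>: "J = pcurve u v \<alpha> 1" using J(1) by (auto simp: Curve_eq)
    show ?thesis
      by (rule compat_local[OF phi_split p_gt(2) U J(2) f inj_mvv[of v]])
        (use \<alpha> pcurve_mvv(1)[OF uv] vanish_Curve_mvv[OF uv] in auto)
  qed
qed

lemma compat_point_mvv:
  fixes u v :: coord
  assumes uv: "u \<noteq> v"
  shows "compatibly_split (hilb_scheme 3) \<phi> {pcurve u v 0 1}"
proof (rule compatI)
  fix U :: "(coord, 'k) mpol set set" and f J assume U: "openin (htop) U" and f: "f \<in> ideal_sheaf (hilb_scheme 3) {pcurve u v 0 1} U"
    and J: "J \<in> {pcurve u v 0 1}" "J \<in> U"
  show "\<phi> U f J = 0"
    by (rule compat_local[OF phi_split p_gt(2) U J(2) f inj_mvv[of v]])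
      (use J pcurve_mvv(1)[OF uv] vanish_point_mvv[OF uv] in auto)
qed

lemma compat_point_muv:
  fixes u v :: coord
  assumes uv: "u \<noteq> v"
  shows "compatibly_split (hilb_scheme 3) \<phi> {pcurve u v 1 0}"
proof (rule compatI)
  fix U :: "(coord, 'k) mpol set set" and f J assume U: "openin (htop) U" and f: "f \<in> ideal_sheaf (hilb_scheme 3) {pcurve u v 1 0} U"
    and J: "J \<in> {pcurve u v 1 0}" "J \<in> U"
  show "\<phi> U f J = 0"
    by (rule compat_local[OF phi_split p_gt(2) U J(2) f inj_muv[OF uv]])
      (use J pcurve_muv(1)[OF uv] vanish_point_muv[OF uv] in auto)
qed

end

subsection \<open>Closed subsets\<close>

lemma closed_by_nbhds:
  assumes "S \<subseteq> topspace \<tau>" "\<And>I. I \<in> topspace \<tau> \<Longrightarrow> I \<notin> S \<Longrightarrow> \<exists>U. openin \<tau> U \<and> I \<in> U \<and> U \<inter> S = {}"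
  shows "closedin \<tau> S"
proof -
  have "openin \<tau> (topspace \<tau> - S)"
  proof (subst openin_subopen, intro ballI)
    fix I assume "I \<in> topspace \<tau> - S"
    then obtain U where U: "openin \<tau> U" "I \<in> U" "U \<inter> S = {}" using assms(2) by auto
    then have "U \<subseteq> topspace \<tau> - S" using openin_subset by fastforce
    with U show "\<exists>T. openin \<tau> T \<and> I \<in> T \<and> T \<subseteq> topspace \<tau> - S" by blast
  qed
  with assms(1) show ?thesis by (simp add: closedin_def)
qed

lemma chart_topspace:
  "inj (b :: 3 \<Rightarrow> coord expo) \<Longrightarrow> I \<in> hchart b \<Longrightarrow> (I :: (coord, 'k::field) mpol set) \<in> topspace (htop)"
  unfolding hilb_topspace by blast

lemma hilb_closed_point:
  assumes "(I :: (coord, 'k::field) mpol set) \<in> topspace (htop)"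
  shows "closedin (htop) {I}"
proof (rule closed_by_nbhds)
  show "{I} \<subseteq> topspace (htop)" using assms by simp
  fix J :: "(coord, 'k) mpol set"
  assume "J \<in> topspace (htop)" "J \<notin> {I}"
  then obtain b :: "3 \<Rightarrow> coord expo" where b: "inj b" "J \<in> hchart b" and ne: "J \<noteq> I"
    unfolding hilb_topspace by blast
  show "\<exists>U. openin (htop) U \<and> J \<in> U \<and> U \<inter> {I} = {}"
  proof (cases "I \<in> hchart b")
    case False
    then show ?thesis using b hilb_open_chart[OF b(1)] by blast
  next
    case True
    let ?C = "hcoeff b"
    have "\<exists>m j. ?C J (m, b j) \<noteq> ?C I (m, b j)"
    proof (rule ccontr)
      assume "\<nexists>m j. ?C J (m, b j) \<noteq> ?C I (m, b j)"
      then have "f \<in> J \<longleftrightarrow> f \<in> I" for f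
        unfolding chart_mem_iff[OF b] chart_mem_iff[OF b(1) True] by simp
      with ne show False by blast
    qed
    then obtain m j where mj: "?C J (m, b j) \<noteq> ?C I (m, b j)" by blast
    define h where "h K = ?C K (m, b j) - ?C I (m, b j)" for K
    have "h \<in> hring b" unfolding h_def[abs_def] by (intro chart_ring_intros)
    from hilb_open_basic[OF b(1) this] show ?thesis
      using mj b by (intro exI[of _ "{K \<in> hchart b. h K \<noteq> 0}"]) (auto simp: h_def)
  qed
qed

lemma subvariety_point:
  assumes "(I :: (coord, 'k::field) mpol set) \<in> topspace (htop)"
  shows "subvariety (hilb_scheme 3) {I}"
  unfolding subvariety_def using hilb_closed_point[OF assms] by blast

text \<open>Points are closed, so a finite set splits into one of its points and a closed
  remainder.\<close>

lemma subvariety_finite: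
  assumes Z: "subvariety (hilb_scheme 3) (Z :: (coord, 'k::field) mpol set set)" and fin: "finite Z"
  shows "\<exists>I. Z = {I}"
proof -
  have cl: "closedin (htop) Z" and irr: "\<And>C D. closedin (htop) C \<Longrightarrow>
      closedin (htop) D \<Longrightarrow> Z \<subseteq> C \<union> D \<Longrightarrow> Z \<subseteq> C \<or> Z \<subseteq> D" and "Z \<noteq> {}"
    using Z unfolding subvariety_def by blast+
  then obtain I where I: "I \<in> Z" by blast
  have pt: "closedin (htop) {J}" if "J \<in> Z" for J
    using that closedin_subset[OF cl] by (intro hilb_closed_point) auto
  have "closedin (htop) (\<Union>J\<in>Z - {I}. {J})"
    by (rule closedin_Union) (use fin pt in auto)
  then have "closedin (htop) (Z - {I})" by simp
  from irr[OF pt[OF I] this] I have "Z \<subseteq> {I}" by blast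
  with I show ?thesis by blast
qed

text \<open>The relations u = \<alpha> v^2 and v^3 = 0 yield uv = 0 and u^2 = 0, so \<open>I\<close>
  contains an ideal of the curve; equality holds because both lie in the same chart.\<close>

lemma mvv_in_Curve:
  fixes u v :: coord and I :: "(coord, 'k::field) mpol set"
  assumes uv: "u \<noteq> v" and I: "I \<in> hchart (mvv v)"
  defines "C \<equiv> hcoeff (mvv v) I"
  assumes z: "C (sg u 1, 0) = 0" "C (sg u 1, sg v 1) = 0" "\<And>j. C (sg v 3, mvv v j) = 0"
  shows "I = pcurve u v (C (sg u 1, sg v 2)) 1"
proof -
  define \<alpha> where "\<alpha> = C (sg u 1, sg v 2)"
  note id = chart_ideal[OF I]
  have "monom (sg u 1) - lin (mon (mvv v)) (\<chi> j. C (sg u 1, mvv v j)) \<in> I"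
    unfolding C_def by (rule chart_coeff_mem[OF inj_mvv I])
  then have 1: "Var u - Const \<alpha> * Var v ^ 2 \<in> I" using z by (simp add: lin_trip monom_sg \<alpha>_def)
  have "monom (sg v 3) - lin (mon (mvv v)) (\<chi> j. C (sg v 3, mvv v j)) \<in> I"
    unfolding C_def by (rule chart_coeff_mem[OF inj_mvv I])
  then have 3: "Var v ^ 3 \<in> I" using z(3) by (simp add: lin_def monom_sg)
  have "Var v * (Var u - Const \<alpha> * Var v ^ 2) + Const \<alpha> * Var v ^ 3 \<in> I" by (intro ideal_add ideal_mult id 1 3)
  then have uvI: "Var u * Var v \<in> I" by (simp add: algebra_simps power2_eq_square power3_eq_cube)
  have "Var u * (Var u - Const \<alpha> * Var v ^ 2) + Const \<alpha> * Var v * (Var u * Var v) \<in> I"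
    by (intro ideal_add ideal_mult id 1 uvI)
  then have u2: "Var u ^ 2 \<in> I" by (simp add: algebra_simps power2_eq_square)
  have 4: "Const (- \<alpha>) * Var v ^ 2 + Const 1 * Var u \<in> I" using 1 by (simp add: Const_uminus)
  have "pcurve u v (- \<alpha>) (- 1) \<subseteq> I"
    by (rule pcurve_gen[OF uv _ id 3 uvI u2 4]) simp
  moreover have "pcurve u v (- \<alpha>) (- 1) = pcurve u v \<alpha> 1"
    using pcurve_scale[of "-1" u v \<alpha> 1] by simp
  ultimately have "pcurve u v \<alpha> 1 \<subseteq> I" by simp
  from chart_subset_eq[OF inj_mvv pcurve_mvv(1)[OF uv] I this] show ?thesis by (simp add: \<alpha>_def)
qed

lemma muv_in_Curve:
  fixes u v :: coord and I :: "(coord, 'k::field) mpol set"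
  assumes uv: "u \<noteq> v" and I: "I \<in> hchart (muv u v)"
    and m: "Var u ^ 2 \<in> I" "Var u * Var v \<in> I" "Var v ^ 2 - Const s * Var u \<in> I"
  shows "I = pcurve u v 1 s"
proof -
  note id = chart_ideal[OF I]
  have "Var v * (Var v ^ 2 - Const s * Var u) + Const s * (Var u * Var v) \<in> I"
    by (intro ideal_add ideal_mult id m)
  then have v3: "Var v ^ 3 \<in> I" by (simp add: algebra_simps power2_eq_square power3_eq_cube)
  have 4: "Const 1 * Var v ^ 2 + Const (- s) * Var u \<in> I" using m(3) by (simp add: Const_uminus)
  have "pcurve u v 1 (- (- s)) \<subseteq> I"
    by (rule pcurve_gen[OF uv _ id v3 m(2,1) 4]) simp
  then have "pcurve u v 1 s \<subseteq> I" by simp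
  from chart_subset_eq[OF inj_muv[OF uv] pcurve_muv(1)[OF uv] I this] show ?thesis by simp
qed

lemma Curve_Hilb:
  fixes u v :: coord
  assumes "u \<noteq> v" "I \<in> Curve u v"
  shows "I \<in> Hilb 3" "I \<in> topspace (htop)"
proof -
  consider \<alpha> where "I = pcurve u v \<alpha> 1" | "I = pcurve u v 1 0" using assms(2) by (auto simp: Curve_eq)
  then have "I \<in> hchart (mvv v) \<or> I \<in> hchart (muv u v)"
    by cases (use pcurve_mvv(1)[OF assms(1)] pcurve_muv(1)[OF assms(1)] in auto)
  then show "I \<in> Hilb 3" "I \<in> topspace (htop)"
    using chart_Hilb[OF inj_mvv] chart_Hilb[OF inj_muv[OF assms(1)]]
      chart_topspace[OF inj_mvv] chart_topspace[OF inj_muv[OF assms(1)]] by blast+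
qed

lemma Curve_punctual:
  fixes u v :: coord
  assumes uv: "u \<noteq> v" and I: "I \<in> Curve u v"
  shows "I \<in> punctual_Hilb 3"
proof -
  obtain \<alpha> \<beta> where \<alpha>: "I = pcurve u v \<alpha> \<beta>" using I by (auto simp: Curve_def)
  have "Var u ^ 2 \<in> I" "Var v ^ 3 \<in> I"
    unfolding \<alpha> pcurve_def using uv by (simp_all add: lookup_Var_power sg_eq_iff sg_neq)
  then have "a u = 0 \<and> a v = 0" if "a \<in> zeros I" for a
    using that unfolding zeros_def by fastforce
  then have "a = (\<lambda>_. 0)" if "a \<in> zeros I" for a
    using that coord_cases[OF uv] by (intro ext) metis
  then show ?thesis using Curve_Hilb(1)[OF uv I] by (auto simp: punctual_Hilb_def)
qed

lemma coeff_nbhd: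
  fixes b :: "3 \<Rightarrow> coord expo"
  assumes "inj b" "I \<in> hchart b" "hcoeff b I x \<noteq> 0"
    and "\<And>J. J \<in> Z \<Longrightarrow> J \<in> hchart b \<Longrightarrow> hcoeff b J x = 0"
  shows "\<exists>U. openin (htop) U \<and> I \<in> U \<and> U \<inter> Z = {}"
  using hilb_open_basic[OF assms(1) chart_coeff_in_ring[of _ x]] assms(2-4)
  by (intro exI[of _ "{J \<in> hchart b. hcoeff b J x \<noteq> 0}"]) auto

text \<open>In the chart of \<open>mvv v\<close> the curve is given by the vanishing of all
  coefficients of u and v^3 except that of v^2 in u. It misses the chart of \<open>mvv u\<close>, as
  its ideals contain u^2. In the chart of \<open>muv u v\<close> it is given by u^2 = uv = 0 and v^2
  being a multiple of u.\<close>

lemma closed_Curve: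
  fixes u v :: coord
  assumes uv: "u \<noteq> v"
  shows "closedin (htop) (Curve u v :: (coord, 'k::field) mpol set set)"
proof (rule closed_by_nbhds)
  show "Curve u v \<subseteq> topspace (htop)" using Curve_Hilb(2)[OF uv] by blast
  fix I :: "(coord, 'k) mpol set"
  assume "I \<in> topspace (htop)" and nI: "I \<notin> Curve u v"
  then have "I \<in> Hilb 3" unfolding hilb_topspace using chart_Hilb by blast
  from Hilb_cover[OF this uv]
  consider "I \<in> hchart (mvv v)" | "I \<in> hchart (mvv u)" | "I \<in> hchart (muv u v)" by blast
  then show "\<exists>U. openin (htop) U \<and> I \<in> U \<and> U \<inter> Curve u v = {}"
  proof cases
    case 1
    let ?C = "hcoeff (mvv v)"
    have nb: "\<exists>U. openin (htop) U \<and> I \<in> U \<and> U \<inter> Curve u v = {}"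
      if x: "?C I (m, mvv v j) \<noteq> 0" "\<And>\<alpha> :: 'k. ?C (pcurve u v \<alpha> 1) (m, mvv v j) = 0" for m j
      by (rule coeff_nbhd[OF inj_mvv 1 x(1)]) (metis x(2) Curve_mvv[OF uv])
    have van: "?C (pcurve u v \<alpha> (1 :: 'k)) (sg u 1, mvv v 1) = 0" "?C (pcurve u v \<alpha> (1 :: 'k)) (sg u 1, mvv v 2) = 0"
      "?C (pcurve u v \<alpha> (1 :: 'k)) (sg v 3, mvv v j) = 0" for \<alpha> j
      unfolding pcurve_mvv(2)[OF uv] using uv exhaust_3[of j] by (auto simp: sg_eq_iff sg_neq)
    have "?C I (sg u 1, mvv v 1) \<noteq> 0 \<or> ?C I (sg u 1, mvv v 2) \<noteq> 0 \<or> (\<exists>j. ?C I (sg v 3, mvv v j) \<noteq> 0)"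
    proof (rule ccontr)
      assume "\<not> ?thesis"
      then have z: "?C I (sg u 1, 0) = 0" "?C I (sg u 1, sg v 1) = 0" "?C I (sg v 3, mvv v j) = 0" for j
        by simp_all
      from mvv_in_Curve[OF uv 1 z] have "I \<in> Curve u v"
        using CurveI[of "?C I (sg u 1, sg v 2)" 1 u v] by simp
      with nI show False by simp
    qed
    then show ?thesis
    proof (elim disjE exE)
      show ?thesis if "?C I (sg u 1, mvv v 1) \<noteq> 0" by (rule nb[OF that van(1)])
      show ?thesis if "?C I (sg u 1, mvv v 2) \<noteq> 0" by (rule nb[OF that van(2)])
      show ?thesis if "?C I (sg v 3, mvv v j) \<noteq> 0" for j by (rule nb[OF that van(3)])
    qed
  next
    case 2
    have "hchart (mvv u) \<inter> Curve u v = {}"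
      using pcurve_not_mvv(2)[OF uv] by (auto simp: Curve_def)
    then show ?thesis using hilb_open_chart[OF inj_mvv[of u]] 2 by blast
  next
    case 3
    let ?C = "hcoeff (muv u v)"
    have nb: "\<exists>U. openin (htop) U \<and> I \<in> U \<and> U \<inter> Curve u v = {}"
      if x: "?C I (m, muv u v j) \<noteq> 0" "\<And>\<beta> :: 'k. ?C (pcurve u v 1 \<beta>) (m, muv u v j) = 0" for m j
      by (rule coeff_nbhd[OF inj_muv[OF uv] 3 x(1)]) (metis x(2) Curve_muv[OF uv])
    have ne: "sg u 1 + sg v 1 \<noteq> sg w n" for w n
    proof
      assume "sg u 1 + sg v 1 = sg w n"
      then have "lookup (sg u 1 + sg v 1) u = lookup (sg w n) u" "lookup (sg u 1 + sg v 1) v = lookup (sg w n) v" by auto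
      then show False using uv by (auto simp: lookup_add lookup_single when_def split: if_splits)
    qed
    have ne0: "sg u 1 + sg v 1 \<noteq> 0" using ne[of u 0] by simp
    have van: "?C (pcurve u v 1 (\<beta> :: 'k)) (sg u 2, muv u v j) = 0" "?C (pcurve u v 1 (\<beta> :: 'k)) (sg u 1 + sg v 1, muv u v j) = 0"
      "?C (pcurve u v 1 (\<beta> :: 'k)) (sg v 2, muv u v 1) = 0" "?C (pcurve u v 1 (\<beta> :: 'k)) (sg v 2, muv u v 3) = 0" for \<beta> j
      unfolding pcurve_muv(2)[OF uv] using uv exhaust_3[of j] ne ne0 by (auto simp: sg_eq_iff sg_neq)
    have "(\<exists>j. ?C I (sg u 2, muv u v j) \<noteq> 0) \<or> (\<exists>j. ?C I (sg u 1 + sg v 1, muv u v j) \<noteq> 0) \<or>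
        ?C I (sg v 2, muv u v 1) \<noteq> 0 \<or> ?C I (sg v 2, muv u v 3) \<noteq> 0"
    proof (rule ccontr)
      assume "\<not> ?thesis"
      then have z: "?C I (sg u 2, muv u v j) = 0" "?C I (sg u 1 + sg v 1, muv u v j) = 0"
        "?C I (sg v 2, muv u v 1) = 0" "?C I (sg v 2, muv u v 3) = 0" for j by simp_all
      note mem = chart_coeff_mem[OF inj_muv[OF uv] 3]
      have m1: "Var u ^ 2 \<in> I" using mem[of "sg u 2"] by (simp add: z lin_def monom_sg)
      have m2: "Var u * Var v \<in> I" using mem[of "sg u 1 + sg v 1"] unfolding z(2) by (simp add: lin_def monom_sg monom_add)
      have m3: "Var v ^ 2 - Const (?C I (sg v 2, muv u v 2)) * Var u \<in> I"
        using mem[of "sg v 2"] unfolding lin_trip vec_lambda_beta z(3,4) by (simp add: monom_sg)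
      from muv_in_Curve[OF uv 3 m1 m2 m3] have "I \<in> Curve u v"
        using CurveI[of 1 "?C I (sg v 2, muv u v 2)" u v] by simp
      with nI show False by simp
    qed
    then show ?thesis
    proof (elim disjE exE)
      show ?thesis if "?C I (sg u 2, muv u v j) \<noteq> 0" for j by (rule nb[OF that van(1)])
      show ?thesis if "?C I (sg u 1 + sg v 1, muv u v j) \<noteq> 0" for j by (rule nb[OF that van(2)])
      show ?thesis if "?C I (sg v 2, muv u v 1) \<noteq> 0" by (rule nb[OF that van(3)])
      show ?thesis if "?C I (sg v 2, muv u v 3) \<noteq> 0" by (rule nb[OF that van(4)])
    qed
  qed
qed

section \<open>Irreducibility of the curves\<close>

lemma polyfun_if: "polyfun f \<Longrightarrow> polyfun g \<Longrightarrow> polyfun (\<lambda>t. if P then f t else g t)"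
  by (cases P) simp_all

lemma polyfun_trip:
  "polyfun f \<Longrightarrow> polyfun g \<Longrightarrow> polyfun h \<Longrightarrow> polyfun (\<lambda>t. trip (f t) (g t) (h t) j)"
  using exhaust_3[of j] by auto

text \<open>Each of the two charts meets the curve in an affine line and omits one point of it. On
  that line a basic open neighbourhood of \<open>I\<close> is the non-vanishing of a nonzero
  polynomial in the parameter.\<close>

lemma Curve_open_cofinite:
  fixes u v :: coord and U :: "(coord, 'k::alg_closed_field) mpol set set"
  assumes uv: "u \<noteq> v" and U: "openin (htop) U" and I: "I \<in> Curve u v" "I \<in> U"
  shows "finite (Curve u v - U)"
proof -
  consider \<alpha> where "I = pcurve u v \<alpha> 1" | "I = pcurve u v 1 0" using I by (auto simp: Curve_eq)
  then show ?thesis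
  proof cases
    case 1
    have IW: "I \<in> hchart (mvv v)" using 1 pcurve_mvv(1)[OF uv] by simp
    obtain h where h: "h \<in> hring (mvv v)" "h I \<noteq> 0" "{J \<in> hchart (mvv v). h J \<noteq> 0} \<subseteq> U"
      using hilb_open_local[OF U I(2) inj_mvv IW] by blast
    have "polyfun (\<lambda>t. hcoeff (mvv v) (pcurve u v t (1 :: 'k)) (m, n))" for m n
    proof (cases "n \<in> range (mvv v)")
      case True
      then obtain j where j: "n = mvv v j" by blast
      show ?thesis unfolding j pcurve_mvv(2)[OF uv] by (intro polyfun_trip polyfun_if polyfun_intros)
    next
      case False
      show ?thesis unfolding chart_coeff_outside[OF pcurve_mvv(1)[OF uv] False] by (rule polyfun_const)
    qed
    then have "polyfun (\<lambda>t. h (pcurve u v t 1))"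
      by (intro polyfun_alg[OF h(1)[unfolded chart_ring_alg]]) auto
    then have "finite {t. h (pcurve u v t 1) = 0}" by (rule polyfun_zeros) (use h(2) 1 in auto)
    moreover have "Curve u v - U \<subseteq> insert (pcurve u v 1 0) ((\<lambda>t. pcurve u v t 1) ` {t. h (pcurve u v t 1) = 0})"
      using h(3) pcurve_mvv(1)[OF uv] by (auto simp: Curve_eq)
    ultimately show ?thesis by (metis finite_imageI finite_insert finite_subset)
  next
    case 2
    have IW: "I \<in> hchart (muv u v)" using 2 pcurve_muv(1)[OF uv] by simp
    obtain h where h: "h \<in> hring (muv u v)" "h I \<noteq> 0" "{J \<in> hchart (muv u v). h J \<noteq> 0} \<subseteq> U"
      using hilb_open_local[OF U I(2) inj_muv[OF uv] IW] by blast
    have "polyfun (\<lambda>t. hcoeff (muv u v) (pcurve u v (1 :: 'k) t) (m, n))" for m n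
    proof (cases "n \<in> range (muv u v)")
      case True
      then obtain j where j: "n = muv u v j" by blast
      show ?thesis unfolding j pcurve_muv(2)[OF uv] by (intro polyfun_trip polyfun_if polyfun_intros)
    next
      case False
      show ?thesis unfolding chart_coeff_outside[OF pcurve_muv(1)[OF uv] False] by (rule polyfun_const)
    qed
    then have "polyfun (\<lambda>t. h (pcurve u v 1 t))"
      by (intro polyfun_alg[OF h(1)[unfolded chart_ring_alg]]) auto
    then have "finite {t. h (pcurve u v 1 t) = 0}" by (rule polyfun_zeros) (use h(2) 2 in auto)
    moreover have "Curve u v - U \<subseteq> insert (pcurve u v 0 1) ((\<lambda>t. pcurve u v 1 t) ` {t. h (pcurve u v 1 t) = 0})"
      using h(3) pcurve_muv(1)[OF uv] by (auto simp: Curve_eq')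
    ultimately show ?thesis by (metis finite_imageI finite_insert finite_subset)
  qed
qed

lemma closed_subset_Curve:
  fixes u v :: coord and Z :: "(coord, 'k::alg_closed_field) mpol set set"
  assumes uv: "u \<noteq> v" and Z: "closedin (htop) Z"
  shows "Curve u v \<subseteq> Z \<or> finite (Curve u v \<inter> Z)"
proof (rule disjCI)
  assume "infinite (Curve u v \<inter> Z)"
  let ?U = "topspace (htop) - Z"
  have U: "openin (htop) ?U" using Z by (simp add: closedin_def)
  have "Curve u v - ?U = Curve u v \<inter> Z" using Curve_Hilb(2)[OF uv] by auto
  with \<open>infinite (Curve u v \<inter> Z)\<close> have "Curve u v \<inter> ?U = {}"
    using Curve_open_cofinite[OF uv U] by auto
  then show "Curve u v \<subseteq> Z" using Curve_Hilb(2)[OF uv] by auto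
qed

lemma infinite_Curve:
  fixes u v :: coord
  assumes uv: "u \<noteq> v"
  shows "infinite (Curve u v :: (coord, 'k::alg_closed_field) mpol set set)"
proof
  assume fin: "finite (Curve u v :: (coord, 'k) mpol set set)"
  have co: "hcoeff (mvv v) (pcurve u v t 1) (sg u 1, mvv v 3) = t" for t :: 'k
    unfolding pcurve_mvv(2)[OF uv] using uv by (simp add: sg_eq_iff)
  have "inj (\<lambda>t :: 'k. pcurve u v t 1)" by (rule injI) (metis co)
  moreover have "range (\<lambda>t :: 'k. pcurve u v t 1) \<subseteq> Curve u v" by (auto intro!: CurveI)
  ultimately show False
    using fin infinite_alg_closed[where 'k = 'k] finite_subset finite_imageD by metis
qed

lemma subvariety_Curve:
  fixes u v :: coord
  assumes uv: "u \<noteq> v"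
  shows "subvariety (hilb_scheme 3) (Curve u v :: (coord, 'k::alg_closed_field) mpol set set)"
  unfolding subvariety_def
proof (intro conjI allI impI)
  show "closedin (htop) (Curve u v :: (coord, 'k) mpol set set)" by (rule closed_Curve[OF uv])
  show "Curve u v \<noteq> ({} :: (coord, 'k) mpol set set)" using infinite_Curve[OF uv, where 'k = 'k] by auto
  fix C D :: "(coord, 'k) mpol set set"
  assume CD: "closedin (htop) C \<and> closedin (htop) D \<and> Curve u v \<subseteq> C \<union> D"
  then have "Curve u v = (Curve u v \<inter> C) \<union> (Curve u v \<inter> D)" by blast
  then have "\<not> (finite (Curve u v \<inter> C) \<and> finite (Curve u v \<inter> D))"
    using infinite_Curve[OF uv, where 'k = 'k] by (metis finite_Un)
  then show "Curve u v \<subseteq> C \<or> Curve u v \<subseteq> D" using closed_subset_Curve[OF uv] CD by blast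
qed

subsection \<open>Punctual ideals outside the two curvilinear charts\<close>

lemma muv_span:
  fixes u v :: coord and K :: "(coord, 'k::field) mpol set"
  assumes K: "is_ideal K" and uv: "u \<noteq> v"
    and m: "Var u ^ 2 - lin (mon (muv u v)) a \<in> K" "Var u * Var v - lin (mon (muv u v)) b \<in> K"
      "Var v ^ 2 - lin (mon (muv u v)) c \<in> K"
  shows "f \<in> mod_span K (mon (muv u v))"
proof -
  let ?S = "mod_span K (mon (muv u v))"
  have e: "1 \<in> ?S" "Var u \<in> ?S" "Var v \<in> ?S"
    using mod_span_basis[OF K, of "mon (muv u v)" 1] mod_span_basis[OF K, of "mon (muv u v)" 2]
      mod_span_basis[OF K, of "mon (muv u v)" 3] by (simp_all add: monom_sg)
  have "g \<in> ?S" if "g - lin (mon (muv u v)) w \<in> K" for g w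
    using mod_span_add[OF K mod_span_ideal[OF K that] mod_span_lin[OF K, of "mon (muv u v)" w]] by simp
  note m' = this[OF m(1)] this[OF m(2)] this[OF m(3)]
  have vu: "Var v * Var u \<in> ?S" using m'(2) by (simp only: mult.commute)
  have v: "Var v * monom (muv u v j) \<in> ?S" for j
    using exhaust_3[of j] e(3) vu m'(3) by (elim disjE) (simp_all add: monom_sg power2_eq_square)
  have u: "Var u * monom (muv u v j) \<in> ?S" for j
    using exhaust_3[of j] e(2) m'(1,2) by (elim disjE) (simp_all add: monom_sg power2_eq_square)
  show ?thesis
    by (rule mod_span_UNIV[OF K uv e(1)]) (erule mod_span_mult[OF K u], erule mod_span_mult[OF K v])
qed

text \<open>Lying outside the two other charts removes u from the expansion of v^2 and v from that
  of u^2. The syzygies v(uv) = u(v^2) and u(uv) = v(u^2) then relate the remaining coefficients, and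
  explicit solutions of the three relations are points of \<open>zeros I\<close>, hence 0.\<close>

lemma punctual_other:
  fixes u v :: coord and I :: "(coord, 'k::field) mpol set"
  assumes uv: "u \<noteq> v" and I: "I \<in> punctual_Hilb 3" "I \<notin> hchart (mvv v)" "I \<notin> hchart (mvv u)"
  shows "I = pcurve u v 1 0"
proof -
  have W: "I \<in> hchart (muv u v)" and z: "zeros I \<subseteq> {\<lambda>_. 0}"
    using Hilb_cover[of I u v] I uv by (auto simp: punctual_Hilb_def)
  note id = chart_ideal[OF W]
  let ?C = "hcoeff (muv u v) I" and ?lin = "lin (mon (muv u v)) :: 'k^3 \<Rightarrow> _"
  have self': "?C (muv u v i, muv u v j) = (if i = j then 1 else 0)" for i j
    by (rule chart_coeff_self[OF inj_muv[OF uv] W])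
  have self: "?C (0, muv u v j) = (if j = 1 then 1 else 0)" "?C (sg u (Suc 0), muv u v j) = (if j = 2 then 1 else 0)"
    "?C (sg v (Suc 0), muv u v j) = (if j = 3 then 1 else 0)" for j
    using self'[of 1 j] self'[of 2 j] self'[of 3 j] unfolding trip_simps
    by (simp_all only: eq_commute[of j])
  have "chdet (muv u v) (mvv w) I \<noteq> 0 \<longleftrightarrow> I \<in> hchart (mvv w)" for w
    using chart_change(1)[OF inj_muv[OF uv] inj_mvv W] by simp
  then have "chdet (muv u v) (mvv v) I = 0" "chdet (muv u v) (mvv u) I = 0"
    using I(2,3) by blast+
  \<comment> \<open>Up to sign these coefficients are the transition determinants to the charts of
    \<open>mvv v\<close> and \<open>mvv u\<close>.\<close>
  then have v2: "?C (sg v 2, muv u v 2) = 0" and u2: "?C (sg u 2, muv u v 3) = 0"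
    unfolding chdet_def det_3
    by (simp_all add: self[of 1, simplified] self[of 2, simplified] self[of 3, simplified])
  define \<gamma> \<beta> where "\<gamma> = ?C (sg v 2, muv u v 1)" and "\<beta> = ?C (sg v 2, muv u v 3)"
  define \<gamma>' \<beta>' where "\<gamma>' = ?C (sg u 2, muv u v 1)" and "\<beta>' = ?C (sg u 2, muv u v 2)"
  define c a b where "c = ?C (sg u 1 + sg v 1, muv u v 1)" and "a = ?C (sg u 1 + sg v 1, muv u v 2)"
    and "b = ?C (sg u 1 + sg v 1, muv u v 3)"
  define l1 l2 l3 where "l1 = (\<chi> j. ?C (sg u 2, muv u v j))" and "l2 = (\<chi> j. ?C (sg u 1 + sg v 1, muv u v j))"
    and "l3 = (\<chi> j. ?C (sg v 2, muv u v j))"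
  have L1: "?lin l1 = Const \<gamma>' + Const \<beta>' * Var u" and L2: "?lin l2 = Const c + Const a * Var u + Const b * Var v"
    and L3: "?lin l3 = Const \<gamma> + Const \<beta> * Var v"
    using u2 v2 by (simp_all add: lin_trip monom_sg l1_def l2_def l3_def \<gamma>_def \<beta>_def \<gamma>'_def \<beta>'_def a_def b_def c_def)
  note mem = chart_coeff_mem[OF inj_muv[OF uv] W]
  have e1: "Var u ^ 2 - ?lin l1 \<in> I" using mem[of "sg u 2"] by (simp add: l1_def monom_sg)
  have e2: "Var u * Var v - ?lin l2 \<in> I" using mem[of "sg u 1 + sg v 1"] by (simp add: l2_def monom_sg monom_add)
  have e3: "Var v ^ 2 - ?lin l3 \<in> I" using mem[of "sg v 2"] by (simp add: l3_def monom_sg)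
  have zero: "x = 0 \<and> y = 0 \<and> z = 0" if "Const x + Const y * Var u + Const z * Var v \<in> I" for x y z
  proof -
    have "?lin (\<chi> j. trip x y z j) \<in> I" using that by (simp add: lin_trip monom_sg)
    from chart_lin_eq_0[OF inj_muv[OF uv] W this] show ?thesis by (simp add: vec_eq_iff forall_3)
  qed
  have "(Var v * (Var u * Var v - ?lin l2) - Var u * (Var v ^ 2 - ?lin l3))
     - Const (\<beta> - a) * (Var u * Var v - ?lin l2) + Const b * (Var v ^ 2 - ?lin l3) \<in> I"
    by (intro ideal_add ideal_diff ideal_mult id e2 e3)
  also have "(Var v * (Var u * Var v - ?lin l2) - Var u * (Var v ^ 2 - ?lin l3))
     - Const (\<beta> - a) * (Var u * Var v - ?lin l2) + Const b * (Var v ^ 2 - ?lin l3) =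
     Const ((\<beta> - a) * c - b * \<gamma>) + Const (\<gamma> + (\<beta> - a) * a) * Var u + Const ((\<beta> - a) * b - b * \<beta> - c) * Var v"
    unfolding L2 L3 by (simp add: Const_add Const_diff Const_mult Const_uminus algebra_simps power2_eq_square)
  finally have r1: "\<gamma> + (\<beta> - a) * a = 0" "(\<beta> - a) * b - b * \<beta> - c = 0" using zero by blast+
  have "(Var u * (Var u * Var v - ?lin l2) - Var v * (Var u ^ 2 - ?lin l1))
     - Const (\<beta>' - b) * (Var u * Var v - ?lin l2) + Const a * (Var u ^ 2 - ?lin l1) \<in> I"
    by (intro ideal_add ideal_diff ideal_mult id e2 e1)
  also have "(Var u * (Var u * Var v - ?lin l2) - Var v * (Var u ^ 2 - ?lin l1))
     - Const (\<beta>' - b) * (Var u * Var v - ?lin l2) + Const a * (Var u ^ 2 - ?lin l1) =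
     Const ((\<beta>' - b) * c - a * \<gamma>') + Const ((\<beta>' - b) * a - a * \<beta>' - c) * Var u + Const (\<gamma>' + (\<beta>' - b) * b) * Var v"
    unfolding L1 L2 by (simp add: Const_add Const_diff Const_mult Const_uminus algebra_simps power2_eq_square)
  finally have r2: "\<gamma>' + (\<beta>' - b) * b = 0" using zero by blast
  have c: "c = - (a * b)" using r1(2) by (simp add: algebra_simps add_eq_0_iff)
  have pnt: "x = 0 \<and> y = 0"
    if h: "x ^ 2 = \<gamma>' + \<beta>' * x" "x * y = c + a * x + b * y" "y ^ 2 = \<gamma> + \<beta> * y" for x y
  proof -
    let ?P = "\<lambda>w. if w = v then y else x"
    have K: "is_ideal (I \<inter> {f. eval f ?P = 0})" using id by (auto simp: is_ideal_iff)
    have ev: "eval (Var u ^ 2 - ?lin l1) ?P = 0" "eval (Var u * Var v - ?lin l2) ?P = 0" "eval (Var v ^ 2 - ?lin l3) ?P = 0"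
      unfolding L1 L2 L3 using uv h by simp_all
    have "?P \<in> zeros I" unfolding zeros_def
    proof (intro CollectI ballI)
      fix f assume f: "f \<in> I"
      have "f \<in> mod_span (I \<inter> {f. eval f ?P = 0}) (mon (muv u v))"
        by (rule muv_span[OF K uv, where a = l1 and b = l2 and c = l3]) (use e1 e2 e3 ev in auto)
      then obtain w where w: "f - ?lin w \<in> I \<inter> {f. eval f ?P = 0}" unfolding mod_span_def by auto
      have "f - (f - ?lin w) \<in> I" using ideal_diff[OF id f] w by blast
      then have "w = 0" using chart_lin_eq_0[OF inj_muv[OF uv] W] by simp
      with w show "eval f ?P = 0" by simp
    qed
    then have "?P = (\<lambda>_. 0)" using z by blast
    from fun_cong[OF this, of u] fun_cong[OF this, of v] show ?thesis using uv by simp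
  qed
  \<comment> \<open>The syzygies give \<gamma> = a (a - \<beta>), \<gamma>' = b (b - \<beta>') and c
    = - a b, so (u, v) = (b, a) satisfies all three relations. Once a and b are 0, the points (0,
    \<beta>) and (\<beta>', 0) do so as well.\<close>
  have ab: "b = 0 \<and> a = 0"
    by (rule pnt) (use r1(1) r2 c in \<open>simp_all add: algebra_simps power2_eq_square add_eq_0_iff\<close>)
  then have g: "\<gamma> = 0" "\<gamma>' = 0" "c = 0" using r1 r2 c by auto
  have "\<beta> = 0" using pnt[of 0 \<beta>] ab g by (simp add: power2_eq_square)
  moreover have "\<beta>' = 0" using pnt[of \<beta>' 0] ab g by (simp add: power2_eq_square)
  ultimately have "?lin l1 = 0" "?lin l2 = 0" "?lin l3 = 0" using L1 L2 L3 ab g by simp_all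
  then show ?thesis using e1 e2 e3 by (intro muv_in_Curve[OF uv W]) simp_all
qed

subsection \<open>Classification\<close>

context induced
begin

lemma compat_chart:
  fixes b :: "3 \<Rightarrow> coord expo"
  assumes "compatibly_split (hilb_scheme 3) \<phi> Z" "inj b" "f \<in> hring b"
    and "\<And>I. I \<in> Z \<Longrightarrow> I \<in> hchart b \<Longrightarrow> f I = 0" and J: "J \<in> Z" "J \<in> hchart b"
  shows "\<phi> (hchart b) (cut (hchart b) f) J = 0"
proof -
  let ?W = "hchart b"
  have "cut ?W f \<in> regular (hilb_scheme 3) ?W"
    by (rule regular_alg[OF hilb_chart_alg[OF assms(2)] order_refl]) (use assms(3) in \<open>simp add: chart_ring_alg\<close>)
  then have "cut ?W f \<in> ideal_sheaf (hilb_scheme 3) Z ?W" using assms(4) by (simp add: ideal_sheaf_def)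
  with assms(1)[unfolded compatibly_split_def, THEN spec, THEN mp, OF hilb_open_chart[OF assms(2)]]
  have "\<phi> ?W (cut ?W f) \<in> ideal_sheaf (hilb_scheme 3) Z ?W" by (rule subsetD[OF _ imageI])
  with J show ?thesis by (simp add: ideal_sheaf_def)
qed

lemma phi_regular:
  fixes b :: "3 \<Rightarrow> coord expo"
  assumes "inj b" "f \<in> hring b"
  shows "\<phi> (hchart b) (cut (hchart b) f) \<in> regular (hilb_scheme 3) (hchart b)"
  by (rule split_regular[OF phi_split hilb_open_chart[OF assms(1)] regular_alg[OF hilb_chart_alg[OF assms(1)] order_refl]])
    (use assms(2) in \<open>simp add: chart_ring_alg\<close>)

lemma compat_in_Curve:
  fixes u v :: coord
  assumes uv: "u \<noteq> v" and Z: "compatibly_split (hilb_scheme 3) \<phi> Z" "Z \<subseteq> punctual_Hilb 3"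
    and I: "I \<in> Z" "I \<in> hchart (mvv v)"
  shows "I \<in> Curve u v"
proof -
  let ?C = "hcoeff (mvv v)" and ?W = "hchart (mvv v) :: (coord, 'k) mpol set set"
  define f where "f I = ?C I (sg v 3, sg v 2) * ?C I (sg u 1, sg v 1) ^ (CHAR('k) - 1) * ?C I (sg u 1, sg v 2)"
    for I :: "(coord, 'k) mpol set"
  have f: "f \<in> hring (mvv v)" unfolding f_def[abs_def] by (intro chart_ring_intros)
  have pz: "zeros J \<subseteq> {\<lambda>_. 0}" if "J \<in> Z" for J using Z(2) that by (auto simp: punctual_Hilb_def)
  have v3: "?C J (sg v 3, mvv v j) = 0" if "J \<in> Z" "J \<in> ?W" for J j
    by (rule punctual_mvv(1)[OF that(2) uv pz[OF that(1)]])
  have "\<phi> ?W (cut ?W f) I = 0"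
    by (rule compat_chart[OF Z(1) inj_mvv f _ I]) (use v3[of _ 3] in \<open>simp add: f_def\<close>)
  moreover have "\<phi> ?W (cut ?W f) I = - ?C I (sg u 1, sg v 1)"
  proof (rule extend_to_punctual[OF uv I(2) pz[OF I(1)] phi_regular[OF inj_mvv f]])
    show "(\<lambda>I. - ?C I (sg u 1, sg v 1)) \<in> hring (mvv v)" by (intro chart_ring_intros)
    show "\<phi> ?W (cut ?W f) (pts_ideal q) = - ?C (pts_ideal q) (sg u 1, sg v 1)" if "q \<in> good v (mvv v)" for q
      using phi_first[OF uv that] unfolding f_def .
  qed
  ultimately have "?C I (sg u 1, sg v 1) = 0" by simp
  from mvv_in_Curve[OF uv I(2) punctual_mvv(2)[OF I(2) uv pz[OF I(1)]] this v3[OF I]]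
  show ?thesis using CurveI[of "?C I (sg u 1, sg v 2)" 1 u v] by simp
qed

text \<open>Let x be the coefficient of v^2 in u. Giving u weight 1 and v weight 0 makes x
  homogeneous of weight 1, so x^(p-1) has weight p - 1, not divisible by p, and is killed, while x^p
  goes to x.\<close>

lemma compat_point_zero:
  fixes u v :: coord
  assumes uv: "u \<noteq> v" and Z: "compatibly_split (hilb_scheme 3) \<phi> {pcurve u v c 1}"
  shows "c = 0"
proof -
  let ?C = "hcoeff (mvv v)" and ?W = "hchart (mvv v) :: (coord, 'k) mpol set set"
  let ?n = "CHAR('k) - 1" and ?J = "pcurve u v c 1"
  have pn: "CHAR('k) = Suc ?n" using p_gt by simp
  define x where "x I = ?C I (sg u 1, mvv v 3)" for I :: "(coord, 'k) mpol set"
  have x: "x \<in> hring (mvv v)" unfolding x_def[abs_def] by (intro chart_ring_intros)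
  have xJ: "x ?J = c" unfolding x_def pcurve_mvv(2)[OF uv] using uv by (simp add: sg_eq_iff)
  define g where "g I = - c * x I ^ ?n" for I
  define f where "f I = x I ^ CHAR('k) + g I" for I
  have gr: "g \<in> hring (mvv v)" unfolding g_def[abs_def] by (intro chart_ring_intros x)
  have xpr: "(\<lambda>I. x I ^ CHAR('k)) \<in> hring (mvv v)" by (intro chart_ring_intros x)
  have fr: "f \<in> hring (mvv v)" unfolding f_def[abs_def] by (intro chart_ring_intros xpr gr)
  have oW: "openin (htop) ?W" by (rule hilb_open_chart[OF inj_mvv])
  have reg: "cut ?W h \<in> regular (hilb_scheme 3) ?W" if "h \<in> hring (mvv v)" for h
    by (rule regular_alg[OF hilb_chart_alg[OF inj_mvv] order_refl]) (use that in \<open>simp add: chart_ring_alg\<close>)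
  have J: "?J \<in> ?W" by (rule pcurve_mvv(1)[OF uv])
  have "f ?J = 0" unfolding f_def g_def xJ by (subst pn) simp
  then have 0: "\<phi> ?W (cut ?W f) ?J = 0" using compat_chart[OF Z inj_mvv fr, of ?J] J by simp
  have hom: "homog (mvv v) v (\<lambda>c. if c = u then 1 else 0) ?n g"
  proof -
    have "homog (mvv v) v (\<lambda>c. if c = u then 1 else 0) (wt (\<lambda>c. if c = u then 1 else 0) (sg u 1) - wt (\<lambda>c. if c = u then 1 else 0) (mvv v 3)) x"
      unfolding x_def[abs_def] by (rule homog_coeff[OF inj_mvv]) (use uv in simp)
    then have "homog (mvv v) v (\<lambda>c. if c = u then 1 else 0) 1 x" using uv by simp
    from homog_mult[OF homog_const[of _ _ _ "- c"] homog_power[OF this, of ?n]]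
    show ?thesis by (simp add: g_def[abs_def])
  qed
  have nd: "\<not> CHAR('k) dvd ?n" using p_gt by (intro nat_dvd_not_less) auto
  have "cut ?W f = (\<lambda>I. cut ?W (\<lambda>I. x I ^ CHAR('k)) I + cut ?W g I)"
    by (auto simp: cut_def f_def)
  then have "\<phi> ?W (cut ?W f) = (\<lambda>I. \<phi> ?W (cut ?W (\<lambda>I. x I ^ CHAR('k))) I + \<phi> ?W (cut ?W g) I)"
    using split_add[OF phi_split oW reg[OF xpr] reg[OF gr]] by simp
  moreover have "cut ?W (\<lambda>I. x I ^ CHAR('k)) = (\<lambda>I. cut ?W x I ^ CHAR('k))"
    using p_gt by (auto simp: cut_def)
  ultimately have \<phi>f: "\<phi> ?W (cut ?W f) = (\<lambda>I. cut ?W x I + \<phi> ?W (cut ?W g) I)"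
    using split_pow[OF phi_split oW reg[OF x]] by simp
  have "?J \<in> punctual_Hilb 3" by (rule Curve_punctual[OF uv CurveI]) simp
  then have z: "zeros ?J \<subseteq> {\<lambda>_. 0}" by (simp add: punctual_Hilb_def)
  have "\<phi> ?W (cut ?W f) ?J = x ?J"
  proof (rule extend_to_punctual[OF uv J z phi_regular[OF inj_mvv fr] x])
    fix q :: "3 \<times> coord \<Rightarrow> 'k" assume q: "q \<in> good v (mvv v)"
    then have "pts_ideal q \<in> ?W" using pts_chart[OF inj_mvv[of v], of q] by (simp add: good_def)
    then show "\<phi> ?W (cut ?W f) (pts_ideal q) = x (pts_ideal q)"
      unfolding \<phi>f using phi_kills[OF uv inj_mvv gr hom nd q] by simp
  qed
  with 0 xJ show ?thesis by simp
qed

lemma subvarieties_of_Curve: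
  fixes u v :: coord
  assumes uv: "u \<noteq> v" and Z: "subvariety (hilb_scheme 3) Z" "compatibly_split (hilb_scheme 3) \<phi> Z" "Z \<subseteq> Curve u v"
  shows "Z = Curve u v \<or> Z = {pcurve u v 0 1} \<or> Z = {pcurve u v 1 0}"
proof (cases "Curve u v \<subseteq> Z")
  case True
  with Z(3) show ?thesis by blast
next
  case False
  moreover have "closedin (htop) Z" using Z(1) by (simp add: subvariety_def)
  ultimately have "finite (Curve u v \<inter> Z)" using closed_subset_Curve[OF uv] by blast
  then have "finite Z" using Z(3) by (simp add: Int_absorb1)
  then obtain I where I: "Z = {I}" using subvariety_finite[OF Z(1)] by blast
  consider \<alpha> where "I = pcurve u v \<alpha> 1" | "I = pcurve u v 1 0" using I Z(3) by (auto simp: Curve_eq)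
  then show ?thesis
  proof cases
    case 1
    then have "\<alpha> = 0" using compat_point_zero[OF uv] Z(2) I by simp
    with 1 I show ?thesis by simp
  qed (use I in simp)
qed

theorem classification:
  "subvariety (hilb_scheme 3) Z \<and> compatibly_split (hilb_scheme 3) \<phi> Z \<and> Z \<subseteq> punctual_Hilb 3 \<longleftrightarrow>
   Z \<in> {Curve X Y, Curve Y X, {pcurve X Y 0 1}, {pcurve X Y 1 0}, {pcurve Y X 0 1}}"
proof
  have XY: "X \<noteq> Y" "Y \<noteq> X" by simp_all
  {
    assume Z: "subvariety (hilb_scheme 3) Z \<and> compatibly_split (hilb_scheme 3) \<phi> Z \<and> Z \<subseteq> punctual_Hilb 3"
    have sub: "Z \<subseteq> Curve X Y \<union> Curve Y X"
    proof
      fix I assume I: "I \<in> Z"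
      show "I \<in> Curve X Y \<union> Curve Y X"
      proof (cases "I \<in> hchart (mvv Y) \<or> I \<in> hchart (mvv X)")
        case True
        then show ?thesis using compat_in_Curve[OF XY(1) _ _ I] compat_in_Curve[OF XY(2) _ _ I] Z by blast
      next
        case False
        then have "I = pcurve X Y 1 0" using punctual_other[OF XY(1), of I] Z I by blast
        then show ?thesis by (auto intro!: CurveI)
      qed
    qed
    have irr: "\<forall>C D. closedin (htop) C \<and> closedin (htop) D \<and> Z \<subseteq> C \<union> D
        \<longrightarrow> Z \<subseteq> C \<or> Z \<subseteq> D"
      using Z unfolding subvariety_def by (elim conjE)
    note irr[THEN spec, THEN spec, THEN mp, OF conjI[OF closed_Curve[OF XY(1)] conjI[OF closed_Curve[OF XY(2)] sub]]]
    then have "(Z = Curve X Y \<or> Z = {pcurve X Y 0 1} \<or> Z = {pcurve X Y 1 0}) \<or>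
        (Z = Curve Y X \<or> Z = {pcurve Y X 0 1} \<or> Z = {pcurve Y X 1 0})"
    proof
      assume "Z \<subseteq> Curve X Y"
      with Z show ?thesis by (intro disjI1 subvarieties_of_Curve[OF XY(1)]) (elim conjE, assumption)+
    next
      assume "Z \<subseteq> Curve Y X"
      with Z show ?thesis by (intro disjI2 subvarieties_of_Curve[OF XY(2)]) (elim conjE, assumption)+
    qed
    \<comment> \<open>The square of the maximal ideal occurs on both curves, which leaves three
      points in all.\<close>
    then show "Z \<in> {Curve X Y, Curve Y X, {pcurve X Y 0 1}, {pcurve X Y 1 0}, {pcurve Y X 0 1}}"
      unfolding pcurve_swap[of Y X] by (elim disjE) simp_all
  }
  have "{pcurve u v \<alpha> \<beta>} \<subseteq> punctual_Hilb 3 \<and> subvariety (hilb_scheme 3) {pcurve u v \<alpha> \<beta>}"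
    if "u \<noteq> v" "(\<alpha>, \<beta>) \<noteq> (0, 0)" for u v and \<alpha> \<beta> :: 'k
    using Curve_punctual[OF that(1) CurveI[OF that(2)]] subvariety_point[OF Curve_Hilb(2)[OF that(1) CurveI[OF that(2)]]]
    by blast
  note pt = this[OF XY(1), of 0 1] this[OF XY(1), of 1 0] this[OF XY(2), of 0 1]
  assume "Z \<in> {Curve X Y, Curve Y X, {pcurve X Y 0 1}, {pcurve X Y 1 0}, {pcurve Y X 0 1}}"
  then consider "Z = Curve X Y" | "Z = Curve Y X" | "Z = {pcurve X Y 0 1}" | "Z = {pcurve X Y 1 0}" | "Z = {pcurve Y X 0 1}"
    by blast
  then show "subvariety (hilb_scheme 3) Z \<and> compatibly_split (hilb_scheme 3) \<phi> Z \<and> Z \<subseteq> punctual_Hilb 3"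
  proof cases
    case 1
    then show ?thesis using subvariety_Curve[OF XY(1)] compat_Curve[OF XY(1)] Curve_punctual[OF XY(1)] by blast
  next
    case 2
    then show ?thesis using subvariety_Curve[OF XY(2)] compat_Curve[OF XY(2)] Curve_punctual[OF XY(2)] by blast
  next
    case 3
    then show ?thesis using pt(1) compat_point_mvv[OF XY(1)] by simp
  next
    case 4
    then show ?thesis using pt(2) compat_point_muv[OF XY(1)] by simp
  next
    case 5
    then show ?thesis using pt(3) compat_point_mvv[OF XY(2)] by simp
  qed
qed

end

section \<open>The curves and points in terms of generators\<close>

lemma Curve_eq_ideal_gen:
  fixes u v :: coord
  assumes uv: "u \<noteq> v"
  shows "{ideal_gen {Var v ^ 3, Var u * Var v, Var u ^ 2, Const a * Var v ^ 2 + Const b * Var u} | a b. (a, b) \<noteq> (0, 0)} =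
    (Curve u v :: (coord, 'k::field) mpol set set)" (is "?L = _")
proof
  show "?L \<subseteq> Curve u v"
  proof
    fix I assume "I \<in> ?L"
    then obtain a b where ab: "(a, b) \<noteq> (0 :: 'k, 0)"
      "I = ideal_gen {Var v ^ 3, Var u * Var v, Var u ^ 2, Const a * Var v ^ 2 + Const b * Var u}" by blast
    then have "I = pcurve u v a (- b)" using pcurve_eq_ideal_gen[OF uv ab(1)] by simp
    then show "I \<in> Curve u v" using ab(1) by (auto intro!: CurveI)
  qed
  show "Curve u v \<subseteq> ?L"
  proof
    fix I :: "(coord, 'k) mpol set" assume "I \<in> Curve u v"
    then obtain a b where ab: "(a, b) \<noteq> (0, 0)" "I = pcurve u v a b" by (auto simp: Curve_def)
    have ab': "(a, - b) \<noteq> (0, 0)" using ab(1) by simp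
    from pcurve_eq_ideal_gen[OF uv ab'] ab'
    show "I \<in> ?L" unfolding ab(2) by (intro CollectI exI[of _ a] exI[of _ "- b"]) simp
  qed
qed

lemma pcurve_0_1_eq_ideal_gen:
  fixes u v :: coord
  assumes uv: "u \<noteq> v"
  shows "ideal_gen {Var u, Var v ^ 3} = (pcurve u v 0 1 :: (coord, 'k::field) mpol set)"
proof
  show "ideal_gen {Var u, Var v ^ 3} \<subseteq> (pcurve u v 0 1 :: (coord, 'k) mpol set)"
    by (rule ideal_gen_minimal[OF _ pcurve_ideal[OF uv]])
      (use uv in \<open>simp add: pcurve_def lookup_Var lookup_Var_power sg_eq_iff sg_neq\<close>)
  let ?G = "ideal_gen {Var u, Var v ^ 3} :: (coord, 'k) mpol set"
  have u: "Var u \<in> ?G" and v: "Var v ^ 3 \<in> ?G" by (simp_all add: ideal_gen_base)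
  have "pcurve u v 0 (- 1) \<subseteq> ?G"
  proof (rule pcurve_gen[OF uv _ is_ideal_gen v])
    show "Var u * Var v \<in> ?G" by (rule ideal_mult_right[OF is_ideal_gen u])
    show "Var u ^ 2 \<in> ?G" unfolding power2_eq_square by (rule ideal_mult[OF is_ideal_gen u])
  qed (use u in simp_all)
  then show "pcurve u v 0 1 \<subseteq> ?G" using pcurve_scale[of "- 1 :: 'k" u v 0 1] by simp
qed

lemma pcurve_1_0_eq_ideal_gen:
  fixes u v :: coord
  assumes uv: "u \<noteq> v"
  shows "ideal_gen {Var u ^ 2, Var u * Var v, Var v ^ 2} = (pcurve u v 1 0 :: (coord, 'k::field) mpol set)"
proof
  let ?G = "ideal_gen {Var u ^ 2, Var u * Var v, Var v ^ 2} :: (coord, 'k) mpol set"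
  have g: "Var u ^ 2 \<in> ?G" "Var u * Var v \<in> ?G" "Var v ^ 2 \<in> ?G" by (simp_all add: ideal_gen_base)
  have "Var v * Var v ^ 2 \<in> ?G" by (rule ideal_mult[OF is_ideal_gen g(3)])
  then have v3: "Var v ^ 3 \<in> ?G" by (simp add: power3_eq_cube power2_eq_square mult.assoc)
  have "pcurve u v 1 (- 0) \<subseteq> ?G"
    by (rule pcurve_gen[OF uv _ is_ideal_gen v3 g(2,1)]) (use g(3) in simp_all)
  then show "pcurve u v 1 0 \<subseteq> ?G" by simp
  have "Var u ^ 2 \<in> pcurve u v 1 (0 :: 'k)" "Var v ^ 2 \<in> pcurve u v 1 (0 :: 'k)"
    using uv by (simp_all add: pcurve_def lookup_Var_power sg_eq_iff sg_neq)
  moreover have "Var u * Var v \<in> pcurve u v 1 (0 :: 'k)"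
  proof -
    have "Var u * Var v \<in> ideal_gen {Var v ^ 3, Var u * Var v, Var u ^ 2, Const (1 :: 'k) * Var v ^ 2 + Const 0 * Var u}"
      by (rule ideal_gen_base) simp
    then show ?thesis by (subst (asm) pcurve_eq_ideal_gen[OF uv]) simp_all
  qed
  ultimately show "?G \<subseteq> pcurve u v 1 0"
    by (intro ideal_gen_minimal[OF _ pcurve_ideal[OF uv]]) simp
qed

theorem proposition2p2p2:
  fixes \<psi> :: "(3 \<times> coord \<Rightarrow> 'k::alg_closed_field, 'k) sheaf_map"
    and \<sigma> :: "((coord \<Rightarrow> 'k) multiset, 'k) sheaf_map"
    and \<phi> :: "((coord, 'k) mpol set, 'k) sheaf_map"
    and x y :: "(coord, 'k) mpol"
  assumes "CHAR('k) > fact 3"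
    and "standard_splitting \<psi>"
    and "quotient_splitting \<psi> \<sigma>"
    and "induced_splitting TYPE(3) \<sigma> \<phi>"
  defines "x \<equiv> Var X" and "y \<equiv> Var Y"
  shows "{Z. subvariety (hilb_scheme 3) Z \<and> compatibly_split (hilb_scheme 3) \<phi> Z \<and>
             Z \<subseteq> punctual_Hilb 3} =
    { {ideal_gen {y^3, x * y, x^2, Const a * y^2 + Const b * x} | a b. (a, b) \<noteq> (0, 0)},
      {ideal_gen {y^2, x * y, x^3, Const a * x^2 + Const b * y} | a b. (a, b) \<noteq> (0, 0)},
      {ideal_gen {x, y^3}},
      {ideal_gen {x^2, x * y, y^2}},
      {ideal_gen {x^3, y}} }"
proof -
  interpret induced \<psi> \<sigma> \<phi> by standard (use assms(1-4) in auto)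
  have 1: "{ideal_gen {y^3, x * y, x^2, Const a * y^2 + Const b * x} | a b. (a, b) \<noteq> (0, 0)} = Curve X Y"
    unfolding x_def y_def by (rule Curve_eq_ideal_gen) simp
  have "{y^2, x * y, x^3, c} = {x^3, y * x, y^2, c}" for c
    unfolding mult.commute[of x y] by (simp only: insert_commute)
  then have 2: "{ideal_gen {y^2, x * y, x^3, Const a * x^2 + Const b * y} | a b. (a, b) \<noteq> (0, 0)} = Curve Y X"
    unfolding x_def y_def using Curve_eq_ideal_gen[of Y X, where 'k = 'k] by simp
  have 3: "ideal_gen {x, y^3} = pcurve X Y 0 1"
    unfolding x_def y_def by (rule pcurve_0_1_eq_ideal_gen) simp
  have 4: "ideal_gen {x^2, x * y, y^2} = pcurve X Y 1 0"
    unfolding x_def y_def by (rule pcurve_1_0_eq_ideal_gen) simp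
  have 5: "ideal_gen {x^3, y} = pcurve Y X 0 1"
    unfolding x_def y_def insert_commute[of "Var X ^ 3"] by (rule pcurve_0_1_eq_ideal_gen) simp
  show ?thesis unfolding 1 2 3 4 5 classification by (rule Collect_mem_eq)
qed

end
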